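(* Let $d\ge 1$ be an integer and let $\alpha \in (d-1,d]$. There exists a constant $C_5=C_5(\alpha,d)>0$ such that $$\int_0^\infty \mathcal{H}^{d-\alpha}_\infty\left(\{x\in\mathbb{R}^d : \mathrm{M}(\mathrm{I}_\alpha F)(x)>t\}\right)\,dt \leq C_5\,|F|(\mathbb{R}^d)$$ for all $F \in M_b(\mathbb{R}^d;\mathbb{R}^d)$ such that $\operatorname{div}F=0$ in the sense of distributions.
   Context: $M_b(\mathbb{R}^d;\mathbb{R}^d)$ is the space of $\mathbb{R}^d$-valued Borel measures on $\mathbb{R}^d$ of bounded total variation, and $|F|$ denotes the total variation measure of $F$. $\operatorname{div}F=0$ means $\int_{\mathbb{R}^d}\nabla\varphi\cdot dF=0$ for all $\varphi\in C_c^\infty(\mathbb{R}^d)$. $\mathrm{I}_\alpha$ denotes the Riesz potential of order $\alpha$, applied componentwise: for $\alpha\in(0,d)$, $\mathrm{I}_\alpha F(x)=c_{d,\alpha}\int_{\mathbb{R}^d}\frac{dF(y)}{|x-y|^{d-\alpha}}$ with the usual normalizing constant $c_{d,\alpha}>0$ (the integral converges absolutely for Lebesgue a.e. $x$). For $\alpha=d$ the kernel $c_{d,\alpha}|x|^{\alpha-d}$ is replaced by the logarithmic kernel $-c_d\log|x|$, $c_d>0$ a dimensional constant. The formula is used at points where the integral converges absolutely, and $\mathrm{I}_\alpha F$ is set to $0$ elsewhere. $\mathrm{M}$ is the Hardy–Littlewood maximal function: $\mathrm{M}f(x)=\sup_{r>0}\frac{1}{|B(x,r)|}\int_{B(x,r)}|f(y)|\,dy$,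 where $|f(y)|$ is the Euclidean norm for vector-valued $f$. For $\beta\ge 0$, $\mathcal{H}^\beta_\infty$ is the Hausdorff content: $\mathcal{H}^\beta_\infty(E)=\inf\{\sum_i r_i^\beta : E\subset\bigcup_i B(x_i,r_i)\}$, the infimum over countable (possibly finite) covers by balls (up to an immaterial normalizing constant; $r^0=1$). *)

theory Defs
  imports "HOL-Analysis.Analysis"
begin

subsection \<open>Vector-valued Borel measures\<close>

text \<open>A vector measure is encoded as a set function; only its values on Borel sets matter.
  Countable additivity forces the value \<open>0\<close> on the empty set.\<close>

definition vector_measure :: "('a::topological_space set \<Rightarrow> 'b::real_normed_vector) \<Rightarrow> bool" where
  "vector_measure F \<longleftrightarrow>
    (\<forall>A :: nat \<Rightarrow> 'a set. range A \<subseteq> sets borel \<longrightarrow> disjoint_family A \<longrightarrow>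
      (\<lambda>n. F (A n)) sums F (\<Union>n. A n))"

definition total_variation ::
    "('a::topological_space set \<Rightarrow> 'b::real_normed_vector) \<Rightarrow> 'a set \<Rightarrow> ennreal" where
  "total_variation F A =
    (SUP E \<in> {E :: nat \<Rightarrow> 'a set. range E \<subseteq> sets borel \<and> disjoint_family E \<and> (\<Union>n. E n) = A}.
      \<Sum>n. ennreal (norm (F (E n))))"

definition bounded_vector_measures ::
    "('a::topological_space set \<Rightarrow> 'b::real_normed_vector) set" where
  "bounded_vector_measures = {F. vector_measure F \<and> total_variation F UNIV < \<infinity>}"

text \<open>For a vector measure, \<^const>\<open>total_variation\<close> is countably additive on Borel sets, so
  \<^const>\<open>measure_of\<close> does not fall back to the null measure, here or in the next definition.\<close>

definition variation_measure ::
    "('a::topological_space set \<Rightarrow> 'b::real_normed_vector) \<Rightarrow> 'a measure" where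
  "variation_measure F = measure_of UNIV (sets borel) (total_variation F)"

text \<open>Positive part \<open>(\<bar>m\<bar> + m) / 2\<close> in the Jordan decomposition of a finite signed
  measure \<open>m\<close>; the negative part of \<open>m\<close> is the positive part of \<open>-m\<close>.\<close>

definition jordan_pos :: "('a::topological_space set \<Rightarrow> real) \<Rightarrow> 'a measure" where
  "jordan_pos m =
    measure_of UNIV (sets borel) (\<lambda>A. ennreal ((enn2real (total_variation m A) + m A) / 2))"

definition signed_integral ::
    "('a::topological_space set \<Rightarrow> real) \<Rightarrow> ('a \<Rightarrow> real) \<Rightarrow> real" where
  "signed_integral m g =
    (LINT y|jordan_pos m. g y) - (LINT y|jordan_pos (\<lambda>A. - m A). g y)"


subsection \<open>Distributional divergence\<close>

definition partial_deriv :: "'n::finite \<Rightarrow> (real ^ 'n \<Rightarrow> real) \<Rightarrow> real ^ 'n \<Rightarrow> real" where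
  "partial_deriv i f x = frechet_derivative f (at x) (axis i 1)"

fun Ck_function :: "nat \<Rightarrow> (real ^ 'n::finite \<Rightarrow> real) \<Rightarrow> bool" where
  "Ck_function 0 f \<longleftrightarrow> continuous_on UNIV f"
| "Ck_function (Suc k) f \<longleftrightarrow>
    (\<forall>x. f differentiable (at x)) \<and> (\<forall>i. Ck_function k (partial_deriv i f))"

definition test_functions :: "(real ^ 'n::finite \<Rightarrow> real) set" where
  "test_functions = {\<phi>. (\<forall>k. Ck_function k \<phi>) \<and> compact (closure {x. \<phi> x \<noteq> 0})}"

definition divergence_free :: "((real ^ 'n::finite) set \<Rightarrow> real ^ 'n) \<Rightarrow> bool" where
  "divergence_free F \<longleftrightarrow>
    (\<forall>\<phi> \<in> test_functions. (\<Sum>i\<in>UNIV. signed_integral (\<lambda>A. F A $ i) (partial_deriv i \<phi>)) = 0)"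


subsection \<open>Riesz potentials\<close>

text \<open>The order \<open>\<alpha>\<close> ranges over \<open>(0, d]\<close>, where \<open>d\<close> is the dimension. The logarithmic
  constant is the one for which the kernel is the fundamental solution of
  \<open>(-\<Delta>)\<close> to the power \<open>d/2\<close>, i.e. the limit of the constants \<open>(d - \<alpha>) c\<^sub>d\<^sub>,\<^sub>\<alpha>\<close> as
  \<open>\<alpha>\<close> tends to \<open>d\<close>. The value at the origin, where the true kernel is infinite, is junk.\<close>

definition riesz_kernel :: "real \<Rightarrow> real ^ 'n::finite \<Rightarrow> real" where
  "riesz_kernel \<alpha> x =
    (let d = real CARD('n) in
     if \<alpha> = d then - (1 / (2 powr (d - 1) * pi powr (d / 2) * Gamma (d / 2))) * ln (norm x)
     else Gamma ((d - \<alpha>) / 2) / (pi powr (d / 2) * 2 powr \<alpha> * Gamma (\<alpha> / 2))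
            * norm x powr (\<alpha> - d))"

text \<open>Since the kernel is infinite at the origin, the integral diverges at every atom of
  \<open>\<bar>F\<bar>\<close>; the first conjunct records this.\<close>

definition riesz_converges ::
    "real \<Rightarrow> ((real ^ 'n::finite) set \<Rightarrow> real ^ 'n) \<Rightarrow> real ^ 'n \<Rightarrow> bool" where
  "riesz_converges \<alpha> F x \<longleftrightarrow>
    emeasure (variation_measure F) {x} = 0 \<and>
    integrable (variation_measure F) (\<lambda>y. riesz_kernel \<alpha> (x - y))"

definition riesz_potential ::
    "real \<Rightarrow> ((real ^ 'n::finite) set \<Rightarrow> real ^ 'n) \<Rightarrow> real ^ 'n \<Rightarrow> real ^ 'n" where
  "riesz_potential \<alpha> F x =
    (if riesz_converges \<alpha> F x
     then (\<chi> i. signed_integral (\<lambda>A. F A $ i) (\<lambda>y. riesz_kernel \<alpha> (x - y)))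
     else 0)"


subsection \<open>Maximal function and Hausdorff content\<close>

definition maximal_function ::
    "('a::euclidean_space \<Rightarrow> 'b::real_normed_vector) \<Rightarrow> 'a \<Rightarrow> ennreal" where
  "maximal_function f x =
    (SUP r \<in> {0<..}.
      (\<integral>\<^sup>+y\<in>ball x r. ennreal (norm (f y)) \<partial>lborel) / emeasure lborel (ball x r))"

text \<open>The index set \<open>I\<close> may be finite or empty, so that the content of the empty set is \<open>0\<close>
  also for \<open>\<beta> = 0\<close>. Radii are positive, so \<open>r powr 0 = 1\<close>.\<close>

definition hausdorff_content :: "real \<Rightarrow> 'a::metric_space set \<Rightarrow> ennreal" where
  "hausdorff_content \<beta> E =
    Inf {(\<Sum>\<^sub>\<infinity>i\<in>I. ennreal (r i powr \<beta>)) | (I :: nat set) (x :: nat \<Rightarrow> 'a) (r :: nat \<Rightarrow> real).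
      (\<forall>i\<in>I. r i > 0) \<and> E \<subseteq> (\<Union>i\<in>I. ball (x i) (r i))}"

end

theory Submission
  imports Defs "HOL-Probability.Distributions" "HOL-Computational_Algebra.Polynomial"
begin

text \<open>
  Put \<open>d = CARD('n)\<close> and \<open>\<beta> = d - \<alpha>\<close>, so that \<open>0 \<le> \<beta> < 1\<close>, and let \<open>G i r\<close> be the \<open>i\<close>-th component
  of \<open>F\<close>, convolved with a normalized Gaussian of width \<open>r\<close>. For a point mass and \<open>\<beta> > 0\<close> the estimate
  fails: the potential is of size \<open>\<bar>x\<bar>\<close> to the power \<open>-\<beta>\<close>, the content of the set where it exceeds \<open>t\<close>
  is of order \<open>1 / t\<close>, and the integral over \<open>t\<close> diverges logarithmically. A divergence-free measure cannot concentrate in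
  this way, and a quantitative form of that fact, summed over all scales, gives the theorem.

  \<^item> \<^emph>\<open>One scale.\<close> If the components of the smoothed field have constant signs in a box of radius \<open>R\<close>,
    then the divergence can be tested with a product of one-dimensional ramps that rise steeply in a
    concentric box of radius \<open>\<theta> R\<close> and descend slowly in the rest of the large box. The inner box
    then carries at most a multiple of \<open>\<theta>\<close> of the mass of the outer one. Without the sign condition
    the mass of the wrong sign has to be added (\<open>local_estimate\<close>).

  \<^item> \<^emph>\<open>The price of cancellation.\<close> Smoothing \<open>\<bar>G i (\<theta> * R)\<bar>\<close> to width \<open>R\<close> gives at least \<open>\<bar>G i R\<bar>\<close>. The
    difference is the defect. It is twice the smaller one of the smoothed positive and negative
    parts (\<open>defect_eq_min\<close>), so it controls the mass of the wrong sign; and its integral is a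
    difference of \<open>L\<^sup>1\<close> norms (\<open>integral_defect\<close>), so that the sum over all scales
    \<open>R = \<theta> powi k\<close> telescopes and is bounded by the total variation. For the mass \<open>a R\<close> of the field
    smoothed at width \<open>R\<close> in the box of radius \<open>R\<close> this gives
    \<open>a (\<theta> * R) \<le> C * (\<theta> * a R + defect)\<close> (\<open>scale_recursion\<close>). Since \<open>\<beta> < 1\<close>, a small \<open>\<theta>\<close> makes
    \<open>C * \<theta> powr (1 - \<beta>)\<close> at most \<open>1 / 2\<close>, and iteration from arbitrarily large scales bounds
    \<open>R powr - \<beta> * a R\<close> by a geometrically weighted sum of normalized defects at larger
    scales (\<open>iterated_recursion\<close>).

  \<^item> \<^emph>\<open>The potential.\<close> Up to an affine change the Riesz kernel, also the logarithmic one, is a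
    superposition of differences of Gaussians (\<open>gauss_representation\<close>). The additive constants
    do not matter because the total flux of \<open>F\<close> vanishes (\<open>total_flux_zero\<close>). Hence the potential is
    bounded by a weighted sum of the \<open>\<bar>G i r x\<bar>\<close> over all widths, and by the preceding step by a sum
    of integrals of defects over boxes around \<open>x\<close> (\<open>integral_scales\<close>).

  \<^item> \<^emph>\<open>Maximal function and content.\<close> The average of such a box integral over a ball is dominated by
    integrals over larger boxes with geometrically small weights (\<open>average_box_mass_le\<close>), and a box
    integral is dominated by a sum of multiples of indicators of dyadic cubes
    (\<open>atomic_bound_box_mass\<close>). As two dyadic cubes are nested or disjoint, the dyadic content is
    strongly subadditive, and the Choquet integral of such a sum is at most a constant times the
    sum of coefficient times diameter to the power \<open>\<beta>\<close> (\<open>choquet_series\<close>). The powers of the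
    scale cancel, and what remains is the telescoping sum of the defects.
\<close>

section \<open>Total variation and the Jordan decomposition\<close>

lemma vector_measure_sums:
  assumes "vector_measure F" "range A \<subseteq> sets borel" "disjoint_family A"
  shows "(\<lambda>n. F (A n)) sums F (\<Union>n. A n)"
  using assms by (auto simp: vector_measure_def)

lemma vector_measure_empty: "vector_measure F \<Longrightarrow> F {} = 0"
proof -
  assume F: "vector_measure F"
  have "(\<lambda>n. F {}) sums F (\<Union>n::nat. {})"
    by (rule vector_measure_sums[OF F]) (auto simp: disjoint_family_on_def)
  then have "summable (\<lambda>n::nat. F {})" by (auto simp: sums_iff)
  then show ?thesis by (simp add: summable_const_iff)
qed

lemma total_variation_le:
  assumes "\<And>E. range E \<subseteq> sets borel \<Longrightarrow> disjoint_family E \<Longrightarrow> (\<Union>n. E n) = A \<Longrightarrow>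
    (\<Sum>n. ennreal (norm (F (E n)))) \<le> c"
  shows "total_variation F A \<le> c"
  unfolding total_variation_def using assms by (intro SUP_least) (elim CollectE conjE)

lemma total_variation_ge:
  assumes "range E \<subseteq> sets borel" "disjoint_family E" "(\<Union>n. E n) = A"
  shows "(\<Sum>n. ennreal (norm (F (E n)))) \<le> total_variation F A"
  unfolding total_variation_def by (rule SUP_upper) (intro CollectI conjI assms)

lemma trivial_partition:
  assumes "A \<in> sets borel"
  shows "range (\<lambda>n::nat. if n = 0 then A else {}) \<subseteq> sets borel"
    "disjoint_family (\<lambda>n::nat. if n = 0 then A else {})"
    "(\<Union>n::nat. if n = 0 then A else {}) = A"
proof -
  show "range (\<lambda>n::nat. if n = 0 then A else {}) \<subseteq> sets borel"
    using assms by (intro image_subsetI) simp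
  show "disjoint_family (\<lambda>n::nat. if n = 0 then A else {})"
    by (simp add: disjoint_family_on_def)
  have "A \<subseteq> (\<Union>n::nat. if n = 0 then A else {})"
    using UN_upper[of "0::nat" UNIV "\<lambda>n. if n = 0 then A else {}"] by simp
  moreover have "(\<Union>n::nat. if n = 0 then A else {}) \<subseteq> A"
    by (rule UN_least) simp
  ultimately show "(\<Union>n::nat. if n = 0 then A else {}) = A" by simp
qed

lemma term_le_suminf: "a p \<le> suminf a" for a :: "nat \<Rightarrow> ennreal"
  using sum_le_suminf[of a "{p}"] by auto

lemma norm_le_total_variation:
  assumes F: "vector_measure F" and A: "A \<in> sets borel"
  shows "ennreal (norm (F A)) \<le> total_variation F A"
proof -
  define E where "E n = (if n = 0 then A else {})" for n :: nat
  have "(\<Sum>n. ennreal (norm (F (E n)))) \<le> total_variation F A"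
    unfolding E_def by (intro total_variation_ge trivial_partition A)
  moreover have "ennreal (norm (F (E 0))) \<le> (\<Sum>n. ennreal (norm (F (E n))))"
    by (rule term_le_suminf)
  ultimately show ?thesis by (simp add: E_def)
qed

text \<open>Near-optimal partitions of the pieces, with errors that sum to \<open>e\<close>, are merged into one
  partition of the union.\<close>

lemma total_variation_superadditive:
  assumes F: "vector_measure F" and A: "range A \<subseteq> sets borel" "disjoint_family A"
    and fin: "\<And>n. total_variation F (A n) < \<infinity>"
  shows "(\<Sum>n. total_variation F (A n)) \<le> total_variation F (\<Union>n. A n)"
proof (rule ennreal_le_epsilon)
  fix e :: real assume e: "0 < e"
  have "\<exists>E. range E \<subseteq> sets borel \<and> disjoint_family E \<and> (\<Union>m. E m) = A n \<and>
      total_variation F (A n) \<le> (\<Sum>m. ennreal (norm (F (E m)))) + ennreal (e * (1/2) ^ Suc n)" for n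
  proof (cases "total_variation F (A n) = 0")
    case True
    show ?thesis
      unfolding True
      by (intro exI[of _ "\<lambda>m::nat. if m = 0 then A n else {}"] conjI trivial_partition
            range_subsetD[OF A(1)]) simp
  next
    case False
    then obtain c where c: "c < total_variation F (A n)" "total_variation F (A n) \<le> c + ennreal (e * (1/2) ^ Suc n)"
    proof -
      define t where "t = enn2real (total_variation F (A n))"
      have t: "total_variation F (A n) = ennreal t" "0 < t"
        using fin[of n] False by (auto simp: t_def enn2real_positive_iff less_top zero_less_iff_neq_zero)
      show thesis
      proof (rule that[of "ennreal (max 0 (t - e * (1/2) ^ Suc n))"])
        show "ennreal (max 0 (t - e * (1/2) ^ Suc n)) < total_variation F (A n)"
          using t e by (auto simp: ennreal_less_iff)
        show "total_variation F (A n) \<le> ennreal (max 0 (t - e * (1/2) ^ Suc n)) + ennreal (e * (1/2) ^ Suc n)"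
          unfolding t using e by (subst ennreal_plus[symmetric]) (auto intro!: ennreal_leI simp del: ennreal_plus)
      qed
    qed
    from c(1) obtain E where E: "E \<in> {E. range E \<subseteq> sets borel \<and> disjoint_family E \<and> (\<Union>m. E m) = A n}"
      "c < (\<Sum>m. ennreal (norm (F (E m))))"
      unfolding total_variation_def[of F "A n"] less_SUP_iff by (elim bexE)
    from E(2) have "total_variation F (A n) \<le> (\<Sum>m. ennreal (norm (F (E m)))) + ennreal (e * (1/2) ^ Suc n)"
      by (intro order.trans[OF c(2)] add_mono less_imp_le order_refl)
    with E(1) show ?thesis by (intro exI[of _ E]) (elim CollectE conjE, intro conjI)
  qed
  then obtain E where E: "\<And>n. range (E n) \<subseteq> sets borel" "\<And>n. disjoint_family (E n)"
    "\<And>n. (\<Union>m. E n m) = A n"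
    "\<And>n. total_variation F (A n) \<le> (\<Sum>m. ennreal (norm (F (E n m)))) + ennreal (e * (1/2) ^ Suc n)"
    by metis
  define G where "G = (\<lambda>(n, m). E n m) \<circ> prod_decode"
  have "(\<Sum>n. total_variation F (A n)) \<le> (\<Sum>n. (\<Sum>m. ennreal (norm (F (E n m)))) + ennreal (e * (1/2) ^ Suc n))"
    by (intro suminf_le E) auto
  also have "\<dots> = (\<Sum>n. \<Sum>m. ennreal (norm (F (E n m)))) + (\<Sum>n. ennreal (e * (1/2)^Suc n))"
    by (subst suminf_add) auto
  also have "(\<Sum>n. ennreal (e * (1/2)^Suc n)) = ennreal e"
    using e sums_mult[OF power_half_series, of e] by (intro suminf_ennreal_eq) auto
  also have "(\<Sum>n. \<Sum>m. ennreal (norm (F (E n m)))) = (\<Sum>k. ennreal (norm (F (G k))))"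
    using suminf_ennreal_2dimen[where f = "\<lambda>(n, m). ennreal (norm (F (E n m)))", OF refl]
    by (simp add: G_def split_beta' comp_def)
  also have "\<dots> \<le> total_variation F (\<Union>n. A n)"
  proof (rule total_variation_ge)
    show "range G \<subseteq> sets borel" using E(1) by (auto simp: G_def split_beta)
    show "disjoint_family G"
    proof (unfold disjoint_family_on_def, safe)
      fix k l x assume "k \<noteq> l" and x: "x \<in> G k" "x \<in> G l"
      obtain n m n' m' where k: "prod_decode k = (n, m)" "prod_decode l = (n', m')"
        by (metis surj_pair)
      with x have x': "x \<in> E n m" "x \<in> E n' m'" by (auto simp: G_def)
      then have "x \<in> A n" "x \<in> A n'" using E(3) by blast+
      then have "n = n'" using A(2) by (auto simp: disjoint_family_on_def)
      with x' E(2)[of n] have "m = m'" by (auto simp: disjoint_family_on_def)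
      with \<open>n = n'\<close> k have "prod_decode k = prod_decode l" by simp
      with \<open>k \<noteq> l\<close> show "x \<in> {}" by (metis prod_decode_inverse)
    qed
    show "(\<Union>k. G k) = (\<Union>n. A n)"
    proof -
      have "(\<Union>k. G k) = (\<Union>p\<in>range prod_decode. (\<lambda>(n, m). E n m) p)" by (auto simp: G_def)
      also have "\<dots> = (\<Union>n. \<Union>m. E n m)" by (auto simp: surj_prod_decode)
      finally show ?thesis by (simp add: E(3))
    qed
  qed
  finally show "(\<Sum>n. total_variation F (A n)) \<le> total_variation F (\<Union>n. A n) + ennreal e"
    by (simp add: add_right_mono)
qed

lemma total_variation_mono:
  assumes F: "vector_measure F" and A: "A \<in> sets borel" "B \<in> sets borel" "A \<subseteq> B"
  shows "total_variation F A \<le> total_variation F B"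
proof (rule total_variation_le)
  fix E :: "nat \<Rightarrow> 'a set" assume E: "range E \<subseteq> sets borel" "disjoint_family E" "(\<Union>n. E n) = A"
  define E' where "E' = case_nat (B - A) E"
  have "(\<Sum>n. ennreal (norm (F (E n)))) \<le> (\<Sum>n. ennreal (norm (F (E' n))))"
  proof -
    have "(\<Sum>n. ennreal (norm (F (E' (n + 1))))) \<le> (\<Sum>n. ennreal (norm (F (E' n))))"
      by (subst (2) suminf_offset[where i = 1]) (rule summableI, simp)
    then show ?thesis by (simp only: E'_def Suc_eq_plus1[symmetric] nat.case)
  qed
  also have "\<dots> \<le> total_variation F B"
  proof (rule total_variation_ge)
    have BA: "B - A \<in> sets borel" using A by (intro sets.Diff)
    have E': "E' n = (case n of 0 \<Rightarrow> B - A | Suc m \<Rightarrow> E m)" for n by (simp add: E'_def)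
    show "range E' \<subseteq> sets borel"
      using BA range_subsetD[OF E(1)] by (intro image_subsetI) (simp add: E' split: nat.split)
    have dj: "E n \<inter> (B - A) = {}" for n unfolding E(3)[symmetric] by fast
    have dj': "E n \<inter> E m = {}" if "n \<noteq> m" for n m
      using E(2) that by (simp add: disjoint_family_on_def)
    show "disjoint_family E'"
      unfolding disjoint_family_on_def
    proof (intro ballI impI)
      fix m n :: nat assume "m \<noteq> n"
      then show "E' m \<inter> E' n = {}"
        using dj dj' by (cases m; cases n) (simp_all add: E' Int_commute)
    qed
    have "(\<Union>n. E' n) = E' 0 \<union> (\<Union>n. E' (Suc n))"
    proof (intro equalityI subsetI)
      fix x assume "x \<in> (\<Union>n. E' n)"
      then obtain n where "x \<in> E' n" by (elim UN_E)
      then show "x \<in> E' 0 \<union> (\<Union>n. E' (Suc n))" by (cases n) (simp, blast)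
    qed (elim UnE UN_E, auto)
    also have "\<dots> = (B - A) \<union> A" by (simp add: E' E(3))
    finally show "(\<Union>n. E' n) = B" using A(3) by auto
  qed
  finally show "(\<Sum>n. ennreal (norm (F (E n)))) \<le> total_variation F B" .
qed

text \<open>Each member of a partition of the union is cut along the pieces \<open>A n\<close>; the order of summation
  is then exchanged.\<close>

lemma total_variation_subadditive:
  assumes F: "vector_measure F" and A: "range A \<subseteq> sets borel" "disjoint_family A"
  shows "total_variation F (\<Union>n. A n) \<le> (\<Sum>n. total_variation F (A n))"
proof (rule total_variation_le)
  fix E :: "nat \<Rightarrow> 'a set" assume E: "range E \<subseteq> sets borel" "disjoint_family E" "(\<Union>n. E n) = (\<Union>n. A n)"
  have "ennreal (norm (F (E m))) \<le> (\<Sum>n. ennreal (norm (F (E m \<inter> A n))))" for m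
  proof -
    have s: "(\<lambda>n. F (E m \<inter> A n)) sums F (\<Union>n. E m \<inter> A n)"
    proof (rule vector_measure_sums[OF F])
      show "range (\<lambda>n. E m \<inter> A n) \<subseteq> sets borel"
        using range_subsetD[OF E(1)] range_subsetD[OF A(1)] by (intro image_subsetI sets.Int)
      have "A k \<inter> A l = {}" if "k \<noteq> l" for k l using A(2) that by (simp add: disjoint_family_on_def)
      then show "disjoint_family (\<lambda>n. E m \<inter> A n)" unfolding disjoint_family_on_def by blast
    qed
    have "(\<Union>n. E m \<inter> A n) = E m" using E(3) by blast
    with s have s: "(\<lambda>n. F (E m \<inter> A n)) sums F (E m)" by simp
    show ?thesis
    proof (cases "(\<Sum>n. ennreal (norm (F (E m \<inter> A n)))) = top")
      case False
      then have sn: "summable (\<lambda>n. norm (F (E m \<inter> A n)))"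
        by (intro summable_suminf_not_top) auto
      have "norm (F (E m)) \<le> (\<Sum>n. norm (F (E m \<inter> A n)))"
      proof (rule LIMSEQ_le[OF tendsto_norm[OF s[unfolded sums_def]] summable_LIMSEQ[OF sn]])
        show "\<exists>N. \<forall>n\<ge>N. norm (\<Sum>i<n. F (E m \<inter> A i)) \<le> (\<Sum>i<n. norm (F (E m \<inter> A i)))"
          by (auto intro: norm_sum)
      qed
      then show ?thesis by (subst suminf_ennreal2[OF _ sn]) (auto intro: ennreal_leI)
    qed auto
  qed
  then have "(\<Sum>m. ennreal (norm (F (E m)))) \<le> (\<Sum>m. \<Sum>n. ennreal (norm (F (E m \<inter> A n))))"
    by (intro suminf_le) auto
  also have "\<dots> = (\<Sum>n. \<Sum>m. ennreal (norm (F (E m \<inter> A n))))"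
  proof -
    have "(\<Sum>m. \<Sum>n. ennreal (norm (F (E m \<inter> A n))))
      = (\<integral>\<^sup>+m. (\<Sum>n. ennreal (norm (F (E m \<inter> A n)))) \<partial>count_space UNIV)"
      by (simp add: nn_integral_count_space_nat)
    also have "\<dots> = (\<Sum>n. \<integral>\<^sup>+m. ennreal (norm (F (E m \<inter> A n))) \<partial>count_space UNIV)"
      by (rule nn_integral_suminf) auto
    finally show ?thesis by (simp add: nn_integral_count_space_nat)
  qed
  also have "\<dots> \<le> (\<Sum>n. total_variation F (A n))"
  proof (intro suminf_le total_variation_ge)
    fix n
    show "range (\<lambda>m. E m \<inter> A n) \<subseteq> sets borel"
      using range_subsetD[OF E(1)] range_subsetD[OF A(1)] by (intro image_subsetI sets.Int)
    have "E k \<inter> E l = {}" if "k \<noteq> l" for k l using E(2) that by (simp add: disjoint_family_on_def)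
    then show "disjoint_family (\<lambda>m. E m \<inter> A n)" unfolding disjoint_family_on_def by blast
    show "(\<Union>m. E m \<inter> A n) = A n" using E(3) by blast
  qed auto
  finally show "(\<Sum>m. ennreal (norm (F (E m)))) \<le> (\<Sum>n. total_variation F (A n))" .
qed

lemma total_variation_finite:
  assumes "F \<in> bounded_vector_measures" "A \<in> sets borel"
  shows "total_variation F A < \<infinity>"
  using assms total_variation_mono[of F A UNIV]
  by (auto simp: bounded_vector_measures_def order_le_less_trans)

lemma total_variation_sums:
  assumes F: "F \<in> bounded_vector_measures" and A: "range A \<subseteq> sets borel" "disjoint_family A"
  shows "(\<Sum>n. total_variation F (A n)) = total_variation F (\<Union>n. A n)"
proof (rule antisym)
  have vm: "vector_measure F" using F by (simp add: bounded_vector_measures_def)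
  show "(\<Sum>n. total_variation F (A n)) \<le> total_variation F (\<Union>n. A n)"
    using A by (intro total_variation_superadditive[OF vm] total_variation_finite[OF F]) auto
  show "total_variation F (\<Union>n. A n) \<le> (\<Sum>n. total_variation F (A n))"
    by (rule total_variation_subadditive[OF vm A])
qed

lemma total_variation_empty: "vector_measure F \<Longrightarrow> total_variation F {} = 0"
  unfolding le_zero_eq[symmetric]
  by (rule total_variation_le) (auto simp: vector_measure_empty)

lemma emeasure_borel_measure_of:
  fixes \<mu> :: "'a::topological_space set \<Rightarrow> ennreal"
  assumes "\<mu> {} = 0" "\<And>A. range A \<subseteq> sets borel \<Longrightarrow> disjoint_family A \<Longrightarrow> (\<Sum>n. \<mu> (A n)) = \<mu> (\<Union>n. A n)"
    and X: "X \<in> sets borel"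
  shows "emeasure (measure_of UNIV (sets borel) \<mu>) X = \<mu> X"
proof (rule emeasure_measure_of)
  show "positive (sets (measure_of UNIV (sets borel) \<mu>)) \<mu>"
    using assms(1) by (simp add: positive_def)
  show "countably_additive (sets (measure_of UNIV (sets borel) \<mu>)) \<mu>"
    using assms(2) sets.sigma_sets_eq[of "borel :: 'a measure"] by (auto simp: countably_additive_def)
  show "X \<in> sets (measure_of UNIV (sets borel) \<mu>)"
    using X sets.sigma_sets_eq[of "borel :: 'a measure"] by auto
qed auto

lemma sets_borel_measure_of: "sets (measure_of UNIV (sets (borel :: 'a::topological_space measure)) \<mu>) = sets borel"
  using sets.sigma_sets_eq[of "borel :: 'a measure"] by simp

lemma emeasure_variation_measure:
  assumes F: "F \<in> bounded_vector_measures" and A: "A \<in> sets borel"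
  shows "emeasure (variation_measure F) A = total_variation F A"
  unfolding variation_measure_def using F A
  by (intro emeasure_borel_measure_of)
     (auto simp: bounded_vector_measures_def total_variation_sums total_variation_empty)

lemma sets_variation_measure: "sets (variation_measure F) = sets borel"
  unfolding variation_measure_def by (rule sets_borel_measure_of)

text \<open>Countable additivity of the total variation is what makes the measure behind \<^const>\<open>jordan_pos\<close>
  take the intended values.\<close>

lemma emeasure_jordan_pos:
  assumes m: "m \<in> bounded_vector_measures" and A: "A \<in> sets borel"
  shows "emeasure (jordan_pos m) A = ennreal ((enn2real (total_variation m A) + m A) / 2)"
  unfolding jordan_pos_def
proof (rule emeasure_borel_measure_of[OF _ _ A])
  have vm: "vector_measure m" using m by (simp add: bounded_vector_measures_def)
  show "ennreal ((enn2real (total_variation m {}) + m {}) / 2) = 0"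
    by (simp add: vector_measure_empty[OF vm] total_variation_empty[OF vm])
  fix A :: "nat \<Rightarrow> 'a set" assume A: "range A \<subseteq> sets borel" "disjoint_family A"
  have tv: "total_variation m X = ennreal (enn2real (total_variation m X))" if "X \<in> sets borel" for X
    using total_variation_finite[OF m that] by (simp add: less_top)
  have U: "(\<Union>n. A n) \<in> sets borel" using A(1) by (intro sets.countable_UN) auto
  have "(\<lambda>n. enn2real (total_variation m (A n))) sums enn2real (total_variation m (\<Union>n. A n))"
  proof -
    have "(\<lambda>n. ennreal (enn2real (total_variation m (A n)))) sums ennreal (enn2real (total_variation m (\<Union>n. A n)))"
      using total_variation_sums[OF m A] tv U A(1) by (simp add: sums_iff range_subsetD flip: tv)
    then show ?thesis by (subst (asm) sums_ennreal) auto
  qed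
  then have "(\<lambda>n. (enn2real (total_variation m (A n)) + m (A n)) / 2) sums
      ((enn2real (total_variation m (\<Union>n. A n)) + m (\<Union>n. A n)) / 2)"
    by (intro sums_divide sums_add vector_measure_sums[OF vm A])
  moreover have "0 \<le> (enn2real (total_variation m X) + m X) / 2" if "X \<in> sets borel" for X
  proof -
    have "ennreal \<bar>m X\<bar> \<le> total_variation m X"
      using norm_le_total_variation[OF vm that] by simp
    then have "\<bar>m X\<bar> \<le> enn2real (total_variation m X)"
      using tv[OF that] by (metis ennreal_le_iff enn2real_nonneg)
    from abs_le_D2[OF this] show ?thesis by simp
  qed
  ultimately show "(\<Sum>n. ennreal ((enn2real (total_variation m (A n)) + m (A n)) / 2)) =
      ennreal ((enn2real (total_variation m (\<Union>n. A n)) + m (\<Union>n. A n)) / 2)"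
    using A(1) by (intro suminf_ennreal_eq) (auto simp: range_subsetD)
qed

lemma sets_jordan_pos: "sets (jordan_pos m) = sets borel"
  unfolding jordan_pos_def by (rule sets_borel_measure_of)

lemma emeasure_jordan_pos_le:
  assumes m: "m \<in> bounded_vector_measures" and A: "A \<in> sets borel"
  shows "emeasure (jordan_pos m) A \<le> total_variation m A"
proof -
  have vm: "vector_measure m" using m by (simp add: bounded_vector_measures_def)
  have tv: "total_variation m A = ennreal (enn2real (total_variation m A))"
    using total_variation_finite[OF m A] by (simp add: less_top)
  have "ennreal \<bar>m A\<bar> \<le> total_variation m A"
    using norm_le_total_variation[OF vm A] by simp
  then have "\<bar>m A\<bar> \<le> enn2real (total_variation m A)"
    using tv by (metis ennreal_le_iff enn2real_nonneg)
  then show ?thesis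
    by (subst tv) (auto simp: emeasure_jordan_pos[OF m A] intro!: ennreal_leI)
qed

lemma component_vector_measure:
  fixes F :: "'a::topological_space set \<Rightarrow> real ^ 'n::finite"
  assumes F: "F \<in> bounded_vector_measures"
  shows "(\<lambda>A. F A $ i) \<in> bounded_vector_measures" "(\<lambda>A. - F A $ i) \<in> bounded_vector_measures"
    "total_variation (\<lambda>A. F A $ i) A \<le> total_variation F A"
    "total_variation (\<lambda>A. - F A $ i) A \<le> total_variation F A"
proof -
  have vm: "vector_measure F" using F by (simp add: bounded_vector_measures_def)
  have 1: "vector_measure (\<lambda>A. F A $ i)" "vector_measure (\<lambda>A. - F A $ i)"
    unfolding vector_measure_def
    by (auto intro!: bounded_linear.sums[OF bounded_linear_vec_nth] sums_minus vector_measure_sums[OF vm])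
  have *: "(\<Sum>n. ennreal \<bar>F (E n) $ i\<bar>) \<le> total_variation F A"
    if E: "range E \<subseteq> sets borel" "disjoint_family E" "(\<Union>n. E n) = A" for E A
  proof -
    have "(\<Sum>n. ennreal \<bar>F (E n) $ i\<bar>) \<le> (\<Sum>n. ennreal (norm (F (E n))))"
      by (intro suminf_le ennreal_leI component_le_norm_cart) auto
    with total_variation_ge[OF E, of F] show ?thesis by simp
  qed
  show 2: "total_variation (\<lambda>A. F A $ i) A \<le> total_variation F A" "total_variation (\<lambda>A. - F A $ i) A \<le> total_variation F A" for A
    by (rule total_variation_le, use * in simp)+
  show "(\<lambda>A. F A $ i) \<in> bounded_vector_measures" "(\<lambda>A. - F A $ i) \<in> bounded_vector_measures"
    using F 1 order_le_less_trans[OF 2(1)[of UNIV]] order_le_less_trans[OF 2(2)[of UNIV]]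
    by (auto simp: bounded_vector_measures_def)
qed

section \<open>Product test functions\<close>

text \<open>The witness is the whole sequence of derivatives. Partial derivatives of a product of such
  functions are again products of members of these sequences, which is how membership in
  \<^const>\<open>test_functions\<close> is shown below.\<close>

definition smooth :: "(real \<Rightarrow> real) \<Rightarrow> bool" where
  "smooth f \<longleftrightarrow> (\<exists>D. D 0 = f \<and> (\<forall>k x. (D k has_real_derivative D (Suc k) x) (at x)))"

text \<open>A version of finite order, in which closure under products is a direct induction.\<close>

fun smooth_upto :: "nat \<Rightarrow> (real \<Rightarrow> real) \<Rightarrow> bool" where
  "smooth_upto 0 f = True"
| "smooth_upto (Suc k) f = (\<exists>f'. (\<forall>x. (f has_real_derivative f' x) (at x)) \<and> smooth_upto k f')"

lemma smooth_uptoD: "smooth_upto k f \<Longrightarrow> l \<le> k \<Longrightarrow> smooth_upto l f"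
proof (induction k arbitrary: f l)
  case (Suc k)
  then show ?case by (cases l) auto
qed auto

lemma smooth_iff: "smooth f \<longleftrightarrow> (\<forall>k. smooth_upto k f)"
proof
  assume "smooth f"
  then obtain D where D: "D 0 = f" "\<And>k x. (D k has_real_derivative D (Suc k) x) (at x)"
    by (auto simp: smooth_def)
  have "smooth_upto k (D l)" for k l
    by (induction k arbitrary: l) (use D(2) in auto)
  then show "\<forall>k. smooth_upto k f" using D(1) by metis
next
  assume f: "\<forall>k. smooth_upto k f"
  have step: "(\<forall>x. (g has_real_derivative deriv g x) (at x)) \<and> (\<forall>k. smooth_upto k (deriv g))"
    if g: "\<forall>k. smooth_upto k g" for g
  proof -
    have *: "(\<forall>x. (g has_real_derivative deriv g x) (at x)) \<and> smooth_upto k (deriv g)" for k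
    proof -
      obtain g' where g': "\<And>x. (g has_real_derivative g' x) (at x)" "smooth_upto k g'"
        using g[rule_format, of "Suc k"] by auto
      have "deriv g = g'" using g'(1) by (auto intro: DERIV_imp_deriv)
      with g' show ?thesis by simp
    qed
    then show ?thesis by auto
  qed
  have all: "\<forall>k. smooth_upto k ((deriv ^^ n) f)" for n
    by (induction n) (use f step in auto)
  show "smooth f"
    unfolding smooth_def
    by (rule exI[of _ "\<lambda>n. (deriv ^^ n) f"]) (use step[OF all] in auto)
qed

lemma smooth_upto_add: "smooth_upto k f \<Longrightarrow> smooth_upto k g \<Longrightarrow> smooth_upto k (\<lambda>x. f x + g x)"
proof (induction k arbitrary: f g)
  case (Suc k)
  then obtain f' g' where "\<And>x. (f has_real_derivative f' x) (at x)" "smooth_upto k f'"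
    "\<And>x. (g has_real_derivative g' x) (at x)" "smooth_upto k g'" by auto
  with Suc.IH[of f' g'] show ?case
    by (auto intro!: exI[of _ "\<lambda>x. f' x + g' x"] derivative_intros)
qed auto

lemma smooth_upto_mult: "smooth_upto k f \<Longrightarrow> smooth_upto k g \<Longrightarrow> smooth_upto k (\<lambda>x. f x * g x)"
proof (induction k arbitrary: f g)
  case (Suc k)
  then obtain f' g' where fg: "\<And>x. (f has_real_derivative f' x) (at x)" "smooth_upto k f'"
    "\<And>x. (g has_real_derivative g' x) (at x)" "smooth_upto k g'" by auto
  have "smooth_upto k f" "smooth_upto k g"
    using Suc.prems smooth_uptoD[of "Suc k"] by (auto simp del: smooth_upto.simps)
  with Suc.IH[of f' g] Suc.IH[of f g'] fg have "smooth_upto k (\<lambda>x. f' x * g x + f x * g' x)"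
    by (intro smooth_upto_add) auto
  moreover have "((\<lambda>x. f x * g x) has_real_derivative f' x * g x + f x * g' x) (at x)" for x
    using fg by (auto intro!: derivative_eq_intros)
  ultimately show ?case
    unfolding smooth_upto.simps by (intro exI[of _ "\<lambda>x. f' x * g x + f x * g' x"]) simp
qed auto

lemma smooth_upto_affine: "smooth_upto k f \<Longrightarrow> smooth_upto k (\<lambda>x. c * f (a * x + b))"
proof (induction k arbitrary: f c)
  case (Suc k)
  then obtain f' where f: "\<And>x. (f has_real_derivative f' x) (at x)" "smooth_upto k f'" by auto
  have "((\<lambda>x. c * f (a * x + b)) has_real_derivative (c * a) * f' (a * x + b)) (at x)" for x
    by (rule derivative_eq_intros DERIV_chain2[OF f(1)] refl | simp)+
  moreover have "smooth_upto k (\<lambda>x. (c * a) * f' (a * x + b))" by (rule Suc.IH[OF f(2)])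
  ultimately show ?case
    unfolding smooth_upto.simps by (intro exI[of _ "\<lambda>x. (c * a) * f' (a * x + b)"]) simp
qed auto

lemma smooth_mult: "smooth f \<Longrightarrow> smooth g \<Longrightarrow> smooth (\<lambda>x. f x * g x)"
  by (simp add: smooth_iff smooth_upto_mult)

lemma smooth_affine: "smooth f \<Longrightarrow> smooth (\<lambda>x. f (a * x + b))"
  using smooth_upto_affine[where c = 1] by (simp add: smooth_iff)

lemma smooth_id: "smooth (\<lambda>x. x)"
  unfolding smooth_def
  by (rule exI[of _ "\<lambda>k x. if k = 0 then x else if k = 1 then 1 else 0"]) auto

definition flat_exp :: "real \<Rightarrow> real" where
  "flat_exp x = (if x \<le> 0 then 0 else exp (- 1 / x))"

lemma poly_flat_exp_tendsto:
  "((\<lambda>x. poly p (1 / x) * exp (- 1 / x)) \<longlongrightarrow> 0) (at_right (0::real))"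
proof -
  have "((\<lambda>y. poly p y * exp (- y)) \<longlongrightarrow> 0) (at_top :: real filter)"
  proof -
    have "((\<lambda>y. \<Sum>i\<le>degree p. coeff p i * (y ^ i / exp y)) \<longlongrightarrow> (\<Sum>i\<le>degree p. coeff p i * 0)) (at_top :: real filter)"
      by (intro tendsto_sum tendsto_mult tendsto_const tendsto_power_div_exp_0)
    then show ?thesis
      by (simp add: poly_altdef sum_distrib_right exp_minus divide_inverse mult.assoc)
  qed
  from filterlim_compose[OF this filterlim_inverse_at_top_right]
  show ?thesis by (simp add: inverse_eq_divide)
qed

text \<open>All derivatives have the form \<open>p (1 / x) * exp (- 1 / x)\<close> with a polynomial \<open>p\<close>, on which
  differentiation acts by the map \<open>S\<close> of the proof. The pieces fit together at \<open>0\<close> because the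
  exponential beats every polynomial.\<close>

lemma smooth_flat_exp: "smooth flat_exp"
proof -
  \<comment> \<open>with \<open>y = 1 / x\<close>, the derivative of \<open>p y * exp (- y)\<close> with respect to \<open>x\<close> is \<open>y ^ 2 * (p y - q y) * exp (- y)\<close>, where \<open>q\<close> is the derivative of \<open>p\<close>\<close>
  define S where "S p = pCons 0 (pCons 0 (p - pderiv p))" for p :: "real poly"
  define P where "P k = (S ^^ k) 1" for k
  define D where "D k x = (if x \<le> 0 then 0 else poly (P k) (1 / x) * exp (- 1 / x))" for k and x :: real
  have "(D k has_real_derivative D (Suc k) x) (at x)" for k x
  proof -
    consider "x < 0" | "x = 0" | "0 < x" by linarith
    then show ?thesis
    proof cases
      case 1
      have "((\<lambda>x. 0) has_real_derivative D (Suc k) x) (at x)" using 1 by (simp add: D_def)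
      then show ?thesis
        by (rule has_field_derivative_transform_within_open[where S = "{..<0}"]) (use 1 in \<open>auto simp: D_def\<close>)
    next
      case 3
      have "((\<lambda>x. poly (P k) (1 / x) * exp (- 1 / x)) has_real_derivative D (Suc k) x) (at x)"
        using 3 by (auto intro!: derivative_eq_intros DERIV_chain2[OF poly_DERIV]
            simp: D_def P_def S_def field_simps power2_eq_square)
      then show ?thesis
        by (rule has_field_derivative_transform_within_open[where S = "{0<..}"]) (use 3 in \<open>auto simp: D_def\<close>)
    next
      case 2
      have "((\<lambda>h. (D k (0 + h) - D k 0) / h) \<longlongrightarrow> 0) (at_left 0)"
        by (rule tendsto_eventually) (auto simp: D_def eventually_at_left_field intro!: exI[of _ "-1"])
      moreover have "((\<lambda>h. (D k (0 + h) - D k 0) / h) \<longlongrightarrow> 0) (at_right 0)"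
        by (rule Lim_transform_eventually[OF poly_flat_exp_tendsto[of "pCons 0 (P k)"]])
           (auto simp: D_def eventually_at_right_field intro!: exI[of _ 1])
      ultimately have "((\<lambda>h. (D k (0 + h) - D k 0) / h) \<longlongrightarrow> 0) (at 0)"
        by (rule filterlim_split_at)
      then show ?thesis using 2 by (simp add: DERIV_def D_def)
    qed
  qed
  moreover have "D 0 = flat_exp" by (auto simp: D_def P_def flat_exp_def fun_eq_iff)
  ultimately show ?thesis by (auto simp: smooth_def)
qed

lemma flat_exp_deriv:
  "(flat_exp has_real_derivative (if x \<le> 0 then 0 else exp (- 1 / x) / x\<^sup>2)) (at x)"
proof -
  obtain f' where f': "\<And>x. (flat_exp has_real_derivative f' x) (at x)" "\<And>x. isCont f' x"
  proof -
    from smooth_flat_exp obtain D where D: "D 0 = flat_exp" "\<And>k x. (D k has_real_derivative D (Suc k) x) (at x)"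
      by (auto simp: smooth_def)
    show thesis
      by (rule that[of "D 1"]) (use D(2)[of 0] D(1) DERIV_isCont[OF D(2)[of 1]] in auto)
  qed
  have neg: "f' x = 0" if "x < 0" for x
  proof -
    have "((\<lambda>x. 0) has_real_derivative f' x) (at x)"
      by (rule has_field_derivative_transform_within_open[OF f'(1), where S = "{..<0}"])
         (use that in \<open>auto simp: flat_exp_def\<close>)
    then show ?thesis using DERIV_unique[OF _ DERIV_const] by blast
  qed
  have "f' 0 = 0"
  proof (rule tendsto_unique)
    show "(f' \<longlongrightarrow> f' 0) (at_left 0)"
      using f'(2)[of 0] by (auto simp: isCont_def filterlim_at_split)
    show "(f' \<longlongrightarrow> 0) (at_left 0)"
      by (rule tendsto_eventually) (auto simp: eventually_at_left_field neg intro!: exI[of _ "-1"])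
  qed simp
  then have le: "f' x = 0" if "x \<le> 0" for x using that neg by (cases "x = 0") auto
  have "((\<lambda>x. exp (- 1 / x)) has_real_derivative exp (- 1 / x) / x\<^sup>2) (at x)" if "0 < x"
    using that by (auto intro!: derivative_eq_intros simp: field_simps power2_eq_square)
  then have "(flat_exp has_real_derivative exp (- 1 / x) / x\<^sup>2) (at x)" if "0 < x"
    by (rule has_field_derivative_transform_within_open[where S = "{0<..}"])
       (use that in \<open>auto simp: flat_exp_def\<close>)
  with f'(1)[of x] le[of x] show ?thesis by auto
qed

lemma partial_deriv_prod:
  fixes h :: "'n::finite \<Rightarrow> real \<Rightarrow> real"
  assumes "\<And>j. (h j has_real_derivative h' j) (at (x $ j))"
  shows "((\<lambda>x. \<Prod>j\<in>UNIV. h j (x $ j)) has_derivative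
      (\<lambda>v. \<Sum>i\<in>UNIV. v $ i * h' i * (\<Prod>j\<in>UNIV - {i}. h j (x $ j)))) (at x)"
proof -
  have *: "((\<lambda>x. h j (x $ j)) has_derivative (\<lambda>v. v $ j * h' j)) (at x)" for j
  proof -
    have "((\<lambda>x. h j (x $ j)) has_derivative (\<lambda>v. h' j * v $ j)) (at x)"
      using has_derivative_compose[of "\<lambda>x. x $ j" "\<lambda>v. v $ j" x UNIV "h j" "\<lambda>v. h' j * v"]
        bounded_linear.has_derivative[OF bounded_linear_vec_nth has_derivative_ident, of j "at x"]
        assms[of j]
      by (simp add: has_field_derivative_def)
    then show ?thesis by (simp add: mult.commute)
  qed
  show ?thesis
    by (rule has_derivative_eq_rhs[OF has_derivative_prod[OF *]]) auto
qed

lemma partial_deriv_prod_eq: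
  fixes h :: "'n::finite \<Rightarrow> real \<Rightarrow> real"
  assumes "\<And>j. (h j has_real_derivative h' j) (at (x $ j))"
  shows "partial_deriv i (\<lambda>x. \<Prod>j\<in>UNIV. h j (x $ j)) x = h' i * (\<Prod>j\<in>UNIV - {i}. h j (x $ j))"
proof -
  have "partial_deriv i (\<lambda>x. \<Prod>j\<in>UNIV. h j (x $ j)) x
      = (\<Sum>k\<in>UNIV. axis i 1 $ k * h' k * (\<Prod>j\<in>UNIV - {k}. h j (x $ j)))"
    unfolding partial_deriv_def frechet_derivative_at[OF partial_deriv_prod[OF assms], symmetric] ..
  also have "\<dots> = (\<Sum>k\<in>UNIV. if k = i then h' k * (\<Prod>j\<in>UNIV - {k}. h j (x $ j)) else 0)"
    by (intro sum.cong) (auto simp: axis_def)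
  finally show ?thesis by simp
qed

lemma prod_update:
  fixes h :: "'n::finite \<Rightarrow> real \<Rightarrow> real"
  shows "(\<Prod>j\<in>UNIV. (h(i := g)) j (x $ j)) = g (x $ i) * (\<Prod>j\<in>UNIV - {i}. h j (x $ j))"
  by (subst prod.remove[of _ i]) auto

text \<open>The induction is over all multi-indices \<open>n\<close> at once, since a partial derivative raises one
  entry of \<open>n\<close> by one.\<close>

lemma product_test_function:
  fixes h :: "'n::finite \<Rightarrow> real \<Rightarrow> real"
  assumes smooth: "\<And>j. smooth (h j)" and supp: "\<And>j t. R < \<bar>t\<bar> \<Longrightarrow> h j t = 0"
  shows "(\<lambda>x. \<Prod>j\<in>UNIV. h j (x $ j)) \<in> test_functions"
proof -
  have "\<exists>D. D 0 = h j \<and> (\<forall>k x. (D k has_real_derivative D (Suc k) x) (at x))" for j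
    using smooth[of j] by (simp add: smooth_def)
  then obtain D where D: "\<And>j. D j 0 = h j" "\<And>j k x. (D j k has_real_derivative D j (Suc k) x) (at x)"
    by metis
  have Ck: "Ck_function k (\<lambda>x. \<Prod>j\<in>UNIV. D j (n j) (x $ j))" for k and n :: "'n \<Rightarrow> nat"
  proof (induction k arbitrary: n)
    case 0
    have "isCont (D j k) t" for j k t using D(2) DERIV_isCont by blast
    then have "continuous_on UNIV (D j k)" for j k
      by (simp add: continuous_at_imp_continuous_on)
    then have "continuous_on UNIV (\<lambda>x. D j k (x $ j))" for j k
      by (rule continuous_on_compose2[OF _ continuous_on_component[OF continuous_on_id]]) auto
    then show ?case by (auto intro!: continuous_on_prod)
  next
    case (Suc k)
    have "partial_deriv i (\<lambda>x. \<Prod>j\<in>UNIV. D j (n j) (x $ j)) = (\<lambda>x. \<Prod>j\<in>UNIV. D j ((n(i := Suc (n i))) j) (x $ j))" for i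
    proof
      fix x :: "real ^ 'n"
      have "(\<Prod>j\<in>UNIV. D j ((n(i := Suc (n i))) j) (x $ j)) = (\<Prod>j\<in>UNIV. ((\<lambda>j. D j (n j))(i := D i (Suc (n i)))) j (x $ j))"
        by (intro prod.cong) auto
      then show "partial_deriv i (\<lambda>x. \<Prod>j\<in>UNIV. D j (n j) (x $ j)) x = (\<Prod>j\<in>UNIV. D j ((n(i := Suc (n i))) j) (x $ j))"
        using partial_deriv_prod_eq[of "\<lambda>j. D j (n j)" "\<lambda>j. D j (Suc (n j)) (x $ j)" x i, OF D(2)]
          prod_update[of "\<lambda>j. D j (n j)" i "D i (Suc (n i))" x] by simp
    qed
    moreover have "(\<lambda>x. \<Prod>j\<in>UNIV. D j (n j) (x $ j)) differentiable (at x)" for x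
      using partial_deriv_prod[of "\<lambda>j. D j (n j)" "\<lambda>j. D j (Suc (n j)) (x $ j)" x, OF D(2)]
      by (rule differentiableI)
    ultimately show ?case using Suc.IH by (simp del: fun_upd_apply)
  qed
  have "compact (closure {x :: real ^ 'n. (\<Prod>j\<in>UNIV. h j (x $ j)) \<noteq> 0})"
  proof (subst compact_closure, rule bounded_subset)
    show "bounded (cbox (\<chi> i. - R) (\<chi> i. R) :: (real ^ 'n) set)" by (rule bounded_cbox)
    show "{x. (\<Prod>j\<in>UNIV. h j (x $ j)) \<noteq> 0} \<subseteq> cbox (\<chi> i. - R) (\<chi> i. R)"
    proof safe
      fix x :: "real ^ 'n" assume "(\<Prod>j\<in>UNIV. h j (x $ j)) \<noteq> 0"
      then have "h j (x $ j) \<noteq> 0" for j by (simp add: prod_zero_iff)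
      then have "\<bar>x $ j\<bar> \<le> R" for j using supp[of "x $ j" j] by (meson not_less)
      then show "x \<in> cbox (\<chi> i. - R) (\<chi> i. R)"
        by (simp add: mem_box_cart abs_le_iff) (metis minus_le_iff)
    qed
  qed
  with Ck[of _ "\<lambda>j. 0"] show ?thesis by (simp add: test_functions_def D(1))
qed

section \<open>Gaussian smoothing of measures\<close>

lemma nn_integral_lborel_affine:
  fixes f :: "'a::euclidean_space \<Rightarrow> ennreal"
  assumes [measurable]: "f \<in> borel_measurable borel" and c: "c \<noteq> 0"
  shows "(\<integral>\<^sup>+x. f x \<partial>lborel) = ennreal (\<bar>c\<bar> ^ DIM('a)) * (\<integral>\<^sup>+x. f (t + c *\<^sub>R x) \<partial>lborel)"
  by (subst lborel_affine[OF c, of t])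
     (simp add: nn_integral_density nn_integral_distr nn_integral_cmult)

lemma integral_lborel_translate:
  fixes f :: "'a::euclidean_space \<Rightarrow> real"
  assumes [measurable]: "f \<in> borel_measurable borel"
  shows "(\<integral>x. f x \<partial>lborel) = (\<integral>x. f (t + x) \<partial>lborel)"
  by (subst lborel_distr_plus[of t, symmetric]) (simp add: integral_distr)

lemma Fubini_swap:
  fixes f :: "'a \<Rightarrow> 'b \<Rightarrow> real"
  assumes A: "sigma_finite_measure A" and B: "sigma_finite_measure B"
    and m: "(\<lambda>(x, y). f x y) \<in> borel_measurable (A \<Otimes>\<^sub>M B)"
    and fin: "(\<integral>\<^sup>+x. \<integral>\<^sup>+y. ennreal \<bar>f x y\<bar> \<partial>B \<partial>A) < \<infinity>"
  shows "(\<integral>x. \<integral>y. f x y \<partial>B \<partial>A) = (\<integral>y. \<integral>x. f x y \<partial>A \<partial>B)"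
    "integrable A (\<lambda>x. \<integral>y. f x y \<partial>B)" "integrable B (\<lambda>y. \<integral>x. f x y \<partial>A)"
proof -
  interpret pair_sigma_finite A B using A B by (simp add: pair_sigma_finite_def)
  have i: "integrable (A \<Otimes>\<^sub>M B) (\<lambda>(x, y). f x y)"
  proof (rule integrableI_bounded[OF m])
    have "(\<lambda>p. ennreal (norm ((\<lambda>(x, y). f x y) p))) \<in> borel_measurable (A \<Otimes>\<^sub>M B)"
      using m by measurable
    from M2.nn_integral_fst[OF this]
    show "(\<integral>\<^sup>+p. ennreal (norm ((\<lambda>(x, y). f x y) p)) \<partial>(A \<Otimes>\<^sub>M B)) < \<infinity>"
      using fin by simp
  qed
  show "(\<integral>x. \<integral>y. f x y \<partial>B \<partial>A) = (\<integral>y. \<integral>x. f x y \<partial>A \<partial>B)"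
    using Fubini_integral[OF i] by simp
  show "integrable A (\<lambda>x. \<integral>y. f x y \<partial>B)" using integrable_fst[OF i] .
  show "integrable B (\<lambda>y. \<integral>x. f x y \<partial>A)" using integrable_snd[OF i] .
qed

text \<open>Its value is \<open>pi powr (d / 2)\<close> in dimension \<open>d\<close>.\<close>

definition gauss_mass :: "'n::finite itself \<Rightarrow> real" where
  "gauss_mass _ = (\<integral>(z::real ^ 'n). exp (- (norm z)\<^sup>2) \<partial>lborel)"

text \<open>The Gaussian density with total mass \<open>1\<close>. In this normalization the squares of the widths add
  under convolution.\<close>

definition gauss :: "real \<Rightarrow> real ^ 'n::finite \<Rightarrow> real" where
  "gauss r z = exp (- (norm z)\<^sup>2 / r\<^sup>2) / (gauss_mass TYPE('n) * r ^ CARD('n))"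

lemma integrable_exp_norm: "integrable lborel (\<lambda>z::real ^ 'n::finite. exp (- (norm z)\<^sup>2))"
proof (rule integrableI_bounded)
  have "exp (- (norm z)\<^sup>2) = (\<Prod>b\<in>Basis. exp (- (z \<bullet> b)\<^sup>2))" for z :: "real ^ 'n"
    by (simp add: exp_sum[symmetric] sum_negf power2_norm_eq_inner euclidean_inner[of z z] flip: power2_eq_square)
  then have "(\<integral>\<^sup>+(z::real ^ 'n). ennreal (exp (- (norm z)\<^sup>2)) \<partial>lborel)
      = (\<integral>\<^sup>+z. (\<Prod>b\<in>(Basis :: (real ^ 'n) set). ennreal (exp (- (z \<bullet> b)\<^sup>2))) \<partial>lborel)"
    by (simp add: prod_ennreal)
  also have "\<dots> = (\<Prod>b\<in>(Basis :: (real ^ 'n) set). \<integral>\<^sup>+t. ennreal (exp (- t\<^sup>2)) \<partial>lborel)"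
    by (rule nn_integral_lborel_prod) auto
  also have "\<dots> < \<infinity>"
  proof -
    have "integrable lborel (\<lambda>t. sqrt pi * normal_density 0 (1 / sqrt 2) t)" by simp
    then have "integrable lborel (\<lambda>t::real. exp (- t\<^sup>2))"
      by (simp add: normal_density_def power_divide real_sqrt_divide)
    then have "(\<integral>\<^sup>+t. ennreal (exp (- t\<^sup>2)) \<partial>lborel) < \<infinity>"
      by (simp add: integrable_iff_bounded)
    then show ?thesis by (simp add: power_less_top_ennreal)
  qed
  finally show "(\<integral>\<^sup>+(z::real ^ 'n). ennreal (norm (exp (- (norm z)\<^sup>2))) \<partial>lborel) < \<infinity>" by simp
qed measurable

lemma gauss_mass_pos: "0 < gauss_mass TYPE('n::finite)"
proof -
  have "(\<integral>(z::real ^ 'n). exp (- (norm z)\<^sup>2) \<partial>lborel) \<noteq> 0"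
  proof
    assume "(\<integral>(z::real ^ 'n). exp (- (norm z)\<^sup>2) \<partial>lborel) = 0"
    then have "AE (z::real ^ 'n) in lborel. exp (- (norm z)\<^sup>2) = 0"
      by (subst (asm) integral_nonneg_eq_0_iff_AE) (auto intro: integrable_exp_norm)
    then have "AE (z::real ^ 'n) in lborel. False" by simp
    then show False using AE_iff_measurable[of UNIV lborel "\<lambda>_::real ^ 'n. False"] by simp
  qed
  then show ?thesis unfolding gauss_mass_def
    by (simp add: less_le integral_nonneg_AE)
qed

lemma gauss_pos: "0 < r \<Longrightarrow> 0 < gauss r (z :: real ^ 'n::finite)"
  unfolding gauss_def using gauss_mass_pos[where 'n = 'n] by simp

lemma gauss_nonneg: "0 < r \<Longrightarrow> 0 \<le> gauss r (z :: real ^ 'n::finite)"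
  using gauss_pos[of r z] by simp

lemma gauss_le: "0 < r \<Longrightarrow> gauss r (z :: real ^ 'n::finite) \<le> 1 / (gauss_mass TYPE('n) * r ^ CARD('n))"
  unfolding gauss_def using gauss_mass_pos[where 'n = 'n] by (intro divide_right_mono) auto

lemma measurable_gauss [measurable]: "gauss r \<in> borel_measurable borel"
  unfolding gauss_def[abs_def] by measurable

lemma nn_integral_exp_norm_scaled:
  assumes c: "0 < c"
  shows "(\<integral>\<^sup>+(z::real ^ 'n::finite). ennreal (exp (- (norm (z - t))\<^sup>2 / c\<^sup>2)) \<partial>lborel)
     = ennreal (gauss_mass TYPE('n) * c ^ CARD('n))"
proof -
  have "(\<integral>\<^sup>+(z::real ^ 'n::finite). ennreal (exp (- (norm (z - t))\<^sup>2 / c\<^sup>2)) \<partial>lborel)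
      = ennreal (c ^ CARD('n)) * (\<integral>\<^sup>+(z::real ^ 'n). ennreal (exp (- (norm z)\<^sup>2)) \<partial>lborel)"
    using c by (subst nn_integral_lborel_affine[where c = c and t = t]) (auto simp: power_mult_distrib)
  also have "(\<integral>\<^sup>+(z::real ^ 'n). ennreal (exp (- (norm z)\<^sup>2)) \<partial>lborel) = ennreal (gauss_mass TYPE('n))"
    unfolding gauss_mass_def by (rule nn_integral_eq_integral[OF integrable_exp_norm]) auto
  finally show ?thesis using c gauss_mass_pos[where 'n = 'n] by (simp add: ennreal_mult[symmetric] mult.commute)
qed

lemma nn_integral_gauss:
  assumes r: "0 < r"
  shows "(\<integral>\<^sup>+z. ennreal (gauss r (z - t :: real ^ 'n::finite)) \<partial>lborel) = 1"
proof -
  define Z where "Z = gauss_mass TYPE('n) * r ^ CARD('n)"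
  have Z: "0 < Z" using r gauss_mass_pos[where 'n = 'n] by (simp add: Z_def)
  have "(\<integral>\<^sup>+z. ennreal (gauss r (z - t :: real ^ 'n)) \<partial>lborel)
      = (\<integral>\<^sup>+(z::real ^ 'n). ennreal (1 / Z) * ennreal (exp (- (norm (z - t))\<^sup>2 / r\<^sup>2)) \<partial>lborel)"
    using Z by (intro nn_integral_cong) (simp add: gauss_def Z_def[symmetric] ennreal_mult[symmetric])
  also have "\<dots> = ennreal (1 / Z) * ennreal Z"
    unfolding Z_def nn_integral_exp_norm_scaled[OF r, of t, symmetric]
    by (rule nn_integral_cmult) measurable
  also have "\<dots> = 1" using Z by (simp add: ennreal_mult[symmetric])
  finally show ?thesis .
qed

text \<open>Completing the square: as a function of \<open>z\<close> the product is a Gaussian around the weighted mean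
  \<open>t\<close> of \<open>x\<close> and \<open>y\<close>, times a Gaussian in \<open>x - y\<close>.\<close>

lemma gauss_convolution:
  assumes a: "0 < a" and b: "0 < b"
  shows "(\<integral>\<^sup>+z. ennreal (gauss a (x - z) * gauss b (z - y :: real ^ 'n::finite)) \<partial>lborel)
     = ennreal (gauss (sqrt (a\<^sup>2 + b\<^sup>2)) (x - y))"
proof -
  define Z where "Z = gauss_mass TYPE('n)"
  define d where "d = CARD('n)"
  define s where "s = sqrt (a\<^sup>2 + b\<^sup>2)"
  define c where "c = a * b / s"
  define t where "t = (1 / s\<^sup>2) *\<^sub>R (b\<^sup>2 *\<^sub>R x + a\<^sup>2 *\<^sub>R y)"
  have Z: "0 < Z" by (simp add: Z_def gauss_mass_pos)
  have s2: "s\<^sup>2 = a\<^sup>2 + b\<^sup>2" by (simp add: s_def)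
  have s: "0 < s" using a b by (simp add: s_def add_pos_pos)
  have c: "0 < c" using a b s by (simp add: c_def)
  have square: "(norm (x - z))\<^sup>2 / a\<^sup>2 + (norm (z - y))\<^sup>2 / b\<^sup>2 = (norm (x - y))\<^sup>2 / s\<^sup>2 + (norm (z - t))\<^sup>2 / c\<^sup>2" for z
  proof -
    have c2: "c\<^sup>2 = a\<^sup>2 * b\<^sup>2 / s\<^sup>2" by (simp add: c_def power_divide power_mult_distrib)
    define A B S where "A = a\<^sup>2" and "B = b\<^sup>2" and "S = s\<^sup>2"
    have AB: "0 < A" "0 < B" "S = A + B" using a b s2 by (auto simp: A_def B_def S_def)
    have "S *\<^sub>R t = B *\<^sub>R x + A *\<^sub>R y"
      using AB by (simp add: t_def A_def[symmetric] B_def[symmetric] S_def[symmetric])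
    then have "S *\<^sub>R (z - t) = S *\<^sub>R z - B *\<^sub>R x - A *\<^sub>R y"
      by (simp add: scaleR_diff_right)
    then have "S\<^sup>2 * (norm (z - t))\<^sup>2 = (norm (S *\<^sub>R z - B *\<^sub>R x - A *\<^sub>R y))\<^sup>2"
      by (metis norm_scaleR power_mult_distrib power2_abs)
    also have "S *\<^sub>R z - B *\<^sub>R x - A *\<^sub>R y = A *\<^sub>R (z - y) - B *\<^sub>R (x - z)"
      by (simp add: AB(3) algebra_simps)
    also have "(norm (A *\<^sub>R (z - y) - B *\<^sub>R (x - z)))\<^sup>2
        = A\<^sup>2 * (norm (z - y))\<^sup>2 - 2 * A * B * ((z - y) \<bullet> (x - z)) + B\<^sup>2 * (norm (x - z))\<^sup>2"
      unfolding power2_norm_eq_inner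
      by (simp add: inner_diff_left inner_diff_right inner_commute algebra_simps power2_eq_square)
    finally have e1: "S\<^sup>2 * (norm (z - t))\<^sup>2
        = A\<^sup>2 * (norm (z - y))\<^sup>2 - 2 * A * B * ((z - y) \<bullet> (x - z)) + B\<^sup>2 * (norm (x - z))\<^sup>2" .
    have "(norm (x - y))\<^sup>2 = (norm ((x - z) + (z - y)))\<^sup>2" by simp
    also have "\<dots> = (norm (x - z))\<^sup>2 + 2 * ((z - y) \<bullet> (x - z)) + (norm (z - y))\<^sup>2"
      unfolding power2_norm_eq_inner by (simp add: inner_diff_left inner_diff_right inner_commute algebra_simps)
    finally have e2: "(norm (x - y))\<^sup>2 = (norm (x - z))\<^sup>2 + 2 * ((z - y) \<bullet> (x - z)) + (norm (z - y))\<^sup>2" .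
    define p q w u v where "p = (norm (x - z))\<^sup>2" and "q = (norm (z - y))\<^sup>2" and "w = (z - y) \<bullet> (x - z)"
      and "u = (norm (z - t))\<^sup>2" and "v = (norm (x - y))\<^sup>2"
    have e1': "S\<^sup>2 * u = A\<^sup>2 * q - 2 * A * B * w + B\<^sup>2 * p" using e1 by (simp add: u_def q_def w_def p_def)
    have e2': "v = p + 2 * w + q" using e2 by (simp add: v_def q_def w_def p_def)
    have "(p / A + q / B) * (A * B * S) = (v / S + u / (A * B / S)) * (A * B * S)"
    proof -
      have "(p / A + q / B) * (A * B * S) = (p * B + q * A) * S" using AB by (simp add: field_simps)
      moreover have "(v / S + u / (A * B / S)) * (A * B * S) = v * A * B + S\<^sup>2 * u"
        using AB(1,2) less_imp_neq[OF add_pos_pos[OF AB(1,2)]] unfolding AB(3)[symmetric]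
        by (simp add: field_simps power2_eq_square)
      moreover have "(p * B + q * A) * S = v * A * B + S\<^sup>2 * u"
        unfolding e1' unfolding e2' AB(3) by (simp add: algebra_simps power2_eq_square)
      ultimately show ?thesis by simp
    qed
    moreover have "A * B * S \<noteq> 0" using AB by auto
    ultimately have "p / A + q / B = v / S + u / (A * B / S)" by (metis mult_right_cancel)
    then show ?thesis
      unfolding c2 by (simp add: p_def q_def u_def v_def A_def B_def S_def)
  qed
  have ptw: "gauss a (x - z) * gauss b (z - y) = exp (- (norm (x - y))\<^sup>2 / s\<^sup>2) / (Z\<^sup>2 * (a * b) ^ d) * exp (- (norm (z - t))\<^sup>2 / c\<^sup>2)" for z
  proof -
    have "gauss a (x - z) * gauss b (z - y) = exp (- ((norm (x - z))\<^sup>2 / a\<^sup>2 + (norm (z - y))\<^sup>2 / b\<^sup>2)) / (Z\<^sup>2 * (a * b) ^ d)"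
      unfolding gauss_def Z_def[symmetric] d_def[symmetric]
      by (simp add: exp_add[symmetric] exp_diff power_mult_distrib power2_eq_square algebra_simps exp_minus field_simps)
    also have "\<dots> = exp (- ((norm (x - y))\<^sup>2 / s\<^sup>2 + (norm (z - t))\<^sup>2 / c\<^sup>2)) / (Z\<^sup>2 * (a * b) ^ d)"
      by (simp only: square)
    finally show ?thesis by (simp add: exp_diff exp_minus field_simps)
  qed
  have "(\<integral>\<^sup>+z. ennreal (gauss a (x - z) * gauss b (z - y)) \<partial>lborel)
      = ennreal (exp (- (norm (x - y))\<^sup>2 / s\<^sup>2) / (Z\<^sup>2 * (a * b) ^ d)) * ennreal (Z * c ^ d)"
    unfolding ptw Z_def d_def nn_integral_exp_norm_scaled[OF c, of t, symmetric]
    by (subst nn_integral_cmult[symmetric], measurable, intro nn_integral_cong ennreal_mult)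
       (use a b Z in \<open>auto simp: Z_def\<close>)
  also have "\<dots> = ennreal (gauss s (x - y))"
    using a b Z s c
    by (simp add: ennreal_mult[symmetric] gauss_def Z_def[symmetric] d_def[symmetric] c_def field_simps power2_eq_square power_mult_distrib power_divide)
  finally show ?thesis by (simp add: s_def)
qed

definition heat :: "(real ^ 'n::finite) measure \<Rightarrow> real \<Rightarrow> real ^ 'n \<Rightarrow> real" where
  "heat m r x = (\<integral>y. gauss r (x - y) \<partial>m)"

locale finite_borel_measure = finite_measure m for m :: "(real ^ 'n::finite) measure" +
  assumes sets_m [measurable_cong]: "sets m = sets borel"
begin

lemma space_m: "space m = UNIV" using sets_eq_imp_space_eq[OF sets_m] by simp

lemma emeasure_UNIV_finite: "emeasure m UNIV < top"
  by (rule emeasure_finite[of UNIV, unfolded infinity_ennreal_def less_top])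

lemma sigma_m: "sigma_finite_measure m" by unfold_locales

lemma integrable_gauss_m: "0 < r \<Longrightarrow> integrable m (\<lambda>y. gauss r (x - y))"
  by (rule integrable_const_bound[of _ "1 / (gauss_mass TYPE('n) * r ^ CARD('n))"])
     (auto simp: gauss_le gauss_nonneg)

lemma heat_nonneg: "0 < r \<Longrightarrow> 0 \<le> heat m r x"
  unfolding heat_def by (intro integral_nonneg_AE AE_I2 gauss_nonneg)

lemma measurable_heat [measurable]: "heat m r \<in> borel_measurable borel"
  unfolding heat_def[abs_def] by (rule borel_measurable_lebesgue_integral) measurable

lemma ennreal_heat: "0 < r \<Longrightarrow> ennreal (heat m r x) = (\<integral>\<^sup>+y. ennreal (gauss r (x - y)) \<partial>m)"
  unfolding heat_def by (intro nn_integral_eq_integral[symmetric] integrable_gauss_m AE_I2 gauss_nonneg)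

lemma nn_integral_heat:
  assumes r: "0 < r" shows "(\<integral>\<^sup>+x. ennreal (heat m r x) \<partial>lborel) = emeasure m UNIV"
proof -
  interpret pair_sigma_finite lborel m by (intro pair_sigma_finite.intro sigma_m lborel.sigma_finite_measure_axioms)
  have "(\<integral>\<^sup>+x. ennreal (heat m r x) \<partial>lborel) = (\<integral>\<^sup>+x. \<integral>\<^sup>+y. ennreal (gauss r (x - y)) \<partial>m \<partial>lborel)"
    by (simp add: ennreal_heat[OF r])
  also have "\<dots> = (\<integral>\<^sup>+y. \<integral>\<^sup>+x. ennreal (gauss r (x - y)) \<partial>lborel \<partial>m)"
    by (rule Fubini'[symmetric]) measurable
  also have "\<dots> = emeasure m UNIV" by (simp add: nn_integral_gauss[OF r] space_m)
  finally show ?thesis .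
qed

lemma integrable_heat: "0 < r \<Longrightarrow> integrable lborel (heat m r)"
  using nn_integral_heat[of r] emeasure_UNIV_finite
  by (intro integrableI_bounded) (auto simp: heat_nonneg)

lemma heat_convolution:
  assumes a: "0 < a" and b: "0 < b"
  shows "heat m (sqrt (a\<^sup>2 + b\<^sup>2)) x = (\<integral>z. gauss a (x - z) * heat m b z \<partial>lborel)"
    "integrable lborel (\<lambda>z. gauss a (x - z) * heat m b z)"
proof -
  define s where "s = sqrt (a\<^sup>2 + b\<^sup>2)"
  have s: "0 < s" using a b by (simp add: s_def add_pos_pos)
  interpret pair_sigma_finite lborel m by (intro pair_sigma_finite.intro sigma_m lborel.sigma_finite_measure_axioms)
  have "ennreal (heat m s x) = (\<integral>\<^sup>+y. \<integral>\<^sup>+z. ennreal (gauss a (x - z) * gauss b (z - y)) \<partial>lborel \<partial>m)"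
    by (simp add: ennreal_heat[OF s] gauss_convolution[OF a b] s_def[symmetric])
  also have "\<dots> = (\<integral>\<^sup>+z. \<integral>\<^sup>+y. ennreal (gauss a (x - z) * gauss b (z - y)) \<partial>m \<partial>lborel)"
    by (rule Fubini') measurable
  also have "\<dots> = (\<integral>\<^sup>+z. ennreal (gauss a (x - z) * heat m b z) \<partial>lborel)"
    using a b by (simp add: ennreal_mult gauss_nonneg heat_nonneg nn_integral_cmult ennreal_heat)
  finally have eq: "(\<integral>\<^sup>+z. ennreal (gauss a (x - z) * heat m b z) \<partial>lborel) = ennreal (heat m s x)" ..
  have nn: "0 \<le> gauss a (x - z) * heat m b z" for z
    using a b by (simp add: gauss_nonneg heat_nonneg)
  show "integrable lborel (\<lambda>z. gauss a (x - z) * heat m b z)"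
    using eq nn by (intro integrableI_bounded) auto
  show "heat m (sqrt (a\<^sup>2 + b\<^sup>2)) x = (\<integral>z. gauss a (x - z) * heat m b z \<partial>lborel)"
    using eq nn heat_nonneg[OF s] by (subst integral_eq_nn_integral) (auto simp: s_def)
qed

text \<open>Smoothing can be moved from the measure to the test function: the pairing of \<open>W\<close> with the
  smoothed measure is a Gaussian average of pairings of \<open>m\<close> with translates of \<open>W\<close>.\<close>

lemma heat_pairing:
  assumes r: "0 < r" and W [measurable]: "W \<in> borel_measurable borel" and B: "\<And>x. \<bar>W x\<bar> \<le> B"
  shows "(\<integral>x. W x * heat m r x \<partial>lborel) = (\<integral>z. gauss r z * (\<integral>y. W (y + z) \<partial>m) \<partial>lborel)"
    "integrable lborel (\<lambda>z. gauss r z * (\<integral>y. W (y + z) \<partial>m))"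
    "integrable lborel (\<lambda>x. W x * heat m r x)"
proof -
  have B0: "0 \<le> B" using B[of 0] by simp
  have bd: "ennreal \<bar>W x * gauss r z\<bar> \<le> ennreal B * ennreal (gauss r z)" for x z
  proof -
    have "\<bar>W x * gauss r z\<bar> \<le> B * gauss r z"
      using B[of x] gauss_nonneg[OF r, of z] by (simp add: abs_mult mult_right_mono)
    then show ?thesis using B0 gauss_nonneg[OF r, of z] by (simp add: ennreal_mult[symmetric] ennreal_leI)
  qed
  have fin1: "(\<integral>\<^sup>+x. \<integral>\<^sup>+y. ennreal \<bar>W x * gauss r (x - y)\<bar> \<partial>m \<partial>lborel) < \<infinity>"
  proof -
    have "(\<integral>\<^sup>+x. \<integral>\<^sup>+y. ennreal \<bar>W x * gauss r (x - y)\<bar> \<partial>m \<partial>lborel)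
        \<le> (\<integral>\<^sup>+x. \<integral>\<^sup>+y. ennreal B * ennreal (gauss r (x - y)) \<partial>m \<partial>lborel)"
      by (intro nn_integral_mono bd)
    also have "\<dots> = ennreal B * emeasure m UNIV"
      by (simp add: nn_integral_cmult ennreal_heat[OF r, symmetric] nn_integral_heat[OF r])
    also have "\<dots> < \<infinity>" using emeasure_UNIV_finite by (simp add: ennreal_mult_less_top)
    finally show ?thesis .
  qed
  have fin2: "(\<integral>\<^sup>+z. \<integral>\<^sup>+y. ennreal \<bar>gauss r z * W (y + z)\<bar> \<partial>m \<partial>lborel) < \<infinity>"
  proof -
    have "(\<integral>\<^sup>+z. \<integral>\<^sup>+y. ennreal \<bar>gauss r z * W (y + z)\<bar> \<partial>m \<partial>lborel)
        \<le> (\<integral>\<^sup>+(z :: real ^ 'n). \<integral>\<^sup>+y. ennreal B * ennreal (gauss r z) \<partial>m \<partial>lborel)"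
    proof (intro nn_integral_mono)
      fix z y :: "real ^ 'n"
      show "ennreal \<bar>gauss r z * W (y + z)\<bar> \<le> ennreal B * ennreal (gauss r z)"
        using bd[of "y + z" z] by (simp only: mult.commute[of "gauss r z"])
    qed
    also have "\<dots> = ennreal B * emeasure m UNIV"
      using nn_integral_gauss[OF r, of "0 :: real ^ 'n"] by (simp add: nn_integral_cmult nn_integral_multc space_m)
    also have "\<dots> < \<infinity>" using emeasure_UNIV_finite by (simp add: ennreal_mult_less_top)
    finally show ?thesis .
  qed
  note F1 = Fubini_swap[OF lborel.sigma_finite_measure_axioms sigma_m _ fin1]
  note F2 = Fubini_swap[OF lborel.sigma_finite_measure_axioms sigma_m _ fin2]
  have m1: "(\<lambda>(x, y). W x * gauss r (x - y)) \<in> borel_measurable (lborel \<Otimes>\<^sub>M m)" by measurable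
  have m2: "(\<lambda>(z, y). gauss r z * W (y + z)) \<in> borel_measurable (lborel \<Otimes>\<^sub>M m)" by measurable
  have "(\<integral>x. W x * heat m r x \<partial>lborel) = (\<integral>x. \<integral>y. W x * gauss r (x - y) \<partial>m \<partial>lborel)"
    by (simp add: heat_def)
  also have "\<dots> = (\<integral>y. \<integral>x. W x * gauss r (x - y) \<partial>lborel \<partial>m)" by (rule F1(1)[OF m1])
  also have "\<dots> = (\<integral>y. \<integral>z. gauss r z * W (y + z) \<partial>lborel \<partial>m)"
  proof -
    have "(\<integral>x. W x * gauss r (x - y) \<partial>lborel) = (\<integral>z. gauss r z * W (y + z) \<partial>lborel)" for y
      using integral_lborel_translate[of "\<lambda>x. W x * gauss r (x - y)" y] by (simp add: mult.commute)
    then show ?thesis by simp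
  qed
  also have "\<dots> = (\<integral>z. \<integral>y. gauss r z * W (y + z) \<partial>m \<partial>lborel)" by (rule F2(1)[OF m2, symmetric])
  finally show "(\<integral>x. W x * heat m r x \<partial>lborel) = (\<integral>z. gauss r z * (\<integral>y. W (y + z) \<partial>m) \<partial>lborel)" by simp
  show "integrable lborel (\<lambda>z. gauss r z * (\<integral>y. W (y + z) \<partial>m))"
    using F2(2)[OF m2] by simp
  show "integrable lborel (\<lambda>x. W x * heat m r x)"
    using F1(2)[OF m1] by (simp add: heat_def)
qed

end

section \<open>Choquet integrals over contents of laminar families\<close>

lemma ennreal_add_less_self: "a < \<infinity> \<Longrightarrow> 0 < b \<Longrightarrow> (a::ennreal) < a + b"
  by (cases a; cases b) (auto simp: ennreal_plus[symmetric] ennreal_less_iff simp del: ennreal_plus)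

lemma ennreal_add_right_le_cancel: "(a::ennreal) + b \<le> c + b \<Longrightarrow> b < \<infinity> \<Longrightarrow> a \<le> c"
  by (metis ennreal_add_left_cancel_le add.commute infinity_ennreal_def not_less_iff_gr_or_eq top.not_eq_extremum)

definition choquet :: "('a set \<Rightarrow> ennreal) \<Rightarrow> ('a \<Rightarrow> ennreal) \<Rightarrow> ennreal" where
  "choquet H f = (\<integral>\<^sup>+t\<in>{0<..}. H {x. f x > ennreal t} \<partial>lborel)"

text \<open>The abstract form of dyadic cubes with a power of the diameter as weight. Monotonicity of the
  weight makes it profitable to keep only the maximal members of a cover, positivity ensures that
  maximal members exist.\<close>

locale weighted_laminar =
  fixes \<D> :: "'a set set" and w :: "'a set \<Rightarrow> ennreal"
  assumes countable_family: "countable \<D>"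
    and laminar: "A \<in> \<D> \<Longrightarrow> B \<in> \<D> \<Longrightarrow> A \<inter> B = {} \<or> A \<subseteq> B \<or> B \<subseteq> A"
    and weight_mono: "A \<in> \<D> \<Longrightarrow> B \<in> \<D> \<Longrightarrow> A \<subseteq> B \<Longrightarrow> w A \<le> w B"
    and weight_pos: "A \<in> \<D> \<Longrightarrow> 0 < w A"
    and weight_fin: "A \<in> \<D> \<Longrightarrow> w A < \<infinity>"
begin

definition weight_sum :: "'a set set \<Rightarrow> ennreal" where
  "weight_sum P = (\<integral>\<^sup>+A. w A * indicator P A \<partial>count_space \<D>)"

definition covering_content :: "'a set \<Rightarrow> ennreal" where
  "covering_content E = Inf {weight_sum P | P. P \<subseteq> \<D> \<and> E \<subseteq> \<Union>P}"

lemma covering_content_le: "P \<subseteq> \<D> \<Longrightarrow> E \<subseteq> \<Union>P \<Longrightarrow> covering_content E \<le> weight_sum P"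
  unfolding covering_content_def by (intro Inf_lower) auto

lemma covering_content_mono: "E \<subseteq> E' \<Longrightarrow> covering_content E \<le> covering_content E'"
  unfolding covering_content_def by (intro Inf_superset_mono) blast

lemma covering_content_approx:
  assumes "covering_content E < c"
  obtains P where "P \<subseteq> \<D>" "E \<subseteq> \<Union>P" "weight_sum P < c"
  using assms unfolding covering_content_def Inf_less_iff by auto

lemma weight_sum_singleton: "A \<in> \<D> \<Longrightarrow> weight_sum {A} = w A"
  unfolding weight_sum_def by (subst nn_integral_count_space'[where A = "{A}"]) (auto simp: indicator_def)

lemma covering_content_le_weight: "A \<in> \<D> \<Longrightarrow> E \<subseteq> A \<Longrightarrow> covering_content E \<le> w A"
  using covering_content_le[of "{A}" E] by (auto simp: weight_sum_singleton)

lemma covering_content_empty: "covering_content {} = 0"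
  using covering_content_le[of "{}" "{}"] by (auto simp: weight_sum_def)

lemma weight_sum_UN:
  "weight_sum (\<Union>n. P n) \<le> (\<Sum>n. weight_sum (P n))" for P :: "nat \<Rightarrow> 'a set set"
proof -
  have "weight_sum (\<Union>n. P n) \<le> (\<integral>\<^sup>+A. (\<Sum>n. w A * indicator (P n) A) \<partial>count_space \<D>)"
    unfolding weight_sum_def
  proof (intro nn_integral_mono)
    fix A
    show "w A * indicator (\<Union>n. P n) A \<le> (\<Sum>n. w A * indicator (P n) A)"
    proof (cases "\<exists>n. A \<in> P n")
      case True
      then obtain n where "A \<in> P n" by auto
      then have "w A * indicator (\<Union>n. P n) A = (\<Sum>i\<in>{n}. w A * indicator (P i) A)"
        by (auto simp: indicator_def)
      also have "\<dots> \<le> (\<Sum>n. w A * indicator (P n) A)"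
        by (rule sum_le_suminf) auto
      finally show ?thesis .
    qed auto
  qed
  also have "\<dots> = (\<Sum>n. weight_sum (P n))"
    unfolding weight_sum_def by (subst nn_integral_suminf) auto
  finally show ?thesis .
qed

lemma covering_content_countably_subadditive:
  "covering_content (\<Union>n. E n) \<le> (\<Sum>n. covering_content (E n))" for E :: "nat \<Rightarrow> 'a set"
proof (cases "(\<Sum>n. covering_content (E n)) = \<infinity>")
  case False
  have fin: "covering_content (E n) < \<infinity>" for n
    using False by (metis ennreal_suminf_lessD infinity_ennreal_def top.not_eq_extremum)
  show ?thesis
  proof (rule ennreal_le_epsilon)
    fix e :: real assume "0 < e"
    have "\<exists>P\<subseteq>\<D>. E n \<subseteq> \<Union>P \<and> weight_sum P < covering_content (E n) + ennreal (e * (1/2)^Suc n)" for n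
    proof -
      have "covering_content (E n) < covering_content (E n) + ennreal (e * (1/2)^Suc n)"
        using fin[of n] \<open>0 < e\<close> by (intro ennreal_add_less_self) auto
      then show ?thesis by (meson covering_content_approx)
    qed
    then obtain P where P: "\<And>n. P n \<subseteq> \<D>" "\<And>n. E n \<subseteq> \<Union>(P n)"
      "\<And>n. weight_sum (P n) < covering_content (E n) + ennreal (e * (1/2)^Suc n)" by metis
    have "covering_content (\<Union>n. E n) \<le> weight_sum (\<Union>n. P n)"
    proof (rule covering_content_le)
      show "(\<Union>n. P n) \<subseteq> \<D>" using P(1) by (rule UN_least)
      have "E n \<subseteq> \<Union>(\<Union>n. P n)" for n
        by (rule order.trans[OF P(2)[of n]]) (rule Union_mono, rule UN_upper, rule UNIV_I)
      then show "(\<Union>n. E n) \<subseteq> \<Union>(\<Union>n. P n)" by (rule UN_least)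
    qed
    also have "\<dots> \<le> (\<Sum>n. weight_sum (P n))" by (rule weight_sum_UN)
    also have "\<dots> \<le> (\<Sum>n. covering_content (E n) + ennreal (e * (1/2)^Suc n))"
      by (intro suminf_le less_imp_le P) auto
    also have "\<dots> = (\<Sum>n. covering_content (E n)) + (\<Sum>n. ennreal (e * (1/2)^Suc n))"
      by (subst suminf_add) auto
    also have "(\<Sum>n. ennreal (e * (1/2)^Suc n)) = ennreal e"
    proof (rule suminf_ennreal_eq)
      show "(\<lambda>n. e * (1 / 2) ^ Suc n) sums e"
        using sums_mult[OF power_half_series, of e] by simp
    qed (use \<open>0 < e\<close> in auto)
    finally show "covering_content (\<Union>n. E n) \<le> (\<Sum>n. covering_content (E n)) + ennreal e" .
  qed
qed auto

text \<open>Every member containing a given \<open>A\<close> weighs at least \<open>w A > 0\<close>. If the total weight is finite,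
  only finitely many members contain \<open>A\<close>, hence there is a maximal one.\<close>

lemma antichain_cover:
  assumes P: "P \<subseteq> \<D>" "E \<subseteq> \<Union>P" and fin: "weight_sum P < \<infinity>"
  obtains P' where "P' \<subseteq> P" "E \<subseteq> \<Union>P'" "\<And>A B. A \<in> P' \<Longrightarrow> B \<in> P' \<Longrightarrow> \<not> A \<subset> B"
proof -
  define P' where "P' = {A \<in> P. \<forall>B\<in>P. \<not> A \<subset> B}"
  have *: "\<exists>B\<in>P'. A \<subseteq> B" if A: "A \<in> P" for A
  proof -
    define S where "S = {B \<in> P. A \<subseteq> B}"
    have "finite S"
    proof (rule ccontr)
      assume inf: "infinite S"
      have "w A * emeasure (count_space \<D>) S = (\<integral>\<^sup>+B. w A * indicator S B \<partial>count_space \<D>)"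
        using P by (subst nn_integral_cmult_indicator) (auto simp: S_def)
      also have "\<dots> \<le> weight_sum P"
        unfolding weight_sum_def using A P
        by (intro nn_integral_mono) (auto simp: S_def indicator_def intro!: weight_mono)
      finally have "w A * emeasure (count_space \<D>) S \<le> weight_sum P" .
      moreover have "emeasure (count_space \<D>) S = \<infinity>"
        using inf P by (subst emeasure_count_space) (auto simp: S_def)
      moreover have "0 < w A" using weight_pos A P by auto
      ultimately show False
        using fin by (auto simp: ennreal_mult_top split: if_splits)
    qed
    moreover have "A \<in> S" using A by (auto simp: S_def)
    ultimately obtain B where B: "B \<in> S" "\<forall>C\<in>S. B \<subseteq> C \<longrightarrow> B = C"
      using finite_has_maximal2[of S A] by auto
    then have "B \<in> P'" unfolding P'_def S_def by auto
    with B show ?thesis unfolding S_def by auto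
  qed
  show thesis
  proof (rule that[of P'])
    show "E \<subseteq> \<Union>P'" using * P by blast
  qed (auto simp: P'_def)
qed

lemma weight_sum_mono: "P \<subseteq> P' \<Longrightarrow> weight_sum P \<le> weight_sum P'"
  unfolding weight_sum_def by (intro nn_integral_mono mult_left_mono) (auto simp: indicator_def)

lemma weight_sum_rearrange:
  assumes "P1 \<subseteq> P" "R1 \<subseteq> R"
  shows "weight_sum ((P - P1) \<union> (R - R1)) + weight_sum (P1 \<union> R1) \<le> weight_sum P + weight_sum R"
  unfolding weight_sum_def
  by (subst (1 2) nn_integral_add[symmetric])
     (use assms in \<open>auto intro!: nn_integral_mono simp: indicator_def\<close>)

text \<open>Let \<open>P\<close> and \<open>R\<close> be covers of \<open>A\<close> and \<open>B\<close> by pairwise incomparable sets. Remove from \<open>P\<close> the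
  sets \<open>P1\<close> that lie strictly inside a member of \<open>R\<close>, and from \<open>R\<close> the sets \<open>R1\<close> that lie inside a
  member of \<open>P\<close>. What is left still covers \<open>A \<union> B\<close>, as the larger sets remain. The removed sets
  cover \<open>A \<inter> B\<close>: a common point lies in a member of \<open>P\<close> and one of \<open>R\<close>, which are nested by
  laminarity. Only one of the two inclusions is strict, so that a set belonging to both covers is
  counted once on each side.\<close>

lemma covering_content_strongly_subadditive:
  "covering_content (A \<union> B) + covering_content (A \<inter> B) \<le> covering_content A + covering_content B"
proof (cases "covering_content A = \<infinity> \<or> covering_content B = \<infinity>")
  case False
  then have fA: "covering_content A < \<infinity>" and fB: "covering_content B < \<infinity>"
    by (auto simp: less_top)
  show ?thesis
  proof (rule ennreal_le_epsilon)
    fix e :: real assume "0 < e"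
    obtain P0 where P0: "P0 \<subseteq> \<D>" "A \<subseteq> \<Union>P0" "weight_sum P0 < covering_content A + ennreal (e/2)"
      using covering_content_approx[OF ennreal_add_less_self[OF fA, of "ennreal (e/2)"]] \<open>0 < e\<close> by auto
    obtain R0 where R0: "R0 \<subseteq> \<D>" "B \<subseteq> \<Union>R0" "weight_sum R0 < covering_content B + ennreal (e/2)"
      using covering_content_approx[OF ennreal_add_less_self[OF fB, of "ennreal (e/2)"]] \<open>0 < e\<close> by auto
    obtain P where P: "P \<subseteq> P0" "A \<subseteq> \<Union>P" "\<And>A B. A \<in> P \<Longrightarrow> B \<in> P \<Longrightarrow> \<not> A \<subset> B"
      using antichain_cover[OF P0(1,2)] P0(3) by (metis infinity_ennreal_def order_less_le_trans top_greatest)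
    obtain R where R: "R \<subseteq> R0" "B \<subseteq> \<Union>R" "\<And>A B. A \<in> R \<Longrightarrow> B \<in> R \<Longrightarrow> \<not> A \<subset> B"
      using antichain_cover[OF R0(1,2)] R0(3) by (metis infinity_ennreal_def order_less_le_trans top_greatest)
    define P1 where "P1 = {C \<in> P. \<exists>D\<in>R. C \<subset> D}"
    define R1 where "R1 = {C \<in> R. \<exists>D\<in>P. C \<subseteq> D}"
    have "covering_content (A \<union> B) \<le> weight_sum ((P - P1) \<union> (R - R1))"
    proof (rule covering_content_le)
      show "A \<union> B \<subseteq> \<Union>((P - P1) \<union> (R - R1))"
      proof
        fix x assume "x \<in> A \<union> B"
        then consider C where "x \<in> C" "C \<in> P" | C where "x \<in> C" "C \<in> R"
          using P(2) R(2) by auto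
        then show "x \<in> \<Union>((P - P1) \<union> (R - R1))"
        proof cases
          case 1
          show ?thesis
          proof (cases "C \<in> P1")
            case True
            then obtain D where D: "D \<in> R" "C \<subset> D" unfolding P1_def by auto
            have "D \<notin> R1"
            proof
              assume "D \<in> R1"
              then obtain C' where "C' \<in> P" "D \<subseteq> C'" unfolding R1_def by auto
              with P(3)[of C C'] D 1 show False by auto
            qed
            with D 1 show ?thesis by auto
          qed (use 1 in auto)
        next
          case 2
          show ?thesis
          proof (cases "C \<in> R1")
            case True
            then obtain D where D: "D \<in> P" "C \<subseteq> D" unfolding R1_def by auto
            have "D \<notin> P1"
            proof
              assume "D \<in> P1"
              then obtain C' where "C' \<in> R" "D \<subset> C'" unfolding P1_def by auto
              with R(3)[of C C'] D 2 show False by auto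
            qed
            with D 2 show ?thesis by auto
          qed (use 2 in auto)
        qed
      qed
      show "(P - P1) \<union> (R - R1) \<subseteq> \<D>"
        by (intro Un_least order.trans[OF Diff_subset] order.trans[OF P(1)] order.trans[OF R(1)] P0(1) R0(1))
    qed
    moreover have "covering_content (A \<inter> B) \<le> weight_sum (P1 \<union> R1)"
    proof (rule covering_content_le)
      show "P1 \<union> R1 \<subseteq> \<D>" unfolding P1_def R1_def
        by (intro Un_least order.trans[OF Collect_restrict] order.trans[OF P(1)] order.trans[OF R(1)] P0(1) R0(1))
      show "A \<inter> B \<subseteq> \<Union>(P1 \<union> R1)"
      proof
        fix x assume "x \<in> A \<inter> B"
        then have "x \<in> \<Union>P" "x \<in> \<Union>R" using P(2) R(2) by auto
        then obtain C D where CD: "C \<in> P" "D \<in> R" "x \<in> C" "x \<in> D"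
          by (elim UnionE)
        then have "C \<in> \<D>" "D \<in> \<D>" using P(1) R(1) P0(1) R0(1) by auto
        from laminar[OF this] CD have "C \<subset> D \<or> D \<subseteq> C" by auto
        then have "C \<in> P1 \<or> D \<in> R1" using CD unfolding P1_def R1_def by auto
        then show "x \<in> \<Union>(P1 \<union> R1)" using CD by auto
      qed
    qed
    ultimately have "covering_content (A \<union> B) + covering_content (A \<inter> B) \<le>
        weight_sum ((P - P1) \<union> (R - R1)) + weight_sum (P1 \<union> R1)"
      by (rule add_mono)
    also have "\<dots> \<le> weight_sum P + weight_sum R"
      by (rule weight_sum_rearrange) (auto simp: P1_def R1_def)
    also have "\<dots> \<le> weight_sum P0 + weight_sum R0"
      by (intro add_mono weight_sum_mono P R)
    also have "\<dots> \<le> (covering_content A + ennreal (e/2)) + (covering_content B + ennreal (e/2))"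
      by (intro add_mono less_imp_le P0 R0)
    also have "\<dots> = covering_content A + covering_content B + (ennreal (e/2) + ennreal (e/2))"
      by (simp add: ac_simps)
    also have "ennreal (e/2) + ennreal (e/2) = ennreal e"
      using \<open>0 < e\<close> by (simp flip: ennreal_plus)
    finally show "covering_content (A \<union> B) + covering_content (A \<inter> B) \<le> covering_content A + covering_content B + ennreal e" .
  qed
qed auto

lemma measurable_antimono_ennreal:
  fixes h :: "real \<Rightarrow> ennreal"
  assumes "antimono h" shows "h \<in> borel_measurable borel"
proof (rule borel_measurableI_greater)
  fix y
  have "is_interval (h -` {y<..})"
    unfolding is_interval_1 vimage_def
  proof (intro ballI allI impI)
    fix a b x assume "a \<in> {x. h x \<in> {y<..}}" "b \<in> {x. h x \<in> {y<..}}" "a \<le> x \<and> x \<le> b"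
    then show "x \<in> {x. h x \<in> {y<..}}"
      using antimonoD[OF assms, of x b] by simp
  qed
  then have "h -` {y<..} \<in> sets borel"
    by (rule real_interval_borel_measurable)
  then show "{x \<in> space borel. y < h x} \<in> sets borel" by (simp add: vimage_def)
qed

text \<open>The level sets of the sum are \<open>{f > t} \<union> ({f > t - l} \<inter> Q)\<close>. Strong subadditivity bounds the
  increase of their content by \<open>\<phi> (t - l) - \<phi> t\<close> with \<open>\<phi> t\<close> the content of \<open>{f > t} \<inter> Q\<close>. The
  integral of this difference over \<open>t > 0\<close> is at most \<open>l * w Q\<close>. Boundedness of \<open>f\<close> makes the
  integral of \<open>\<phi>\<close> finite, so that it can be cancelled.\<close>

lemma choquet_add_indicator:
  fixes f :: "'a \<Rightarrow> real"
  assumes f: "\<And>x. 0 \<le> f x" "\<And>x. f x \<le> b" and Q: "Q \<in> \<D>" and l: "0 \<le> l"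
  shows "choquet covering_content (\<lambda>x. ennreal (f x + l * indicator Q x)) \<le> choquet covering_content (\<lambda>x. ennreal (f x)) + ennreal l * w Q"
proof -
  define \<phi> where "\<phi> t = covering_content ({x. f x > t} \<inter> Q)" for t
  define H1 where "H1 t = covering_content {x. f x + l * indicator Q x > t}" for t
  define H0 where "H0 t = covering_content {x. f x > t}" for t
  have meas: "\<phi> \<in> borel_measurable borel" "H0 \<in> borel_measurable borel" "H1 \<in> borel_measurable borel"
    unfolding \<phi>_def H1_def H0_def
    by (rule measurable_antimono_ennreal; rule antimonoI; rule covering_content_mono; fastforce)+
  have le: "\<phi> t \<le> w Q" for t unfolding \<phi>_def by (rule covering_content_le_weight[OF Q]) auto
  have key: "H1 t + \<phi> t \<le> H0 t + \<phi> (t - l)" for t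
  proof -
    have e1: "{x. f x + l * indicator Q x > t} = {x. f x > t} \<union> ({x. f x > t - l} \<inter> Q)"
      using l by (auto simp: indicator_def split: if_splits)
    have e2: "{x. f x > t} \<inter> Q = {x. f x > t} \<inter> ({x. f x > t - l} \<inter> Q)"
      using l by auto
    show ?thesis
      unfolding H1_def H0_def \<phi>_def e1
      by (subst e2) (rule covering_content_strongly_subadditive)
  qed
  have fin: "(\<integral>\<^sup>+t\<in>{0<..}. \<phi> t \<partial>lborel) < \<infinity>"
  proof -
    have b: "0 \<le> b" using f(1)[of undefined] f(2)[of undefined] by linarith
    have "(\<integral>\<^sup>+t\<in>{0<..}. \<phi> t \<partial>lborel) \<le> (\<integral>\<^sup>+t. w Q * indicator {0..b} t \<partial>lborel)"
    proof (intro nn_integral_mono)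
      fix t :: real
      have "\<phi> t = 0" if "t > b"
      proof -
        have "\<not> t < f x" for x using that f(2)[of x] by linarith
        then have "{x. f x > t} \<inter> Q = {}" by auto
        then show ?thesis by (simp add: \<phi>_def covering_content_empty)
      qed
      then show "\<phi> t * indicator {0<..} t \<le> w Q * indicator {0..b} t"
        using le[of t] by (cases "t > b") (auto simp: indicator_def)
    qed
    also have "\<dots> = w Q * ennreal b" using b by (subst nn_integral_cmult_indicator) auto
    also have "\<dots> < \<infinity>" using weight_fin[OF Q] by (simp add: ennreal_mult_less_top)
    finally show ?thesis .
  qed
  have "(\<integral>\<^sup>+t\<in>{0<..}. \<phi> (t - l) \<partial>lborel) = (\<integral>\<^sup>+t. \<phi> t * indicator {-l<..} t \<partial>lborel)"
    using meas by (subst nn_integral_real_affine[where c = 1 and t = "l"])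
      (auto simp: indicator_def intro!: nn_integral_cong)
  also have "\<dots> \<le> (\<integral>\<^sup>+t. w Q * indicator {-l..0} t + \<phi> t * indicator {0<..} t \<partial>lborel)"
    using le by (intro nn_integral_mono) (auto simp: indicator_def)
  also have "\<dots> = ennreal l * w Q + (\<integral>\<^sup>+t\<in>{0<..}. \<phi> t \<partial>lborel)"
    using l meas by (subst nn_integral_add) (auto simp: nn_integral_cmult_indicator mult.commute)
  finally have shift: "(\<integral>\<^sup>+t\<in>{0<..}. \<phi> (t - l) \<partial>lborel) \<le> ennreal l * w Q + (\<integral>\<^sup>+t\<in>{0<..}. \<phi> t \<partial>lborel)" .
  have "(\<integral>\<^sup>+t\<in>{0<..}. H1 t \<partial>lborel) + (\<integral>\<^sup>+t\<in>{0<..}. \<phi> t \<partial>lborel)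
      = (\<integral>\<^sup>+t\<in>{0<..}. H1 t + \<phi> t \<partial>lborel)"
    using meas by (subst nn_integral_add[symmetric]) (auto simp: distrib_right)
  also have "\<dots> \<le> (\<integral>\<^sup>+t\<in>{0<..}. H0 t + \<phi> (t - l) \<partial>lborel)"
    using key by (intro nn_integral_mono) (auto simp: indicator_def)
  also have "\<dots> = (\<integral>\<^sup>+t\<in>{0<..}. H0 t \<partial>lborel) + (\<integral>\<^sup>+t\<in>{0<..}. \<phi> (t - l) \<partial>lborel)"
    using meas by (subst nn_integral_add[symmetric]) (auto simp: distrib_right)
  also have "\<dots> \<le> (\<integral>\<^sup>+t\<in>{0<..}. H0 t \<partial>lborel) + (ennreal l * w Q + (\<integral>\<^sup>+t\<in>{0<..}. \<phi> t \<partial>lborel))"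
    by (intro add_mono shift order_refl)
  finally have "(\<integral>\<^sup>+t\<in>{0<..}. H1 t \<partial>lborel) + (\<integral>\<^sup>+t\<in>{0<..}. \<phi> t \<partial>lborel)
      \<le> ((\<integral>\<^sup>+t\<in>{0<..}. H0 t \<partial>lborel) + ennreal l * w Q) + (\<integral>\<^sup>+t\<in>{0<..}. \<phi> t \<partial>lborel)"
    by (simp add: ac_simps)
  then have main: "(\<integral>\<^sup>+t\<in>{0<..}. H1 t \<partial>lborel) \<le> (\<integral>\<^sup>+t\<in>{0<..}. H0 t \<partial>lborel) + ennreal l * w Q"
    using fin by (rule ennreal_add_right_le_cancel)
  have "choquet covering_content (\<lambda>x. ennreal (f x + l * indicator Q x)) = (\<integral>\<^sup>+t\<in>{0<..}. H1 t \<partial>lborel)"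
    unfolding choquet_def H1_def
    by (intro nn_integral_cong) (auto simp: indicator_def ennreal_less_iff)
  moreover have "choquet covering_content (\<lambda>x. ennreal (f x)) = (\<integral>\<^sup>+t\<in>{0<..}. H0 t \<partial>lborel)"
    unfolding choquet_def H0_def
    by (intro nn_integral_cong) (auto simp: indicator_def ennreal_less_iff)
  ultimately show ?thesis using main by simp
qed

lemma choquet_finite_sum:
  fixes l :: "'i \<Rightarrow> real"
  assumes "finite I" "\<And>i. i \<in> I \<Longrightarrow> Q i \<in> \<D>" "\<And>i. i \<in> I \<Longrightarrow> 0 \<le> l i"
  shows "choquet covering_content (\<lambda>x. ennreal (\<Sum>i\<in>I. l i * indicator (Q i) x)) \<le> (\<Sum>i\<in>I. ennreal (l i) * w (Q i))"
  using assms
proof (induction I rule: finite_induct)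
  case empty
  have "{x. 0 > ennreal t} = {}" for t :: real by auto
  then show ?case by (simp add: choquet_def covering_content_empty)
next
  case (insert i I)
  have "choquet covering_content (\<lambda>x. ennreal (\<Sum>j\<in>insert i I. l j * indicator (Q j) x))
      = choquet covering_content (\<lambda>x. ennreal ((\<Sum>j\<in>I. l j * indicator (Q j) x) + l i * indicator (Q i) x))"
    by (simp only: sum.insert[OF insert.hyps(1,2)] add.commute)
  also have "\<dots> \<le> choquet covering_content (\<lambda>x. ennreal (\<Sum>j\<in>I. l j * indicator (Q j) x)) + ennreal (l i) * w (Q i)"
  proof (rule choquet_add_indicator)
    show "(\<Sum>j\<in>I. l j * indicator (Q j) x) \<le> (\<Sum>j\<in>I. l j)" for x
      using insert by (intro sum_mono) (auto simp: indicator_def)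
  qed (use insert in \<open>auto intro!: sum_nonneg\<close>)
  also have "\<dots> \<le> (\<Sum>j\<in>I. ennreal (l j) * w (Q j)) + ennreal (l i) * w (Q i)"
    using insert by (intro add_mono insert.IH) auto
  also have "\<dots> = (\<Sum>j\<in>insert i I. ennreal (l j) * w (Q j))"
    using insert by (simp add: add.commute)
  finally show ?case .
qed

lemma choquet_scale:
  assumes "0 < c"
  shows "(\<integral>\<^sup>+t\<in>{0<..}. covering_content {x. g x > ennreal (c * t)} \<partial>lborel) = ennreal (1 / c) * choquet covering_content g"
proof -
  have m: "(\<lambda>t. covering_content {x. g x > ennreal t}) \<in> borel_measurable borel"
    by (intro measurable_antimono_ennreal antimonoI covering_content_mono)
       (auto intro: order.strict_trans1 ennreal_leI)
  have "choquet covering_content g = ennreal c * (\<integral>\<^sup>+t. covering_content {x. g x > ennreal (c * t)} * indicator {0<..} (c * t) \<partial>lborel)"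
    unfolding choquet_def using assms m by (subst nn_integral_real_affine[where c = c and t = 0]) auto
  also have "(\<integral>\<^sup>+t. covering_content {x. g x > ennreal (c * t)} * indicator {0<..} (c * t) \<partial>lborel)
      = (\<integral>\<^sup>+t\<in>{0<..}. covering_content {x. g x > ennreal (c * t)} \<partial>lborel)"
    using assms by (intro nn_integral_cong) (auto simp: indicator_def zero_less_mult_iff)
  finally show ?thesis
    using assms by (simp add: mult.assoc[symmetric] ennreal_mult[symmetric])
qed

lemma choquet_mono: "(\<And>x. f x \<le> g x) \<Longrightarrow> choquet covering_content f \<le> choquet covering_content g"
  unfolding choquet_def
  by (intro nn_integral_mono mult_right_mono covering_content_mono) (auto intro: order.strict_trans2)

text \<open>Continuity of the content along increasing unions is avoided by cutting the series into finite
  blocks. The blocks are chosen so long that the \<open>j\<close>-th block has cost at most \<open>B / 4 ^ j\<close>. If the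
  sum exceeds \<open>t\<close>, then some block \<open>j\<close> exceeds \<open>t / 2 ^ (j + 1)\<close>, which multiplies its Choquet
  integral by \<open>2 ^ (j + 1)\<close>; the resulting series has the sum \<open>4 * B\<close>.\<close>

lemma choquet_series_real:
  fixes l :: "nat \<Rightarrow> real"
  assumes Q: "\<And>i. Q i \<in> \<D>" and l: "\<And>i. 0 \<le> l i" and B: "(\<Sum>i. ennreal (l i) * w (Q i)) \<le> ennreal B" "0 < B"
  shows "choquet covering_content (\<lambda>x. \<Sum>i. ennreal (l i) * indicator (Q i) x) \<le> ennreal (4 * B)"
proof -
  define c where "c i = enn2real (ennreal (l i) * w (Q i))" for i
  have c: "ennreal (c i) = ennreal (l i) * w (Q i)" "0 \<le> c i" for i
    unfolding c_def using weight_fin[OF Q, of i] by (auto simp: ennreal_mult_less_top)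
  have sumc: "summable c" "suminf c \<le> B"
  proof -
    have le: "(\<Sum>i. ennreal (c i)) \<le> ennreal B" using B by (simp add: c)
    then show s: "summable c"
      by (intro summable_suminf_not_top) (auto simp: c top_unique)
    then show "suminf c \<le> B"
      using le B(2) c(2) by (subst (asm) suminf_ennreal2) (auto simp: ennreal_le_iff)
  qed
  have "\<exists>N. \<forall>n\<ge>N. (\<Sum>i. c (i + n)) < B / 4 ^ j" for j
    using suminf_exist_split[of "B / 4 ^ j" c] sumc(1) B(2) by (auto simp: abs_less_iff)
  then obtain N where N: "\<And>j n. n \<ge> N j \<Longrightarrow> (\<Sum>i. c (i + n)) < B / 4 ^ j" by metis
  \<comment> \<open>the end points of the blocks; the summand \<open>j\<close> makes them tend to infinity, and the value at \<open>0\<close> lets the first block start the series\<close>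
  define M where "M j = (if j = 0 then 0 else (\<Sum>k\<le>j. N k) + j)" for j
  have M_mono: "M j \<le> M (Suc j)" for j
    by (auto simp: M_def)
  have M_ge: "j \<le> M j" for j by (auto simp: M_def)
  define I where "I j = {M j..<M (Suc j)}" for j
  define g where "g j x = (\<Sum>i\<in>I j. l i * indicator (Q i) x)" for j x
  have g_nonneg: "0 \<le> g j x" for j x
    unfolding g_def by (intro sum_nonneg) (auto simp: l)
  have cost: "(\<Sum>i\<in>I j. c i) \<le> B / 4 ^ j" for j
  proof -
    have "(\<Sum>i\<in>I j. c i) = (\<Sum>i<M (Suc j) - M j. c (i + M j))"
      unfolding I_def using M_mono[of j]
      by (intro sum.reindex_bij_witness[of _ "\<lambda>i. i + M j" "\<lambda>i. i - M j"]) auto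
    also have "\<dots> \<le> (\<Sum>i. c (i + M j))"
      using sumc(1) c(2) by (intro sum_le_suminf) (auto intro: summable_ignore_initial_segment)
    also have "\<dots> \<le> B / 4 ^ j"
    proof (cases "j = 0")
      case False
      have "N j \<le> (\<Sum>k\<le>j. N k)" by (rule member_le_sum) auto
      then have "N j \<le> M j" using False by (auto simp: M_def)
      then show ?thesis using N by (auto intro: less_imp_le)
    qed (use sumc in \<open>auto simp: M_def\<close>)
    finally show ?thesis .
  qed
  have sub: "{x. (\<Sum>i. ennreal (l i) * indicator (Q i) x) > ennreal t} \<subseteq> (\<Union>j. {x. ennreal (g j x) > ennreal ((1/2)^Suc j * t)})"
    if t: "0 < t" for t
  proof (rule ccontr)
    assume "\<not> ?thesis"
    then obtain x where x': "x \<in> {x. (\<Sum>i. ennreal (l i) * indicator (Q i) x) > ennreal t}"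
      "x \<notin> (\<Union>j. {x. ennreal (g j x) > ennreal ((1/2)^Suc j * t)})" unfolding subset_iff by blast
    then have x: "ennreal t < (\<Sum>i. ennreal (l i) * indicator (Q i) x)" by simp
    have "\<not> ennreal (g j x) > ennreal ((1/2)^Suc j * t)" for j
      using x'(2) by blast
    then have x2: "ennreal (g j x) \<le> ennreal ((1/2)^Suc j * t)" for j by (simp only: not_less)
    have gle: "g j x \<le> (1/2)^Suc j * t" for j
      using x2[of j] t by (subst (asm) ennreal_le_iff) auto
    have part: "(\<Sum>i<M J. l i * indicator (Q i) x) = (\<Sum>j<J. g j x)" for J
    proof (induction J)
      case (Suc J)
      have "(\<Sum>i<M (Suc J). l i * indicator (Q i) x) = (\<Sum>i<M J. l i * indicator (Q i) x) + g J x"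
        unfolding g_def I_def lessThan_atLeast0 using M_mono[of J]
        by (subst sum.atLeastLessThan_concat) auto
      with Suc show ?case by simp
    qed (simp add: M_def)
    have "(\<Sum>i<J. ennreal (l i) * indicator (Q i) x) \<le> ennreal t" for J
    proof -
      have "(\<Sum>i<J. ennreal (l i) * indicator (Q i) x) = ennreal (\<Sum>i<J. l i * indicator (Q i) x)"
        using l by (subst sum_ennreal[symmetric]) (auto simp: indicator_def intro!: sum.cong)
      also have "(\<Sum>i<J. l i * indicator (Q i) x) \<le> (\<Sum>i<M J. l i * indicator (Q i) x)"
        using M_ge[of J] l by (intro sum_mono2) (auto simp: indicator_def)
      also have "\<dots> \<le> (\<Sum>j<J. (1/2)^Suc j * t)"
        unfolding part by (intro sum_mono gle)
      also have "\<dots> \<le> (\<Sum>j. (1/2)^Suc j * t)"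
        using t power_half_series by (intro sum_le_suminf summable_mult2) (auto simp: sums_iff)
      also have "\<dots> = t"
        using sums_unique[OF sums_mult2[OF power_half_series, of t]] by simp
      finally show ?thesis by (simp add: ennreal_leI)
    qed
    then have "(\<Sum>i. ennreal (l i) * indicator (Q i) x) \<le> ennreal t"
      by (intro suminf_le_const) auto
    with x show False by simp
  qed
  have m: "(\<lambda>t. covering_content {x. ennreal (g j x) > ennreal ((1/2)^Suc j * t)}) \<in> borel_measurable borel" for j
    by (intro measurable_antimono_ennreal antimonoI covering_content_mono)
       (auto intro: order.strict_trans1[OF ennreal_leI[OF mult_left_mono]] simp del: power_Suc)
  have "choquet covering_content (\<lambda>x. \<Sum>i. ennreal (l i) * indicator (Q i) x)
      \<le> (\<integral>\<^sup>+t. (\<Sum>j. covering_content {x. ennreal (g j x) > ennreal ((1/2)^Suc j * t)} * indicator {0<..} t) \<partial>lborel)"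
    unfolding choquet_def
  proof (intro nn_integral_mono)
    fix t :: real
    show "covering_content {x. (\<Sum>i. ennreal (l i) * indicator (Q i) x) > ennreal t} * indicator {0<..} t
      \<le> (\<Sum>j. covering_content {x. ennreal (g j x) > ennreal ((1/2)^Suc j * t)} * indicator {0<..} t)"
    proof (cases "0 < t")
      case True
      from order.trans[OF covering_content_mono[OF sub[OF True]] covering_content_countably_subadditive] True
      show ?thesis by simp
    qed auto
  qed
  also have "\<dots> = (\<Sum>j. \<integral>\<^sup>+t. covering_content {x. ennreal (g j x) > ennreal ((1/2)^Suc j * t)} * indicator {0<..} t \<partial>lborel)"
    using m by (subst nn_integral_suminf) auto
  also have "\<dots> = (\<Sum>j. ennreal (2 ^ Suc j) * choquet covering_content (\<lambda>x. ennreal (g j x)))"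
    by (subst choquet_scale) (auto simp: power_one_over)
  also have "\<dots> \<le> (\<Sum>j. ennreal (2 ^ Suc j) * ennreal (B / 4 ^ j))"
  proof (intro suminf_le mult_left_mono)
    fix j
    have "choquet covering_content (\<lambda>x. ennreal (g j x)) \<le> (\<Sum>i\<in>I j. ennreal (l i) * w (Q i))"
      unfolding g_def using l Q by (intro choquet_finite_sum) (auto simp: I_def)
    also have "\<dots> = ennreal (\<Sum>i\<in>I j. c i)"
      using c by (subst sum_ennreal[symmetric]) auto
    also have "\<dots> \<le> ennreal (B / 4 ^ j)" by (intro ennreal_leI cost)
    finally show "choquet covering_content (\<lambda>x. ennreal (g j x)) \<le> ennreal (B / 4 ^ j)" .
  qed auto
  also have "\<dots> = (\<Sum>j. ennreal (4 * B * (1/2) ^ Suc j))"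
  proof -
    have "2 ^ Suc j * (B / 4 ^ j) = 4 * B * (1/2) ^ Suc j" for j :: nat
    proof -
      have "(4::real) ^ j = 2 ^ j * 2 ^ j" by (simp flip: power_mult_distrib)
      then show ?thesis by (simp add: field_simps)
    qed
    then show ?thesis using B(2) by (subst ennreal_mult[symmetric]) auto
  qed
  also have "\<dots> = ennreal (4 * B)"
    using B(2) sums_mult[OF power_half_series, of "4 * B"] by (intro suminf_ennreal_eq) auto
  finally show ?thesis .
qed

lemma choquet_series:
  fixes l :: "'a set \<Rightarrow> ennreal"
  assumes B: "(\<integral>\<^sup>+Q. l Q * w Q \<partial>count_space \<D>) \<le> ennreal B" "0 < B"
  shows "choquet covering_content (\<lambda>x. \<integral>\<^sup>+Q. l Q * indicator Q x \<partial>count_space \<D>) \<le> ennreal (4 * B)"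
proof (cases "\<D> = {}")
  case True
  have "{x. 0 > ennreal t} = {}" for t :: real by auto
  then show ?thesis by (simp add: True choquet_def nn_integral_empty covering_content_empty[unfolded True])
next
  case False
  define q where "q n = from_nat_into \<D> n" for n
  define l' where "l' n = (if n \<in> to_nat_on \<D> ` \<D> then enn2real (l (q n)) else 0)" for n
  have fin: "l Q < \<infinity>" if Q: "Q \<in> \<D>" for Q
  proof -
    have "l Q * w Q \<le> (\<integral>\<^sup>+Q. l Q * w Q \<partial>count_space \<D>)"
      using Q by (rule nn_integral_ge_point)
    then have "l Q * w Q < \<infinity>" using B by (auto simp: order_le_less_trans)
    then show ?thesis using weight_pos[OF Q] by (auto simp: ennreal_mult_less_top)
  qed
  have sum: "(\<integral>\<^sup>+Q. l Q * f Q \<partial>count_space \<D>) = (\<Sum>n. ennreal (l' n) * f (q n))" for f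
  proof -
    have "(\<integral>\<^sup>+Q. l Q * f Q \<partial>count_space \<D>) = (\<integral>\<^sup>+n. l (q n) * f (q n) \<partial>count_space (to_nat_on \<D> ` \<D>))"
      unfolding q_def using countable_family
      by (subst nn_integral_bij_count_space[where g = "to_nat_on \<D>" and A = \<D>, symmetric])
         (auto intro!: nn_integral_cong inj_on_imp_bij_betw inj_on_to_nat_on)
    also have "\<dots> = (\<integral>\<^sup>+n. ennreal (l' n) * f (q n) \<partial>count_space UNIV)"
      using fin countable_family
      by (subst nn_integral_count_space_indicator)
         (auto simp: l'_def q_def indicator_def less_top intro!: nn_integral_cong)
    finally show ?thesis by (simp add: nn_integral_count_space_nat)
  qed
  show ?thesis
    unfolding sum
  proof (rule choquet_series_real)
    show "q n \<in> \<D>" for n unfolding q_def using False by (rule from_nat_into)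
    show "(\<Sum>i. ennreal (l' i) * w (q i)) \<le> ennreal B"
      using B(1) unfolding sum .
  qed (use B in \<open>auto simp: l'_def\<close>)
qed

end

section \<open>Dyadic cubes\<close>

definition dyadic_cube :: "int \<Rightarrow> ('n::finite \<Rightarrow> int) \<Rightarrow> (real ^ 'n) set" where
  "dyadic_cube k n = {x. \<forall>i. \<lfloor>x $ i / 2 powi k\<rfloor> = n i}"

definition dyadic_cubes :: "(real ^ 'n::finite) set set" where
  "dyadic_cubes = range (\<lambda>(k, n). dyadic_cube k n)"

definition cube_weight :: "real \<Rightarrow> (real ^ 'n::finite) set \<Rightarrow> ennreal" where
  "cube_weight \<beta> Q = ennreal (diameter Q powr \<beta>)"

lemma mem_dyadic_cube_self: "x \<in> dyadic_cube k (\<lambda>i. \<lfloor>x $ i / 2 powi k\<rfloor>)"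
  by (simp add: dyadic_cube_def)

lemma dyadic_cube_dist:
  fixes x y :: "real ^ 'n::finite"
  assumes "x \<in> dyadic_cube k n" "y \<in> dyadic_cube k n"
  shows "norm (x - y) \<le> real CARD('n) * 2 powi k"
proof -
  have "\<bar>(x - y) $ i\<bar> \<le> 2 powi k" for i
  proof -
    have "\<lfloor>x $ i / 2 powi k\<rfloor> = \<lfloor>y $ i / 2 powi k\<rfloor>" using assms by (simp add: dyadic_cube_def)
    then have "\<bar>x $ i / 2 powi k - y $ i / 2 powi k\<bar> \<le> 1" by linarith
    then show ?thesis by (simp add: diff_divide_distrib[symmetric] abs_divide)
  qed
  then have "(\<Sum>i\<in>UNIV. \<bar>(x - y) $ i\<bar>) \<le> (\<Sum>i\<in>(UNIV::'n set). 2 powi k)" by (intro sum_mono)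
  with norm_le_l1_cart[of "x - y"] show ?thesis by simp
qed

lemma dyadic_cube_bounded: "bounded (dyadic_cube k (n :: 'n::finite \<Rightarrow> int))"
proof -
  have "dyadic_cube k n \<subseteq> cball x (real CARD('n) * 2 powi k)" if "x \<in> dyadic_cube k n" for x
    using dyadic_cube_dist[OF that] by (auto simp: dist_norm)
  then show ?thesis
    by (metis bounded_cball bounded_empty bounded_subset equals0I)
qed

lemma diameter_dyadic_cube_le: "diameter (dyadic_cube k (n :: 'n::finite \<Rightarrow> int)) \<le> real CARD('n) * 2 powi k"
  by (rule diameter_le) (auto intro: dyadic_cube_dist)

lemma diameter_dyadic_cube_pos: "0 < diameter (dyadic_cube k (n :: 'n::finite \<Rightarrow> int))"
proof -
  define x :: "real ^ 'n" where "x = (\<chi> i. real_of_int (n i) * 2 powi k)"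
  define y :: "real ^ 'n" where "y = (\<chi> i. (real_of_int (n i) + 1/2) * 2 powi k)"
  have "x \<in> dyadic_cube k n" "y \<in> dyadic_cube k n"
    by (auto simp: x_def y_def dyadic_cube_def)
  then have "dist x y \<le> diameter (dyadic_cube k n)"
    by (intro diameter_bounded_bound dyadic_cube_bounded)
  moreover have "x \<noteq> y" by (auto simp: x_def y_def vec_eq_iff)
  ultimately show ?thesis using zero_less_dist_iff[of x y] by linarith
qed

lemma dyadic_cube_nested:
  assumes "k \<le> k'" "x \<in> dyadic_cube k n" "x \<in> dyadic_cube k' n'"
  shows "dyadic_cube k n \<subseteq> dyadic_cube k' n'"
proof -
  obtain m where m: "k' = k + int m" using assms(1) by (metis zle_iff_zadd)
  have *: "\<lfloor>t / 2 powi k'\<rfloor> = \<lfloor>t / 2 powi k\<rfloor> div 2 ^ m" for t :: real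
  proof -
    have "(2::real) powi k' = 2 powi k * 2 ^ m" by (simp add: m power_int_add)
    then have "t / 2 powi k' = (t / 2 powi k) / real_of_int (2 ^ m)" by simp
    then have "\<lfloor>t / 2 powi k'\<rfloor> = \<lfloor>(t / 2 powi k) / real_of_int (2 ^ m)\<rfloor>" by (rule arg_cong)
    also have "\<dots> = \<lfloor>t / 2 powi k\<rfloor> div 2 ^ m" by (rule floor_divide_real_eq_div) simp
    finally show ?thesis .
  qed
  show ?thesis using assms(2,3) by (auto simp: dyadic_cube_def *)
qed

lemma weighted_laminar_dyadic:
  assumes "0 \<le> \<beta>"
  shows "weighted_laminar (dyadic_cubes :: (real ^ 'n::finite) set set) (cube_weight \<beta>)"
proof
  show "countable (dyadic_cubes :: (real ^ 'n) set set)"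
    unfolding dyadic_cubes_def by (intro countable_image) auto
next
  fix A B :: "(real ^ 'n) set" assume "A \<in> dyadic_cubes" "B \<in> dyadic_cubes"
  then obtain k n k' n' where AB: "A = dyadic_cube k n" "B = dyadic_cube k' n'"
    by (auto simp: dyadic_cubes_def)
  show "A \<inter> B = {} \<or> A \<subseteq> B \<or> B \<subseteq> A"
    using dyadic_cube_nested[of k k' _ n n'] dyadic_cube_nested[of k' k _ n' n]
    unfolding AB by (metis disjoint_iff linear)
  assume "A \<subseteq> B"
  then show "cube_weight \<beta> A \<le> cube_weight \<beta> B"
    unfolding cube_weight_def AB using assms
    by (intro ennreal_leI powr_mono2 diameter_subset diameter_ge_0 dyadic_cube_bounded)
next
  fix A :: "(real ^ 'n) set" assume "A \<in> dyadic_cubes"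
  then obtain k n where "A = dyadic_cube k n" by (auto simp: dyadic_cubes_def)
  then show "0 < cube_weight \<beta> A" "cube_weight \<beta> A < \<infinity>"
    using diameter_dyadic_cube_pos[of k n] by (auto simp: cube_weight_def)
qed

abbreviation dyadic_content :: "real \<Rightarrow> (real ^ 'n::finite) set \<Rightarrow> ennreal" where
  "dyadic_content \<beta> \<equiv> weighted_laminar.covering_content dyadic_cubes (cube_weight \<beta>)"

text \<open>A cube lies in the open ball around any of its points whose radius is twice the diameter; this
  accounts for the factor.\<close>

lemma hausdorff_content_le_dyadic_content:
  fixes E :: "(real ^ 'n::finite) set"
  assumes \<beta>: "0 \<le> \<beta>"
  shows "hausdorff_content \<beta> E \<le> ennreal (2 powr \<beta>) * dyadic_content \<beta> E"
proof -
  interpret weighted_laminar "dyadic_cubes :: (real ^ 'n) set set" "cube_weight \<beta>"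
    by (rule weighted_laminar_dyadic[OF \<beta>])
  have *: "hausdorff_content \<beta> E \<le> ennreal (2 powr \<beta>) * weight_sum P" if P: "P \<subseteq> dyadic_cubes" "E \<subseteq> \<Union>P" for P
  proof -
    define I where "I = to_nat_on P ` P"
    define q where "q = from_nat_into P"
    have cP: "countable P" using P(1) countable_family by (rule countable_subset)
    have q: "q i \<in> P" if "i \<in> I" for i using that cP by (auto simp: I_def q_def)
    have inj: "inj_on q I" using cP by (auto simp: I_def q_def inj_on_def)
    have pos: "0 < diameter (q i)" if "i \<in> I" for i
    proof -
      from q[OF that] P(1) have "q i \<in> dyadic_cubes" by auto
      then show ?thesis using diameter_dyadic_cube_pos by (auto simp: dyadic_cubes_def)
    qed
    define c where "c i = (SOME x. x \<in> q i)" for i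
    have c: "q i \<subseteq> ball (c i) (2 * diameter (q i))" if i: "i \<in> I" for i
    proof
      fix y assume y: "y \<in> q i"
      then have "c i \<in> q i" unfolding c_def by (rule someI)
      moreover have "bounded (q i)"
      proof -
        from q[OF i] P(1) have "q i \<in> dyadic_cubes" by auto
        then show ?thesis using dyadic_cube_bounded by (auto simp: dyadic_cubes_def)
      qed
      ultimately have "dist (c i) y \<le> diameter (q i)" using y by (intro diameter_bounded_bound)
      then show "y \<in> ball (c i) (2 * diameter (q i))" using pos[OF i] by simp
    qed
    have "E \<subseteq> (\<Union>i\<in>I. ball (c i) (2 * diameter (q i)))"
    proof
      fix y assume "y \<in> E"
      then obtain Q where Q: "Q \<in> P" "y \<in> Q" using P(2) by auto
      then have "to_nat_on P Q \<in> I" "y \<in> q (to_nat_on P Q)" using cP by (auto simp: I_def q_def)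
      with c show "y \<in> (\<Union>i\<in>I. ball (c i) (2 * diameter (q i)))" by blast
    qed
    then have "hausdorff_content \<beta> E \<le> (\<Sum>\<^sub>\<infinity>i\<in>I. ennreal ((2 * diameter (q i)) powr \<beta>))"
      unfolding hausdorff_content_def using pos
      by (intro Inf_lower CollectI exI[of _ I] exI[of _ c] exI[of _ "\<lambda>i. 2 * diameter (q i)"]) auto
    also have "\<dots> \<le> ennreal (2 powr \<beta>) * weight_sum P"
    proof (subst nonneg_infsum_complete, simp, intro SUP_least, safe)
      fix S assume S: "finite S" "S \<subseteq> I"
      have "(\<Sum>i\<in>S. ennreal ((2 * diameter (q i)) powr \<beta>)) = (\<Sum>i\<in>S. ennreal (2 powr \<beta>) * cube_weight \<beta> (q i))"
        using pos S by (intro sum.cong refl) (auto simp: cube_weight_def powr_mult ennreal_mult less_imp_le subset_iff)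
      also have "\<dots> = ennreal (2 powr \<beta>) * (\<Sum>Q\<in>q ` S. cube_weight \<beta> Q)"
        using S inj by (subst sum.reindex) (auto simp: sum_distrib_left intro: inj_on_subset)
      also have "(\<Sum>Q\<in>q ` S. cube_weight \<beta> Q) = weight_sum (q ` S)"
        unfolding weight_sum_def using S q P
        by (subst nn_integral_count_space'[where A = "q ` S"]) (auto simp: indicator_def)
      also have "weight_sum (q ` S) \<le> weight_sum P"
        using S q by (intro weight_sum_mono) auto
      finally show "(\<Sum>i\<in>S. ennreal ((2 * diameter (q i)) powr \<beta>)) \<le> ennreal (2 powr \<beta>) * weight_sum P"
        by (simp add: mult_left_mono)
    qed
    finally show ?thesis .
  qed
  show ?thesis
  proof (cases "covering_content E = \<infinity>")
    case True
    then show ?thesis by (simp add: ennreal_mult_top)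
  next
    case False
    show ?thesis
    proof (rule ennreal_le_epsilon)
      fix e :: real assume e: "0 < e"
      obtain P where P: "P \<subseteq> dyadic_cubes" "E \<subseteq> \<Union>P" "weight_sum P < covering_content E + ennreal (e / 2 powr \<beta>)"
        using covering_content_approx[OF ennreal_add_less_self[of "covering_content E" "ennreal (e / 2 powr \<beta>)"]] False e
        by (auto simp: less_top)
      have "hausdorff_content \<beta> E \<le> ennreal (2 powr \<beta>) * (covering_content E + ennreal (e / 2 powr \<beta>))"
        using *[OF P(1,2)] P(3) by (meson less_imp_le mult_left_mono order.trans zero_le)
      also have "\<dots> = ennreal (2 powr \<beta>) * covering_content E + ennreal e"
        using e by (simp add: distrib_left ennreal_mult[symmetric])
      finally show "hausdorff_content \<beta> E \<le> ennreal (2 powr \<beta>) * covering_content E + ennreal e" .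
    qed
  qed
qed

text \<open>Domination by a superposition of cubes of total cost at most \<open>B\<close>. In contrast to a bound for
  the Choquet integral, this property passes to countable sums without loss (\<open>atomic_bound_suminf\<close>
  below), and only the final superposition has to be integrated.\<close>

definition atomic_bound :: "real \<Rightarrow> (real ^ 'n::finite \<Rightarrow> ennreal) \<Rightarrow> ennreal \<Rightarrow> bool" where
  "atomic_bound \<beta> f B \<longleftrightarrow> (\<exists>l.
     (\<forall>x. f x \<le> (\<integral>\<^sup>+Q. l Q * indicator Q x \<partial>count_space dyadic_cubes)) \<and>
     (\<integral>\<^sup>+Q. l Q * cube_weight \<beta> Q \<partial>count_space dyadic_cubes) \<le> B)"

lemma atomic_bound_choquet:
  fixes f :: "real ^ 'n::finite \<Rightarrow> ennreal"
  assumes \<beta>: "0 \<le> \<beta>" and f: "atomic_bound \<beta> f (ennreal B)" and B: "0 \<le> B"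
  shows "choquet (hausdorff_content \<beta>) f \<le> ennreal (4 * 2 powr \<beta> * B)"
proof -
  interpret weighted_laminar "dyadic_cubes :: (real ^ 'n) set set" "cube_weight \<beta>"
    by (rule weighted_laminar_dyadic[OF \<beta>])
  obtain l where l: "\<And>x. f x \<le> (\<integral>\<^sup>+Q. l Q * indicator Q x \<partial>count_space dyadic_cubes)"
    "(\<integral>\<^sup>+Q. l Q * cube_weight \<beta> Q \<partial>count_space dyadic_cubes) \<le> ennreal B"
    using f unfolding atomic_bound_def by auto
  \<comment> \<open>a margin \<open>e\<close> is added because \<open>choquet_series\<close> asks for a strictly positive bound\<close>
  have "choquet covering_content f \<le> ennreal (4 * B)"
  proof (rule ennreal_le_epsilon)
    fix e :: real assume e: "0 < e"
    have "choquet covering_content f \<le> choquet covering_content (\<lambda>x. \<integral>\<^sup>+Q. l Q * indicator Q x \<partial>count_space dyadic_cubes)"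
      by (intro choquet_mono l)
    also have "\<dots> \<le> ennreal (4 * (B + e / 4))"
      using e B l(2) by (intro choquet_series) (auto intro: order.trans ennreal_leI)
    also have "\<dots> = ennreal (4 * B) + ennreal e"
      using e B by (simp flip: ennreal_plus)
    finally show "choquet covering_content f \<le> ennreal (4 * B) + ennreal e" .
  qed
  moreover have "choquet (hausdorff_content \<beta>) f \<le> ennreal (2 powr \<beta>) * choquet covering_content f"
  proof -
    have m: "(\<lambda>t. covering_content {x. f x > ennreal t}) \<in> borel_measurable borel"
      by (intro measurable_antimono_ennreal antimonoI covering_content_mono)
         (auto intro: order.strict_trans1 ennreal_leI)
    show ?thesis
      unfolding choquet_def using m
      by (subst nn_integral_cmult[symmetric])
         (auto intro!: nn_integral_mono hausdorff_content_le_dyadic_content \<beta> simp: indicator_def)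
  qed
  ultimately have "choquet (hausdorff_content \<beta>) f \<le> ennreal (2 powr \<beta>) * ennreal (4 * B)"
    by (meson mult_left_mono order.trans zero_le)
  then show ?thesis using B by (simp add: ennreal_mult[symmetric] ac_simps)
qed

lemma atomic_bound_mono:
  "atomic_bound \<beta> f B \<Longrightarrow> (\<And>x. g x \<le> f x) \<Longrightarrow> B \<le> B' \<Longrightarrow> atomic_bound \<beta> g B'"
  unfolding atomic_bound_def by (meson order.trans)

lemma atomic_bound_cmult:
  assumes "atomic_bound \<beta> f B" shows "atomic_bound \<beta> (\<lambda>x. c * f x) (c * B)"
proof -
  obtain l where l: "\<And>x. f x \<le> (\<integral>\<^sup>+Q. l Q * indicator Q x \<partial>count_space dyadic_cubes)"
    "(\<integral>\<^sup>+Q. l Q * cube_weight \<beta> Q \<partial>count_space dyadic_cubes) \<le> B"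
    using assms unfolding atomic_bound_def by auto
  show ?thesis
    unfolding atomic_bound_def
    by (rule exI[of _ "\<lambda>Q. c * l Q"])
       (auto simp: mult.assoc nn_integral_cmult intro!: mult_left_mono l)
qed

lemma atomic_bound_suminf:
  assumes "\<And>n. atomic_bound \<beta> (f n) (B n)"
  shows "atomic_bound \<beta> (\<lambda>x. \<Sum>n. f n x) (\<Sum>n. B n)"
proof -
  from choice[OF allI[OF assms[unfolded atomic_bound_def]]]
  obtain l where "\<forall>n. (\<forall>x. f n x \<le> (\<integral>\<^sup>+Q. l n Q * indicator Q x \<partial>count_space dyadic_cubes)) \<and>
    (\<integral>\<^sup>+Q. l n Q * cube_weight \<beta> Q \<partial>count_space dyadic_cubes) \<le> B n" ..
  then have l: "\<And>n x. f n x \<le> (\<integral>\<^sup>+Q. l n Q * indicator Q x \<partial>count_space dyadic_cubes)"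
    "\<And>n. (\<integral>\<^sup>+Q. l n Q * cube_weight \<beta> Q \<partial>count_space dyadic_cubes) \<le> B n" by auto
  have *: "(\<integral>\<^sup>+Q. (\<Sum>n. l n Q) * h Q \<partial>count_space dyadic_cubes) = (\<Sum>n. \<integral>\<^sup>+Q. l n Q * h Q \<partial>count_space dyadic_cubes)" for h
    by (subst nn_integral_suminf[symmetric]) auto
  show ?thesis
    unfolding atomic_bound_def
    by (rule exI[of _ "\<lambda>Q. \<Sum>n. l n Q"]) (auto simp: * intro!: suminf_le l)
qed

section \<open>Box masses and their averages\<close>

definition sup_box :: "real ^ 'n::finite \<Rightarrow> real \<Rightarrow> (real ^ 'n) set" where
  "sup_box x R = {y. \<forall>i. \<bar>y $ i - x $ i\<bar> \<le> R}"

definition box_mass :: "real \<Rightarrow> (real ^ 'n::finite \<Rightarrow> ennreal) \<Rightarrow> real ^ 'n \<Rightarrow> ennreal" where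
  "box_mass R D x = (\<integral>\<^sup>+y\<in>sup_box x R. D y \<partial>lborel)"

lemma sup_box_cbox: "sup_box x R = cbox (x - (\<chi> i. R)) (x + (\<chi> i. R))"
  by (auto simp: sup_box_def mem_box_cart abs_le_iff algebra_simps)

lemma sup_box_sym: "y \<in> sup_box x R \<longleftrightarrow> x \<in> sup_box y R"
  by (auto simp: sup_box_def abs_minus_commute)

lemma sup_box_trans:
  assumes "z \<in> sup_box y S" "y \<in> sup_box x R" shows "z \<in> sup_box x (R + S)"
  unfolding sup_box_def
proof (safe)
  fix i
  have "\<bar>z $ i - y $ i\<bar> \<le> S" "\<bar>y $ i - x $ i\<bar> \<le> R" using assms by (auto simp: sup_box_def)
  then show "\<bar>z $ i - x $ i\<bar> \<le> R + S" by linarith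
qed

lemma sup_box_mono: "R \<le> S \<Longrightarrow> sup_box x R \<subseteq> sup_box x S"
  by (auto simp: sup_box_def intro: order.trans)

lemma sets_sup_box [measurable]: "sup_box x R \<in> sets borel"
  by (simp add: sup_box_cbox)

lemma borel_measurable_nth_vec: "(\<lambda>x::real ^ 'n::finite. x $ i) \<in> borel_measurable borel"
  by (intro borel_measurable_continuous_onI continuous_intros)

lemma measurable_pred_sup_box [measurable]:
  assumes [measurable]: "f \<in> borel_measurable M" "g \<in> borel_measurable M"
  shows "Measurable.pred M (\<lambda>p. g p \<in> sup_box (f p :: real ^ 'n::finite) R)"
proof -
  note [measurable] = measurable_compose[OF assms(1) borel_measurable_nth_vec]
    measurable_compose[OF assms(2) borel_measurable_nth_vec]
  show ?thesis unfolding sup_box_def mem_Collect_eq by measurable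
qed

lemma emeasure_sup_box:
  assumes "0 \<le> R"
  shows "emeasure lborel (sup_box (x :: real ^ 'n::finite) R) = ennreal ((2 * R) ^ CARD('n))"
proof -
  have ne: "cbox (x - (\<chi> i. R)) (x + (\<chi> i. R)) \<noteq> {}"
    using assms by (auto simp: interval_ne_empty_cart)
  have "emeasure lborel (sup_box x R) = ennreal (measure lborel (cbox (x - (\<chi> i. R)) (x + (\<chi> i. R))))"
    unfolding sup_box_cbox by (intro emeasure_eq_ennreal_measure) (auto simp: emeasure_lborel_cbox_eq)
  also have "measure lborel (cbox (x - (\<chi> i. R)) (x + (\<chi> i. R))) = (2 * R) ^ CARD('n)"
    using content_cbox_cart[OF ne] by (simp add: algebra_simps)
  finally show ?thesis .
qed

lemma measurable_box_mass [measurable]: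
  fixes D :: "real ^ 'n::finite \<Rightarrow> ennreal"
  assumes [measurable]: "D \<in> borel_measurable borel"
  shows "box_mass R D \<in> borel_measurable borel"
  unfolding box_mass_def by measurable

lemma box_mass_mono: "sup_box x R \<subseteq> sup_box y S \<Longrightarrow> box_mass R D x \<le> box_mass S D y"
  unfolding box_mass_def by (intro nn_integral_mono mult_left_mono) (auto simp: indicator_def)

text \<open>Take cubes of side between \<open>R\<close> and \<open>2 * R\<close>, and give to each the mass of \<open>D\<close> in its threefold
  enlargement \<open>big n\<close>. A box around a point of the cube lies in the enlargement, which proves the
  domination; and every point lies in at most \<open>3 ^ d\<close> enlargements, which bounds the cost.\<close>

lemma atomic_bound_box_mass:
  fixes D :: "real ^ 'n::finite \<Rightarrow> ennreal"
  assumes D [measurable]: "D \<in> borel_measurable borel" and R: "0 < R" and \<beta>: "0 \<le> \<beta>"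
  shows "atomic_bound \<beta> (box_mass R D)
    (ennreal (3 ^ CARD('n) * (2 * real CARD('n)) powr \<beta> * R powr \<beta>) * (\<integral>\<^sup>+y. D y \<partial>lborel))"
proof -
  \<comment> \<open>the cubes have side \<open>2 powi k\<close>\<close>
  define k where "k = \<lceil>log 2 R\<rceil>"
  have k: "R \<le> 2 powi k" "2 powi k \<le> 2 * R"
  proof -
    have p: "2 powi k = 2 powr (real_of_int k)" by (simp add: powr_real_of_int')
    have "2 powr (log 2 R) \<le> 2 powr (real_of_int k)" unfolding k_def by (intro powr_mono) auto
    then show "R \<le> 2 powi k" using R unfolding p by simp
    have "2 powr (real_of_int k) \<le> 2 powr (log 2 R + 1)" unfolding k_def by (intro powr_mono) linarith+
    then show "2 powi k \<le> 2 * R" using R unfolding p by (simp add: powr_add)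
  qed
  define big :: "('n \<Rightarrow> int) \<Rightarrow> (real ^ 'n) set" where "big n = {y. \<forall>i. \<bar>\<lfloor>y $ i / 2 powi k\<rfloor> - n i\<bar> \<le> 1}" for n
  define h where "h n = (\<integral>\<^sup>+y. D y * indicator (big n) y \<partial>lborel)" for n
  define l where "l Q = (if Q \<in> range (dyadic_cube k) then h (the_inv (dyadic_cube k) Q) else 0)" for Q
  have inj: "inj (dyadic_cube k :: ('n \<Rightarrow> int) \<Rightarrow> _)"
  proof (rule injI)
    fix n n' :: "'n \<Rightarrow> int" assume eq: "dyadic_cube k n = dyadic_cube k n'"
    define x :: "real ^ 'n" where "x = (\<chi> i. real_of_int (n i) * 2 powi k)"
    have "x \<in> dyadic_cube k n" by (auto simp: x_def dyadic_cube_def)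
    with eq have "x \<in> dyadic_cube k n'" by simp
    then show "n = n'" by (auto simp: x_def dyadic_cube_def)
  qed
  have big_meas [measurable]: "big n \<in> sets borel" for n
  proof -
    note [measurable] = borel_measurable_nth_vec
    have "big n = {y \<in> space borel. \<forall>i. real_of_int (n i - 1) \<le> y $ i / 2 powi k \<and> y $ i / 2 powi k < real_of_int (n i + 2)}"
    proof -
      have "\<bar>\<lfloor>a\<rfloor> - m\<bar> \<le> 1 \<longleftrightarrow> real_of_int (m - 1) \<le> a \<and> a < real_of_int (m + 2)" for a :: real and m
        by linarith
      then show ?thesis by (simp add: big_def)
    qed
    also have "\<dots> \<in> sets borel" by measurable
    finally show ?thesis .
  qed
  have sum: "(\<integral>\<^sup>+Q. l Q * g Q \<partial>count_space dyadic_cubes) = (\<integral>\<^sup>+n. h n * g (dyadic_cube k n) \<partial>count_space UNIV)" for g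
  proof -
    have sub: "range (dyadic_cube k) \<subseteq> (dyadic_cubes :: (real ^ 'n) set set)"
      by (auto simp: dyadic_cubes_def)
    have "(\<integral>\<^sup>+Q. l Q * g Q \<partial>count_space dyadic_cubes) = (\<integral>\<^sup>+Q. l Q * g Q \<partial>count_space (range (dyadic_cube k)))"
      using sub by (subst (1 2) nn_integral_count_space_indicator)
        (auto simp: l_def indicator_def image_subset_iff intro!: nn_integral_cong)
    also have "\<dots> = (\<integral>\<^sup>+n. l (dyadic_cube k n) * g (dyadic_cube k n) \<partial>count_space UNIV)"
      by (subst nn_integral_bij_count_space[where g = "dyadic_cube k"]) (auto simp: inj_on_imp_bij_betw inj)
    finally show ?thesis by (simp add: l_def the_inv_f_f[OF inj])
  qed
  have dom: "box_mass R D x \<le> (\<integral>\<^sup>+Q. l Q * indicator Q x \<partial>count_space dyadic_cubes)" for x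
  proof -
    define n where "n = (\<lambda>i. \<lfloor>x $ i / 2 powi k\<rfloor>)"
    have sub: "sup_box x R \<subseteq> big n"
    proof
      fix y assume y: "y \<in> sup_box x R"
      have "\<bar>\<lfloor>y $ i / 2 powi k\<rfloor> - \<lfloor>x $ i / 2 powi k\<rfloor>\<bar> \<le> 1" for i
      proof -
        have "\<bar>y $ i - x $ i\<bar> \<le> 2 powi k" using y k(1) unfolding sup_box_def by (auto intro: order.trans)
        then have "\<bar>y $ i / 2 powi k - x $ i / 2 powi k\<bar> \<le> 1"
          by (simp add: diff_divide_distrib[symmetric] abs_divide)
        then show ?thesis by linarith
      qed
      then show "y \<in> big n" by (simp add: big_def n_def)
    qed
    have "box_mass R D x \<le> h n * indicator (dyadic_cube k n) x"
      unfolding box_mass_def h_def using sub mem_dyadic_cube_self[of x k]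
      by (auto simp: n_def[symmetric] indicator_def intro!: nn_integral_mono)
    also have "\<dots> \<le> (\<integral>\<^sup>+n. h n * indicator (dyadic_cube k n) x \<partial>count_space UNIV)"
      by (rule nn_integral_ge_point) auto
    finally show ?thesis unfolding sum .
  qed
  have count: "(\<integral>\<^sup>+n. indicator (big n) y \<partial>count_space UNIV) \<le> (3 ^ CARD('n) :: ennreal)" for y
  proof -
    define S where "S = Pi\<^sub>E (UNIV :: 'n set) (\<lambda>i. {\<lfloor>y $ i / 2 powi k\<rfloor> - 1 .. \<lfloor>y $ i / 2 powi k\<rfloor> + 1})"
    have "\<bar>a - m\<bar> \<le> 1 \<longleftrightarrow> m \<in> {a - 1 .. a + 1}" for a m :: int by auto
    then have "y \<in> big n \<longleftrightarrow> n \<in> S" for n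
      by (simp add: big_def S_def PiE_UNIV_domain Pi_iff)
    then have "indicator (big n) y = (indicator S n :: ennreal)" for n by (simp add: indicator_def)
    then have "(\<integral>\<^sup>+n. indicator (big n) y \<partial>count_space UNIV) = emeasure (count_space UNIV) S" by simp
    also have "\<dots> = of_nat (card S)"
      by (rule emeasure_count_space_finite) (auto simp: S_def intro!: finite_PiE)
    also have "card S = 3 ^ CARD('n)" by (simp add: S_def card_PiE)
    finally show ?thesis by simp
  qed
  have hsum: "(\<integral>\<^sup>+n. h n \<partial>count_space UNIV) \<le> 3 ^ CARD('n) * (\<integral>\<^sup>+y. D y \<partial>lborel)"
  proof -
    have "(\<integral>\<^sup>+n. h n \<partial>count_space UNIV) = (\<integral>\<^sup>+y. (\<integral>\<^sup>+n. D y * indicator (big n) y \<partial>count_space UNIV) \<partial>lborel)"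
      unfolding h_def by (subst nn_integral_count_space_nn_integral) auto
    also have "\<dots> = (\<integral>\<^sup>+y. D y * (\<integral>\<^sup>+n. indicator (big n) y \<partial>count_space UNIV) \<partial>lborel)"
      by (subst nn_integral_cmult) auto
    also have "\<dots> \<le> (\<integral>\<^sup>+y. 3 ^ CARD('n) * D y \<partial>lborel)"
      using count by (intro nn_integral_mono) (metis mult.commute mult_left_mono zero_le)
    finally show ?thesis by (simp add: nn_integral_cmult)
  qed
  have "(\<integral>\<^sup>+Q. l Q * cube_weight \<beta> Q \<partial>count_space dyadic_cubes)
      \<le> (\<integral>\<^sup>+n. h n * ennreal ((2 * real CARD('n)) powr \<beta> * R powr \<beta>) \<partial>count_space UNIV)"
    unfolding sum
  proof (intro nn_integral_mono mult_left_mono)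
    fix n :: "'n \<Rightarrow> int"
    have "diameter (dyadic_cube k n) \<le> real CARD('n) * (2 * R)"
      by (rule order.trans[OF diameter_dyadic_cube_le]) (intro mult_left_mono k, simp)
    also have "\<dots> = 2 * real CARD('n) * R" by simp
    finally have "diameter (dyadic_cube k n) \<le> 2 * real CARD('n) * R" .
    then have "diameter (dyadic_cube k n) powr \<beta> \<le> (2 * real CARD('n) * R) powr \<beta>"
      using diameter_dyadic_cube_pos[of k n] \<beta> by (intro powr_mono2) auto
    also have "\<dots> = (2 * real CARD('n)) powr \<beta> * R powr \<beta>" using R by (subst powr_mult) auto
    finally show "cube_weight \<beta> (dyadic_cube k n) \<le> ennreal ((2 * real CARD('n)) powr \<beta> * R powr \<beta>)"
      unfolding cube_weight_def by (rule ennreal_leI)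
  qed auto
  also have "\<dots> = ennreal ((2 * real CARD('n)) powr \<beta> * R powr \<beta>) * (\<integral>\<^sup>+n. h n \<partial>count_space UNIV)"
    by (subst nn_integral_multc) (auto simp: mult.commute)
  also have "\<dots> \<le> ennreal ((2 * real CARD('n)) powr \<beta> * R powr \<beta>) * (3 ^ CARD('n) * (\<integral>\<^sup>+y. D y \<partial>lborel))"
    by (intro mult_left_mono hsum) auto
  also have "\<dots> = ennreal (3 ^ CARD('n) * (2 * real CARD('n)) powr \<beta> * R powr \<beta>) * (\<integral>\<^sup>+y. D y \<partial>lborel)"
    by (simp add: ennreal_mult ac_simps ennreal_power[symmetric])
  finally show ?thesis
    unfolding atomic_bound_def using dom by blast
qed

definition averaging_const :: "'n::finite itself \<Rightarrow> real" where
  "averaging_const _ = 1 + 2 ^ CARD('n) / unit_ball_vol (real CARD('n))"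

lemma averaging_const_pos: "0 < averaging_const TYPE('n::finite)"
  unfolding averaging_const_def by (intro add_pos_nonneg divide_nonneg_nonneg) auto

text \<open>If \<open>r \<le> R\<close>, the boxes around points of the ball all lie in a box of comparable size and the
  term \<open>p = 0\<close> suffices. Otherwise choose \<open>p\<close> with \<open>2 ^ p\<close> comparable to \<open>r / R\<close>: each point of the
  box of radius \<open>2 ^ (p + 2) * R\<close> is counted by a volume of at most \<open>(2 * R) ^ d\<close>, a fraction of
  order \<open>(1/2) ^ (p * d)\<close> of the volume of the ball. The sum over all \<open>p\<close> makes the bound
  independent of \<open>r\<close>, as a bound for a maximal function must be.\<close>

lemma average_box_mass_le:
  fixes D :: "real ^ 'n::finite \<Rightarrow> ennreal" and R r :: real and x :: "real ^ 'n"
  assumes D [measurable]: "D \<in> borel_measurable borel" and R: "0 < R" and r: "0 < r"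
  shows "(\<integral>\<^sup>+y\<in>ball x r. box_mass R D y \<partial>lborel) / emeasure lborel (ball x r)
    \<le> (\<Sum>p. ennreal (averaging_const TYPE('n) * (1/2) ^ (p * CARD('n))) * box_mass (2 ^ (p + 2) * R) D x)"
proof -
  define d where "d = CARD('n)"
  define v where "v = unit_ball_vol (real d)"
  have v: "0 < v" by (simp add: v_def d_def)
  define C where "C = averaging_const TYPE('n)"
  have C_eq: "C = 1 + 2 ^ d / v" by (simp add: C_def averaging_const_def v_def d_def)
  have ball: "emeasure lborel (ball x r) = ennreal (v * r ^ d)" if "0 < r" for x :: "real ^ 'n" and r
    using that by (subst emeasure_ball) (auto simp: v_def d_def)
  have bm: "b \<in> sup_box x r" if "b \<in> ball x r" for x b :: "real ^ 'n" and r
    unfolding sup_box_def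
  proof safe
    fix i
    have "norm (b - x) < r" using that by (simp add: dist_norm norm_minus_commute)
    then show "\<bar>b $ i - x $ i\<bar> \<le> r" using component_le_norm_cart[of "b - x" i] by simp
  qed
  have [measurable]: "ball x r \<in> sets borel" by simp
  have vr: "0 < v * r ^ d" using v r by simp
  show ?thesis
  proof (cases "r \<le> R")
    case True
    have "(\<integral>\<^sup>+y\<in>ball x r. box_mass R D y \<partial>lborel) \<le> (\<integral>\<^sup>+y. box_mass (2 ^ 2 * R) D x * indicator (ball x r) y \<partial>lborel)"
    proof (intro nn_integral_mono)
      fix y
      have "box_mass R D y \<le> box_mass (2 ^ 2 * R) D x" if "y \<in> ball x r"
      proof (rule box_mass_mono, rule subsetI)
        fix z assume "z \<in> sup_box y R"
        from sup_box_trans[OF this bm[OF that]] show "z \<in> sup_box x (2 ^ 2 * R)"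
          using sup_box_mono[of "r + R" "2 ^ 2 * R" x] True R by auto
      qed
      then show "box_mass R D y * indicator (ball x r) y \<le> box_mass (2 ^ 2 * R) D x * indicator (ball x r) y"
        by (auto simp: indicator_def)
    qed
    also have "\<dots> = box_mass (2 ^ 2 * R) D x * ennreal (v * r ^ d)"
      by (subst nn_integral_cmult_indicator) (auto simp: ball r)
    finally have "(\<integral>\<^sup>+y\<in>ball x r. box_mass R D y \<partial>lborel) / ennreal (v * r ^ d)
        \<le> box_mass (2 ^ 2 * R) D x * ennreal (v * r ^ d) / ennreal (v * r ^ d)"
      by (rule divide_right_mono_ennreal)
    also have "\<dots> = 1 * box_mass (2 ^ 2 * R) D x"
      using vr by (subst mult_divide_eq_ennreal) (auto simp: ennreal_eq_0_iff)
    also have "\<dots> \<le> ennreal (C * (1/2) ^ (0 * CARD('n))) * box_mass (2 ^ (0 + 2) * R) D x"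
      using v by (intro mult_mono) (auto simp: C_eq)
    also have "\<dots> \<le> (\<Sum>p. ennreal (C * (1/2) ^ (p * CARD('n))) * box_mass (2 ^ (p + 2) * R) D x)"
      by (rule term_le_suminf)
    finally show ?thesis using r by (simp add: ball C_def[symmetric])
  next
    case False
    define p where "p = nat \<lfloor>log 2 (r / R)\<rfloor>"
    have p: "2 ^ p * R \<le> r" "r \<le> 2 ^ (p + 1) * R"
    proof -
      have lg: "0 \<le> log 2 (r / R)" using False R by (simp add: zero_le_log_cancel_iff)
      have "2 powr (real p) \<le> 2 powr (log 2 (r / R))" using lg unfolding p_def by (intro powr_mono) auto
      then show "2 ^ p * R \<le> r" using r R by (simp add: powr_realpow field_simps)
      have "2 powr (log 2 (r / R)) \<le> 2 powr (real (p + 1))"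
        using lg unfolding p_def by (intro powr_mono) (auto, linarith)
      then show "r \<le> 2 ^ (p + 1) * R" using r R by (simp only: powr_realpow) (simp add: field_simps)
    qed
    define S where "S = 2 ^ (p + 2) * R"
    have "(\<integral>\<^sup>+y\<in>ball x r. box_mass R D y \<partial>lborel)
        = (\<integral>\<^sup>+y. (\<integral>\<^sup>+z. D z * indicator (sup_box y R) z * indicator (ball x r) y \<partial>lborel) \<partial>lborel)"
      unfolding box_mass_def by (intro nn_integral_cong nn_integral_multc[symmetric]) auto
    also have "\<dots> = (\<integral>\<^sup>+z. (\<integral>\<^sup>+y. D z * indicator (sup_box y R) z * indicator (ball x r) y \<partial>lborel) \<partial>lborel)"
      by (rule lborel_pair.Fubini') measurable
    also have "\<dots> \<le> (\<integral>\<^sup>+z. (\<integral>\<^sup>+y. D z * indicator (sup_box x S) z * indicator (sup_box z R) y \<partial>lborel) \<partial>lborel)"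
    proof (intro nn_integral_mono)
      fix y z
      have "z \<in> sup_box x S" "y \<in> sup_box z R" if "z \<in> sup_box y R" "y \<in> ball x r"
      proof -
        have "R \<le> 2 ^ (p + 1) * R" using R one_le_power[of "2::real" "p + 1"] by simp
        then have "r + R \<le> S" using p(2) unfolding S_def by simp
        then show "z \<in> sup_box x S"
          using sup_box_trans[OF that(1) bm[OF that(2)]] sup_box_mono[of "r + R" S x] by auto
      qed (use that sup_box_sym in blast)
      then show "D z * indicator (sup_box y R) z * indicator (ball x r) y
          \<le> D z * indicator (sup_box x S) z * indicator (sup_box z R) y"
        by (auto simp: indicator_def)
    qed
    also have "\<dots> = (\<integral>\<^sup>+z. D z * indicator (sup_box x S) z * ennreal ((2 * R) ^ d) \<partial>lborel)"
      using R by (subst nn_integral_cmult_indicator) (auto simp: emeasure_sup_box d_def)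
    also have "\<dots> = box_mass S D x * ennreal ((2 * R) ^ d)"
      unfolding box_mass_def by (rule nn_integral_multc) auto
    finally have "(\<integral>\<^sup>+y\<in>ball x r. box_mass R D y \<partial>lborel) / ennreal (v * r ^ d)
        \<le> box_mass S D x * ennreal ((2 * R) ^ d) / ennreal (v * r ^ d)"
      by (rule divide_right_mono_ennreal)
    also have "\<dots> = ennreal ((2 * R) ^ d / (v * r ^ d)) * box_mass S D x"
      using vr R by (subst divide_ennreal[symmetric]) (auto simp: ennreal_times_divide mult.commute)
    also have "\<dots> \<le> ennreal (C * (1/2) ^ (p * CARD('n))) * box_mass (2 ^ (p + 2) * R) D x"
      unfolding S_def
    proof (intro mult_right_mono ennreal_leI)
      have "(2 ^ p * R) ^ d \<le> r ^ d" using p(1) R by (intro power_mono) auto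
      then have "(2 * R) ^ d / (v * r ^ d) \<le> (2 * R) ^ d / (v * (2 ^ p * R) ^ d)"
        using v R r by (intro divide_left_mono mult_left_mono mult_pos_pos) auto
      also have "\<dots> = 2 ^ d / v * (1/2) ^ (p * d)"
        using R v by (simp add: power_mult_distrib power_mult[symmetric] power_one_over field_simps)
      also have "\<dots> \<le> C * (1/2) ^ (p * d)" unfolding C_eq by (intro mult_right_mono) auto
      finally show "(2 * R) ^ d / (v * r ^ d) \<le> C * (1/2) ^ (p * CARD('n))" by (simp add: d_def)
    qed auto
    also have "\<dots> \<le> (\<Sum>p. ennreal (C * (1/2) ^ (p * CARD('n))) * box_mass (2 ^ (p + 2) * R) D x)"
      by (rule term_le_suminf)
    finally show ?thesis using r by (simp add: ball C_def[symmetric])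
  qed
qed

section \<open>Smoothed divergence-free fields in a box\<close>

lemma smooth_compact_bounds:
  assumes h: "smooth h" and supp: "\<And>t. R < \<bar>t\<bar> \<Longrightarrow> h t = 0" and h': "\<And>t. (h has_real_derivative h' t) (at t)"
  obtains B where "\<And>t. \<bar>h t\<bar> \<le> B" "\<And>t. \<bar>h' t\<bar> \<le> B" "continuous_on UNIV h" "continuous_on UNIV h'"
proof -
  obtain D where D: "D 0 = h" "\<And>k x. (D k has_real_derivative D (Suc k) x) (at x)"
    using h by (auto simp: smooth_def)
  have D1: "D 1 = h'" using D(2)[of 0] h' D(1) by (auto intro!: ext DERIV_unique)
  have cont: "continuous_on UNIV (D k)" for k
    using D(2) DERIV_isCont by (blast intro: continuous_at_imp_continuous_on)
  have ch: "continuous_on UNIV h" "continuous_on UNIV h'" using cont[of 0] cont[of 1] D(1) D1 by auto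
  have supp': "h' t = 0" if "R < \<bar>t\<bar>" for t
  proof -
    have "((\<lambda>_. 0) has_real_derivative h' t) (at t)"
    proof (rule has_field_derivative_transform_within_open[OF h', where S = "{t. R < \<bar>t\<bar>}"])
      show "open {t. R < \<bar>t\<bar>}" by (intro open_Collect_less continuous_intros)
    qed (use that supp in auto)
    then show ?thesis using DERIV_unique[OF _ DERIV_const] by blast
  qed
  have bd: "\<exists>B. \<forall>t. \<bar>g t\<bar> \<le> B" if g: "continuous_on UNIV g" "\<And>t. R < \<bar>t\<bar> \<Longrightarrow> g t = 0" for g :: "real \<Rightarrow> real"
  proof -
    have "bounded (g ` {-R..R})"
      by (intro compact_imp_bounded compact_continuous_image continuous_on_subset[OF g(1)]) auto
    then obtain B where "\<forall>x\<in>g ` {-R..R}. norm x \<le> B" by (auto simp: bounded_iff)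
    moreover have "t \<in> {-R..R}" if "\<not> R < \<bar>t\<bar>" for t using that by (auto simp: not_less abs_le_iff)
    ultimately have "\<bar>g t\<bar> \<le> max 0 B" for t
      using g(2)[of t] by (cases "R < \<bar>t\<bar>") (auto simp: le_max_iff_disj)
    then show ?thesis by auto
  qed
  obtain B1 B2 where "\<And>t. \<bar>h t\<bar> \<le> B1" "\<And>t. \<bar>h' t\<bar> \<le> B2"
    using bd[OF ch(1) supp] bd[OF ch(2) supp'] by auto
  then show thesis using ch by (intro that[of "max B1 B2"]) (auto simp: le_max_iff_disj)
qed

text \<open>A divergence-free field, given by decompositions \<open>P i - N i\<close> of its components into positive
  measures; the application is to Jordan decompositions.\<close>

locale solenoidal =
  fixes P N :: "'n::finite \<Rightarrow> (real ^ 'n) measure" and M :: real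
  assumes P: "\<And>i. finite_borel_measure (P i)" and N: "\<And>i. finite_borel_measure (N i)"
    and P_mass: "\<And>i. emeasure (P i) UNIV \<le> ennreal M" and N_mass: "\<And>i. emeasure (N i) UNIV \<le> ennreal M"
    and M_nonneg: "0 \<le> M"
    and div: "\<And>\<phi>. \<phi> \<in> test_functions \<Longrightarrow>
      (\<Sum>i\<in>UNIV. (\<integral>y. partial_deriv i \<phi> y \<partial>P i) - (\<integral>y. partial_deriv i \<phi> y \<partial>N i)) = 0"
begin

definition G :: "'n \<Rightarrow> real \<Rightarrow> real ^ 'n \<Rightarrow> real" where
  "G i r x = heat (P i) r x - heat (N i) r x"

lemma measurable_G [measurable]: "G i r \<in> borel_measurable borel"
  using finite_borel_measure.measurable_heat[OF P, of i r] finite_borel_measure.measurable_heat[OF N, of i r]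
  unfolding G_def[abs_def] by measurable

lemma integrable_G: "0 < r \<Longrightarrow> integrable lborel (G i r)"
  unfolding G_def[abs_def]
  by (intro Bochner_Integration.integrable_diff finite_borel_measure.integrable_heat P N)

lemma G_L1:
  assumes r: "0 < r" shows "(\<integral>x. \<bar>G i r x\<bar> \<partial>lborel) \<le> 2 * M"
proof -
  have 1: "(\<integral>x. heat m r x \<partial>lborel) \<le> M" if "finite_borel_measure m" "emeasure m UNIV \<le> ennreal M" for m :: "(real ^ 'n) measure"
  proof -
    interpret m: finite_borel_measure m by fact
    have "ennreal (\<integral>x. heat m r x \<partial>lborel) = emeasure m UNIV"
      using m.nn_integral_heat[OF r] nn_integral_eq_integral[OF m.integrable_heat[OF r]] m.heat_nonneg[OF r] by simp
    then show ?thesis using that(2) M_nonneg by (metis ennreal_le_iff)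
  qed
  have "(\<integral>x. \<bar>G i r x\<bar> \<partial>lborel) \<le> (\<integral>x. heat (P i) r x + heat (N i) r x \<partial>lborel)"
    using r finite_borel_measure.heat_nonneg[OF P r, of i] finite_borel_measure.heat_nonneg[OF N r, of i]
    by (intro integral_mono integrable_abs integrable_G Bochner_Integration.integrable_add finite_borel_measure.integrable_heat P N)
       (auto simp: G_def abs_le_iff add_increasing2 add_increasing)
  also have "\<dots> = (\<integral>x. heat (P i) r x \<partial>lborel) + (\<integral>x. heat (N i) r x \<partial>lborel)"
    using r by (intro Bochner_Integration.integral_add finite_borel_measure.integrable_heat P N)
  also have "\<dots> \<le> 2 * M" using 1[OF P P_mass, of i] 1[OF N N_mass, of i] by simp
  finally show ?thesis .
qed

lemma G_convolution:
  assumes "0 < a" "0 < b"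
  shows "G i (sqrt (a\<^sup>2 + b\<^sup>2)) x = (\<integral>z. gauss a (x - z) * G i b z \<partial>lborel)"
    "integrable lborel (\<lambda>z. gauss a (x - z) * G i b z)"
  using finite_borel_measure.heat_convolution[OF P[of i] assms, of x]
    finite_borel_measure.heat_convolution[OF N[of i] assms, of x]
  by (simp_all add: G_def right_diff_distrib)

text \<open>The smoothed field is again divergence free: by \<open>heat_pairing\<close> its pairing with a gradient is
  an average of pairings of the field with translated gradients.\<close>

lemma product_test:
  fixes h h' :: "'n \<Rightarrow> real \<Rightarrow> real"
  assumes h: "\<And>j. smooth (h j)" and supp: "\<And>j t. R < \<bar>t\<bar> \<Longrightarrow> h j t = 0"
    and h': "\<And>j t. (h j has_real_derivative h' j t) (at t)" and r: "0 < r"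
  shows "(\<Sum>i\<in>UNIV. \<integral>x. h' i (x $ i) * (\<Prod>j\<in>UNIV - {i}. h j (x $ j)) * G i r x \<partial>lborel) = 0"
    "integrable lborel (\<lambda>x. h' i (x $ i) * (\<Prod>j\<in>UNIV - {i}. h j (x $ j)) * G i r x)"
proof -
  define W where "W i x = h' i (x $ i) * (\<Prod>j\<in>UNIV - {i}. h j (x $ j))" for i and x :: "real ^ 'n"
  have "\<exists>B. (\<forall>t. \<bar>h j t\<bar> \<le> B) \<and> (\<forall>t. \<bar>h' j t\<bar> \<le> B) \<and> continuous_on UNIV (h j) \<and> continuous_on UNIV (h' j)" for j
    using smooth_compact_bounds[OF h[of j] supp h'[of j]] by metis
  then obtain B where B: "\<And>j t. \<bar>h j t\<bar> \<le> B j" "\<And>j t. \<bar>h' j t\<bar> \<le> B j"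
    and c: "\<And>j. continuous_on UNIV (h j)" "\<And>j. continuous_on UNIV (h' j)" by metis
  have [measurable]: "h j \<in> borel_measurable borel" "h' j \<in> borel_measurable borel" for j
    using c[of j] by (auto intro: borel_measurable_continuous_onI)
  note [measurable] = borel_measurable_nth_vec
  have Wm [measurable]: "W i \<in> borel_measurable borel" for i
    unfolding W_def[abs_def] by measurable
  have Wb: "\<bar>W i x\<bar> \<le> B i * (\<Prod>j\<in>UNIV - {i}. B j)" for i x
  proof -
    have B0: "0 \<le> B j" for j using B(1)[of j 0] by linarith
    show ?thesis unfolding W_def abs_mult abs_prod
      by (intro mult_mono B prod_mono conjI abs_ge_zero prod_nonneg B0)
  qed
  note pairP = finite_borel_measure.heat_pairing[OF P r Wm Wb]
  note pairN = finite_borel_measure.heat_pairing[OF N r Wm Wb]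
  show "integrable lborel (\<lambda>x. h' i (x $ i) * (\<Prod>j\<in>UNIV - {i}. h j (x $ j)) * G i r x)"
    using pairP(3)[of i] pairN(3)[of i] unfolding W_def[symmetric] G_def right_diff_distrib by simp
  have eq: "(\<integral>x. W i x * G i r x \<partial>lborel) = (\<integral>z. gauss r z * ((\<integral>y. W i (y + z) \<partial>P i) - (\<integral>y. W i (y + z) \<partial>N i)) \<partial>lborel)" for i
    unfolding G_def right_diff_distrib using pairP[of i i] pairN[of i i] by simp
  have int: "integrable lborel (\<lambda>z. gauss r z * ((\<integral>y. W i (y + z) \<partial>P i) - (\<integral>y. W i (y + z) \<partial>N i)))" for i
    unfolding right_diff_distrib using pairP(2)[of i i] pairN(2)[of i i] by simp
  have z0: "(\<Sum>i\<in>UNIV. (\<integral>y. W i (y + z) \<partial>P i) - (\<integral>y. W i (y + z) \<partial>N i)) = 0" for z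
  proof -
    define \<phi> where "\<phi> = (\<lambda>y::real ^ 'n. \<Prod>j\<in>UNIV. h j (y $ j + z $ j))"
    have "\<phi> \<in> test_functions"
      unfolding \<phi>_def
    proof (rule product_test_function[where h = "\<lambda>j t. h j (t + z $ j)" and R = "R + norm z"])
      show "smooth (\<lambda>t. h j (t + z $ j))" for j
        using smooth_affine[OF h[of j], of 1 "z $ j"] by simp
      fix j t assume "R + norm z < \<bar>t\<bar>"
      then have "R < \<bar>t + z $ j\<bar>" using component_le_norm_cart[of z j] by linarith
      then show "h j (t + z $ j) = 0" by (rule supp)
    qed
    moreover have "partial_deriv i \<phi> y = W i (y + z)" for i y
    proof -
      have "((\<lambda>t. h j (t + z $ j)) has_real_derivative h' j (y $ j + z $ j)) (at (y $ j))" for j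
        using DERIV_shift[of "h j" _ "y $ j" "z $ j"] h' by blast
      from partial_deriv_prod_eq[where h = "\<lambda>j t. h j (t + z $ j)", OF this, of i] show ?thesis
        by (simp add: \<phi>_def W_def)
    qed
    ultimately show ?thesis using div[of \<phi>] by simp
  qed
  have "(\<Sum>i\<in>UNIV. \<integral>x. W i x * G i r x \<partial>lborel)
      = (\<integral>z. gauss r z * (\<Sum>i\<in>UNIV. (\<integral>y. W i (y + z) \<partial>P i) - (\<integral>y. W i (y + z) \<partial>N i)) \<partial>lborel)"
    unfolding eq sum_distrib_left using int by (intro Bochner_Integration.integral_sum[symmetric]) auto
  also have "\<dots> = 0" by (simp add: z0)
  finally show "(\<Sum>i\<in>UNIV. \<integral>x. h' i (x $ i) * (\<Prod>j\<in>UNIV - {i}. h j (x $ j)) * G i r x \<partial>lborel) = 0"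
    by (simp add: W_def)
qed

end

text \<open>Supported in \<open>[0, 1]\<close>. It rises near \<open>0\<close> with a slope of order \<open>K\<close> and descends with a slope
  bounded independently of \<open>K\<close>.\<close>

definition ramp :: "real \<Rightarrow> real \<Rightarrow> real" where
  "ramp K t = flat_exp (K * t) * flat_exp (1 - t)"

definition flat_exp' :: "real \<Rightarrow> real" where
  "flat_exp' x = (if x \<le> 0 then 0 else exp (- 1 / x) / x\<^sup>2)"

definition ramp' :: "real \<Rightarrow> real \<Rightarrow> real" where
  "ramp' K t = K * flat_exp' (K * t) * flat_exp (1 - t) - flat_exp (K * t) * flat_exp' (1 - t)"

lemma flat_exp_bounds: "0 \<le> flat_exp x" "flat_exp x \<le> 1"
  by (auto simp: flat_exp_def)

lemma flat_exp'_bounds: "0 \<le> flat_exp' x" "flat_exp' x \<le> 2"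
proof -
  show "0 \<le> flat_exp' x" by (simp add: flat_exp'_def)
  show "flat_exp' x \<le> 2"
  proof (cases "x \<le> 0")
    case False
    then have u: "0 < 1 / x" by simp
    have "u\<^sup>2 \<le> 2 * exp u" if "0 < u" for u :: real
      using exp_lower_Taylor_quadratic[of u] that by simp
    from this[OF u] have "(1 / x)\<^sup>2 \<le> 2 * exp (1 / x)" .
    then have "(1 / x)\<^sup>2 * exp (- (1 / x)) \<le> 2 * exp (1 / x) * exp (- (1 / x))"
      by (intro mult_right_mono) auto
    also have "\<dots> = 2" by (simp add: exp_minus)
    finally show ?thesis using False by (simp add: flat_exp'_def power_one_over field_simps)
  qed (simp add: flat_exp'_def)
qed

lemma ramp_deriv: "(ramp K has_real_derivative ramp' K t) (at t)"
proof -
  have f: "(flat_exp has_real_derivative flat_exp' x) (at x)" for x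
    using flat_exp_deriv by (simp add: flat_exp'_def)
  show ?thesis
    unfolding ramp_def[abs_def] ramp'_def
    by (rule derivative_eq_intros DERIV_chain2[OF f] refl | simp add: algebra_simps)+
qed

lemma smooth_ramp: "smooth (ramp K)"
  unfolding ramp_def[abs_def]
  using smooth_mult[OF smooth_affine[OF smooth_flat_exp, of K 0] smooth_affine[OF smooth_flat_exp, of "-1" 1]] by simp

lemma ramp_bounds: "0 \<le> ramp K t" "ramp K t \<le> 1"
  using flat_exp_bounds[of "K * t"] flat_exp_bounds[of "1 - t"] by (auto simp: ramp_def mult_le_one)

lemma ramp'_bounds:
  assumes "1 \<le> K" shows "- 2 \<le> ramp' K t" "ramp' K t \<le> 2 * K"
proof -
  have 1: "0 \<le> K * flat_exp' (K * t) * flat_exp (1 - t)" "K * flat_exp' (K * t) * flat_exp (1 - t) \<le> K * 2 * 1"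
    by (intro mult_mono mult_nonneg_nonneg mult_left_mono flat_exp_bounds flat_exp'_bounds;
        use assms in simp)+
  have 2: "0 \<le> flat_exp (K * t) * flat_exp' (1 - t)" "flat_exp (K * t) * flat_exp' (1 - t) \<le> 1 * 2"
    by (intro mult_mono mult_nonneg_nonneg flat_exp_bounds flat_exp'_bounds; simp)+
  show "- 2 \<le> ramp' K t" "ramp' K t \<le> 2 * K" using 1 2 unfolding ramp'_def by linarith+
qed

lemma ramp_outside: "t \<le> 0 \<or> 1 \<le> t \<Longrightarrow> 0 \<le> K \<Longrightarrow> ramp K t = 0" "t \<le> 0 \<or> 1 \<le> t \<Longrightarrow> 0 \<le> K \<Longrightarrow> ramp' K t = 0"
  by (auto simp: ramp_def ramp'_def flat_exp_def flat_exp'_def mult_le_0_iff)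

text \<open>On \<open>[1 / K, 2 / K]\<close> the rising factor and its derivative are at least \<open>exp (- 1)\<close> and
  \<open>exp (- 1) / 4\<close>, and the other factor is at least \<open>exp (- 2)\<close>. The lower bound for \<open>K\<close> allows the
  contribution of the descending factor, at most \<open>2\<close>, to be absorbed.\<close>

lemma ramp_rise:
  assumes K: "16 * exp 3 \<le> K" and t: "1 / K \<le> t" "t \<le> 2 / K"
  shows "exp (- 3) \<le> ramp K t" "K * exp (- 3) / 8 \<le> ramp' K t"
proof -
  have "1 \<le> exp (3::real)" by simp
  then have K4: "4 \<le> K" using K by linarith
  define s where "s = K * t"
  have s: "1 \<le> s" "s \<le> 2" using t K4 by (auto simp: s_def field_simps)
  have "2 / K \<le> 1 / 2" using K4 by (simp add: field_simps)
  then have t2: "1 / 2 \<le> 1 - t" using t by linarith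
  have a: "exp (- 1) \<le> flat_exp s" using s by (simp add: flat_exp_def field_simps)
  have b: "exp (- 2) \<le> flat_exp (1 - t)" using t2 by (simp add: flat_exp_def field_simps)
  have c: "exp (- 1) / 4 \<le> flat_exp' s"
  proof -
    have "s\<^sup>2 \<le> 2\<^sup>2" using s by (intro power_mono) auto
    then have "exp (- 1) / 4 \<le> exp (- 1 / s) / s\<^sup>2" using s by (intro frac_le) (auto simp: field_simps)
    then show ?thesis using s by (simp add: flat_exp'_def)
  qed
  have e3: "exp (- 3) = exp (- 1) * exp (- 2 :: real)" by (simp add: exp_add[symmetric])
  show "exp (- 3) \<le> ramp K t"
    unfolding ramp_def s_def[symmetric] e3 using a b by (intro mult_mono) (auto simp: flat_exp_bounds)
  have "K * (exp (- 1) / 4) * exp (- 2) \<le> K * flat_exp' s * flat_exp (1 - t)"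
    using b c K4 by (intro mult_mono) (auto simp: flat_exp_bounds flat_exp'_bounds)
  moreover have "flat_exp s * flat_exp' (1 - t) \<le> 1 * 2"
    by (intro mult_mono flat_exp_bounds flat_exp'_bounds) auto
  ultimately have "K * exp (- 3) / 4 - 2 \<le> ramp' K t"
    unfolding ramp'_def s_def[symmetric] e3 by simp
  moreover have "2 \<le> K * exp (- 3) / 8"
  proof -
    have "16 * exp 3 * exp (- 3) \<le> K * exp (- 3 :: real)" using K by (intro mult_right_mono) auto
    moreover have "exp 3 * exp (- 3 :: real) = 1" by (simp add: exp_minus)
    ultimately show ?thesis by (simp add: mult.assoc)
  qed
  ultimately show "K * exp (- 3) / 8 \<le> ramp' K t" by linarith
qed

definition box_int :: "real \<Rightarrow> (real ^ 'n::finite \<Rightarrow> real) \<Rightarrow> real ^ 'n \<Rightarrow> real" where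
  "box_int R g x = (\<integral>y. indicator (sup_box x R) y * g y \<partial>lborel)"

lemma integrable_box: "integrable lborel g \<Longrightarrow> integrable lborel (\<lambda>y. indicator (sup_box x R) y * g y :: real)"
  using integrable_mult_indicator[of "sup_box x R" lborel g] by simp

context solenoidal
begin

text \<open>Test the smoothed field with the product of the ramps \<open>h i\<close>, oriented by the signs \<open>s i\<close> and
  placed so that they rise on the inner box \<open>Q\<close>. The divergence becomes a sum of integrals of
  \<open>w i * u i\<close>, where \<open>u i = s i * G i r\<close>. The weight \<open>w i\<close> is of order \<open>K\<close> on \<open>Q\<close> and nowhere below
  \<open>- 2\<close>. As the sum vanishes, the positive mass of \<open>u i\<close> in \<open>Q\<close> times \<open>K\<close> is compensated by twice
  the mass in the large box, apart from points where \<open>u i\<close> is negative and \<open>w i\<close> may be as large as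
  \<open>2 * K\<close>. Division by \<open>K\<close> leaves a small multiple of the full mass and a bounded multiple of the
  mass of the wrong sign.\<close>

lemma local_estimate:
  assumes K: "16 * exp 3 \<le> K" and R: "0 < R" and r: "0 < r" and s: "\<And>i. s i = 1 \<or> s i = - 1"
  defines "C0 \<equiv> 8 * exp 3 ^ CARD('n)"
  shows "(\<Sum>i\<in>UNIV. box_int (R / (2 * K)) (\<lambda>y. \<bar>G i r y\<bar>) x) \<le>
    2 * C0 / K * (\<Sum>i\<in>UNIV. box_int R (\<lambda>y. \<bar>G i r y\<bar>) x)
    + (2 * C0 + 1) * (\<Sum>i\<in>UNIV. box_int R (\<lambda>y. max 0 (- s i * G i r y)) x)"
proof -
  have "1 \<le> exp (3::real)" by simp
  then have K16: "16 \<le> K" using K by linarith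
  have C0: "0 < C0" by (simp add: C0_def)
  define B where "B = sup_box x R"
  define Q where "Q = sup_box x (R / (2 * K))"
  \<comment> \<open>the shift puts the inner box into the interval \<open>[1 / K, 2 / K]\<close>, where the ramps rise\<close>
  define T where "T i y = s i * (y - x $ i) / R + 3 / (2 * K)" for i y
  define h where "h i y = ramp K (T i y)" for i y
  define h' where "h' i y = s i / R * ramp' K (T i y)" for i y
  define w where "w i y = ramp' K (T i (y $ i)) * (\<Prod>j\<in>UNIV - {i}. h j (y $ j))" for i and y :: "real ^ 'n"
  have QB: "Q \<subseteq> B" unfolding Q_def B_def using K16 R by (intro sup_box_mono) (simp add: field_simps)
  have T_aff: "T i = (\<lambda>y. s i / R * y + (3 / (2 * K) - s i * x $ i / R))" for i
    using R by (auto simp: T_def field_simps)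
  have T_out: "T i y \<le> 0 \<or> 1 \<le> T i y" if "R < \<bar>y - x $ i\<bar>" for i y
  proof -
    have "0 < 3 / (2 * K)" "3 / (2 * K) \<le> 1" using K16 by (auto simp: field_simps)
    moreover have "1 < s i * (y - x $ i) / R \<or> s i * (y - x $ i) / R < - 1"
      using that R s[of i] by (auto simp: field_simps abs_if split: if_splits)
    ultimately show ?thesis unfolding T_def by linarith
  qed
  have test: "(\<Sum>i\<in>UNIV. \<integral>y. h' i (y $ i) * (\<Prod>j\<in>UNIV - {i}. h j (y $ j)) * G i r y \<partial>lborel) = 0"
    "integrable lborel (\<lambda>y. h' i (y $ i) * (\<Prod>j\<in>UNIV - {i}. h j (y $ j)) * G i r y)" for i
  proof -
    have a: "smooth (h j)" for j
      unfolding h_def T_aff by (rule smooth_affine[OF smooth_ramp])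
    have b: "h j t = 0" if "R + norm x < \<bar>t\<bar>" for j t
    proof -
      have "R < \<bar>t - x $ j\<bar>" using that component_le_norm_cart[of x j] by linarith
      then show ?thesis unfolding h_def using T_out K16 by (intro ramp_outside) auto
    qed
    have c: "(h j has_real_derivative h' j t) (at t)" for j t
    proof -
      have "((\<lambda>y. ramp K (a * y + b)) has_real_derivative a * ramp' K (a * t + b)) (at t)" for a b
        by (subst mult.commute, rule DERIV_chain2[OF ramp_deriv]) (auto intro!: derivative_eq_intros)
      then show ?thesis unfolding h_def[abs_def] h'_def T_aff .
    qed
    show "(\<Sum>i\<in>UNIV. \<integral>y. h' i (y $ i) * (\<Prod>j\<in>UNIV - {i}. h j (y $ j)) * G i r y \<partial>lborel) = 0"
      by (rule product_test(1)[where h = h and h' = h', OF a b c r])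
    show "integrable lborel (\<lambda>y. h' i (y $ i) * (\<Prod>j\<in>UNIV - {i}. h j (y $ j)) * G i r y)"
      by (rule product_test(2)[where h = h and h' = h', OF a b c r])
  qed
  define u where "u i y = s i * G i r y" for i y
  have h'w: "h' i (y $ i) * (\<Prod>j\<in>UNIV - {i}. h j (y $ j)) * G i r y = 1 / R * (w i y * u i y)" for i y
    using R by (simp add: h'_def w_def u_def)
  have wint: "integrable lborel (\<lambda>y. w i y * u i y)" for i
    using integrable_mult_right[OF test(2)[of i, unfolded h'w], of R] R by simp
  have wsum: "(\<Sum>i\<in>UNIV. \<integral>y. w i y * u i y \<partial>lborel) = 0"
    using test(1) R unfolding h'w by (simp add: sum_divide_distrib[symmetric])
  have uint: "integrable lborel (u i)" for i
    unfolding u_def by (intro integrable_mult_right integrable_G r)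
  have hb: "0 \<le> h j t" "h j t \<le> 1" for j t unfolding h_def by (rule ramp_bounds)+
  have prod01: "0 \<le> (\<Prod>j\<in>S. h j (y $ j))" "(\<Prod>j\<in>S. h j (y $ j)) \<le> 1" for S and y :: "real ^ 'n"
    using hb by (auto intro!: prod_nonneg prod_le_1)
  have w_out: "w i y = 0" if y: "y \<notin> B" for i y
  proof -
    obtain j where "R < \<bar>y $ j - x $ j\<bar>" using y by (auto simp: B_def sup_box_def not_le)
    from T_out[OF this] have "h j (y $ j) = 0" "ramp' K (T j (y $ j)) = 0"
      using K16 by (auto simp: h_def intro!: ramp_outside)
    then show ?thesis unfolding w_def by (cases "i = j") (auto intro!: prod_zero)
  qed
  have w_low: "- 2 \<le> w i y" and w_up: "w i y \<le> 2 * K" for i y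
  proof -
    have "1 \<le> K" using K16 by simp
    note b = ramp'_bounds[OF this, of "T i (y $ i)"] and p = prod01[of y "UNIV - {i}"]
    have "ramp' K (T i (y $ i)) * (\<Prod>j\<in>UNIV - {i}. h j (y $ j)) \<ge> (- 2) * (\<Prod>j\<in>UNIV - {i}. h j (y $ j))"
      using b p by (intro mult_right_mono) auto
    then show "- 2 \<le> w i y" unfolding w_def using p by linarith
    have "w i y \<le> 2 * K * (\<Prod>j\<in>UNIV - {i}. h j (y $ j))"
      unfolding w_def using b p by (intro mult_right_mono) auto
    also have "\<dots> \<le> 2 * K * 1" using p K16 by (intro mult_left_mono) auto
    finally show "w i y \<le> 2 * K" by simp
  qed
  have w_Q: "K / C0 \<le> w i y" if "y \<in> Q" for i y
  proof -
    have T: "1 / K \<le> T j (y $ j)" "T j (y $ j) \<le> 2 / K" for j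
    proof -
      have "\<bar>y $ j - x $ j\<bar> \<le> R / (2 * K)" using that by (auto simp: Q_def sup_box_def)
      then have "\<bar>s j * (y $ j - x $ j)\<bar> \<le> R / (2 * K)" using s[of j] by auto
      then have "\<bar>s j * (y $ j - x $ j)\<bar> / R \<le> R / (2 * K) / R" using R by (intro divide_right_mono) auto
      then have "\<bar>s j * (y $ j - x $ j) / R\<bar> \<le> 1 / (2 * K)" using R by (simp add: abs_divide)
      moreover have "1 / K = 3 / (2 * K) - 1 / (2 * K)" "2 / K = 3 / (2 * K) + 1 / (2 * K)"
        using K16 by (auto simp: field_simps)
      ultimately show "1 / K \<le> T j (y $ j)" "T j (y $ j) \<le> 2 / K" unfolding T_def by linarith+
    qed
    have "K / C0 = (K * exp (- 3) / 8) * (\<Prod>j\<in>UNIV - {i}. exp (- 3))"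
    proof -
      have "exp (3::real) ^ CARD('n) = exp 3 * exp 3 ^ (CARD('n) - 1)"
        by (metis power_eq_if zero_less_card_finite less_numeral_extra(3))
      then show ?thesis by (simp add: C0_def exp_minus power_inverse field_simps card_Diff_singleton)
    qed
    also have "\<dots> \<le> w i y"
      unfolding w_def h_def using T K16
      by (intro mult_mono prod_mono ramp_rise[OF K] conjI prod_nonneg)
         (auto intro: order.trans[OF _ ramp_rise(2)[OF K T]])
    finally show ?thesis .
  qed
  \<comment> \<open>the lower bounds for \<open>w\<close> serve where \<open>u\<close> has the right sign, the upper bound where it has the wrong one\<close>
  have pt: "K / C0 * (indicator Q y * max 0 (u i y)) \<le> w i y * u i y + 2 * (indicator B y * \<bar>u i y\<bar>) + 2 * K * (indicator B y * max 0 (- u i y))" for i y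
  proof (cases "0 \<le> u i y")
    case True
    have *: "- 2 * u i y \<le> w i y * u i y" using w_low[of i y] True by (intro mult_right_mono) auto
    have **: "K / C0 * u i y \<le> w i y * u i y" if "y \<in> Q" using w_Q[OF that, of i] True by (intro mult_right_mono) auto
    show ?thesis
      using True QB w_out[of y i] * ** by (cases "y \<in> Q"; cases "y \<in> B") (auto simp: max_def)
  next
    case False
    have *: "2 * K * u i y \<le> w i y * u i y" using w_up[of i y] False by (intro mult_right_mono_neg) auto
    have e: "max 0 (u i y) = 0" "max 0 (- u i y) = - u i y" "\<bar>u i y\<bar> = - u i y" using False by auto
    show ?thesis
    proof (cases "y \<in> B")
      case True
      have "0 \<le> w i y * u i y + 2 * (- u i y) + 2 * K * (- u i y)"
        unfolding mult_minus_right using * False by linarith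
      then show ?thesis unfolding e using True by simp
    qed (use w_out[of y i] e in simp)
  qed
  note ints = integrable_box[OF integrable_abs[OF uint]] integrable_box[OF integrable_max[OF integrable_zero uint]]
    integrable_box[OF integrable_max[OF integrable_zero integrable_minus[OF uint]]]
  have int_pt: "K / C0 * box_int (R / (2 * K)) (\<lambda>y. max 0 (u i y)) x
      \<le> (\<integral>y. w i y * u i y \<partial>lborel) + 2 * box_int R (\<lambda>y. \<bar>u i y\<bar>) x + 2 * K * box_int R (\<lambda>y. max 0 (- u i y)) x" for i
  proof -
    have i1: "integrable lborel (\<lambda>y. 2 * (indicator B y * \<bar>u i y\<bar>))"
      and i2: "integrable lborel (\<lambda>y. 2 * K * (indicator B y * max 0 (- u i y)))"
      and i3: "integrable lborel (\<lambda>y. K / C0 * (indicator Q y * max 0 (u i y)))"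
      unfolding B_def Q_def by (intro integrable_mult_right ints)+
    note i12 = Bochner_Integration.integrable_add[OF Bochner_Integration.integrable_add[OF wint[of i] i1] i2]
    have "(\<integral>y. K / C0 * (indicator Q y * max 0 (u i y)) \<partial>lborel)
      \<le> (\<integral>y. w i y * u i y + 2 * (indicator B y * \<bar>u i y\<bar>) + 2 * K * (indicator B y * max 0 (- u i y)) \<partial>lborel)"
      by (intro integral_mono pt i12 i3)
    also have "\<dots> = (\<integral>y. w i y * u i y \<partial>lborel) + (\<integral>y. 2 * (indicator B y * \<bar>u i y\<bar>) \<partial>lborel)
        + (\<integral>y. 2 * K * (indicator B y * max 0 (- u i y)) \<partial>lborel)"
      by (simp only: Bochner_Integration.integral_add[OF Bochner_Integration.integrable_add[OF wint[of i] i1] i2]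
          Bochner_Integration.integral_add[OF wint[of i] i1])
    finally show ?thesis
      unfolding B_def Q_def box_int_def integral_mult_right_zero .
  qed
  have split: "box_int (R / (2 * K)) (\<lambda>y. \<bar>u i y\<bar>) x \<le> box_int (R / (2 * K)) (\<lambda>y. max 0 (u i y)) x + box_int R (\<lambda>y. max 0 (- u i y)) x" for i
  proof -
    have "box_int (R / (2 * K)) (\<lambda>y. \<bar>u i y\<bar>) x
        \<le> (\<integral>y. indicator (sup_box x (R / (2 * K))) y * max 0 (u i y) + indicator (sup_box x R) y * max 0 (- u i y) \<partial>lborel)"
      unfolding box_int_def using QB
      by (intro integral_mono ints Bochner_Integration.integrable_add)
         (auto simp: B_def Q_def indicator_def)
    also have "\<dots> = box_int (R / (2 * K)) (\<lambda>y. max 0 (u i y)) x + box_int R (\<lambda>y. max 0 (- u i y)) x"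
      unfolding box_int_def by (intro Bochner_Integration.integral_add ints)
    finally show ?thesis .
  qed
  have absu: "\<bar>u i y\<bar> = \<bar>G i r y\<bar>" for i y using s[of i] by (auto simp: u_def)
  have negu: "- u i y = - s i * G i r y" for i y by (simp add: u_def)
  define X where "X = (\<Sum>i\<in>UNIV. box_int (R / (2 * K)) (\<lambda>y. max 0 (u i y)) x)"
  define Y where "Y = (\<Sum>i\<in>UNIV. box_int R (\<lambda>y. \<bar>u i y\<bar>) x)"
  define Z where "Z = (\<Sum>i\<in>UNIV. box_int R (\<lambda>y. max 0 (- u i y)) x)"
  have "K / C0 * X \<le> 2 * Y + 2 * K * Z"
  proof -
    have "K / C0 * X \<le> (\<Sum>i\<in>UNIV. (\<integral>y. w i y * u i y \<partial>lborel) + 2 * box_int R (\<lambda>y. \<bar>u i y\<bar>) x + 2 * K * box_int R (\<lambda>y. max 0 (- u i y)) x)"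
      unfolding X_def sum_distrib_left by (intro sum_mono int_pt)
    then show ?thesis by (simp add: sum.distrib wsum sum_distrib_left[symmetric] Y_def Z_def)
  qed
  then have X: "X \<le> 2 * C0 / K * Y + 2 * C0 * Z" using C0 K16 by (simp add: field_simps)
  have "(\<Sum>i\<in>UNIV. box_int (R / (2 * K)) (\<lambda>y. \<bar>u i y\<bar>) x) \<le> X + Z"
    unfolding X_def Z_def sum.distrib[symmetric] by (intro sum_mono split)
  with X have "(\<Sum>i\<in>UNIV. box_int (R / (2 * K)) (\<lambda>y. \<bar>u i y\<bar>) x) \<le> 2 * C0 / K * Y + (2 * C0 + 1) * Z"
    by (simp add: algebra_simps)
  then show ?thesis unfolding Y_def Z_def absu negu .
qed

end

section \<open>The defect and the recursion between scales\<close>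

definition gauss_conv :: "real \<Rightarrow> (real ^ 'n::finite \<Rightarrow> real) \<Rightarrow> real ^ 'n \<Rightarrow> real" where
  "gauss_conv t g x = (\<integral>z. gauss t (x - z) * g z \<partial>lborel)"

lemma integrable_gauss_mult:
  fixes g :: "real ^ 'n::finite \<Rightarrow> real"
  assumes t: "0 < t" and g: "integrable lborel g"
  shows "integrable lborel (\<lambda>z. gauss t (x - z) * g z)"
proof (rule Bochner_Integration.integrable_bound[OF integrable_mult_right[OF g, of "1 / (gauss_mass TYPE('n) * t ^ CARD('n))"]])
  show "(\<lambda>z. gauss t (x - z) * g z) \<in> borel_measurable lborel"
    using borel_measurable_integrable[OF g] by measurable
  show "AE z in lborel. norm (gauss t (x - z) * g z) \<le> norm (1 / (gauss_mass TYPE('n) * t ^ CARD('n)) * g z)"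
    unfolding real_norm_def abs_mult[of "gauss t _"] abs_mult[of "1 / _"] abs_of_nonneg[OF gauss_nonneg[OF t]]
    by (intro AE_I2 mult_right_mono order.trans[OF gauss_le[OF t] abs_ge_self] abs_ge_zero)
qed

lemma measurable_gauss_conv:
  assumes [measurable]: "g \<in> borel_measurable borel"
  shows "gauss_conv t g \<in> borel_measurable borel"
  unfolding gauss_conv_def[abs_def] by (rule lborel.borel_measurable_lebesgue_integral) measurable

lemma gauss_conv_integral:
  fixes g :: "real ^ 'n::finite \<Rightarrow> real"
  assumes t: "0 < t" and g: "integrable lborel g" and nn: "\<And>z. 0 \<le> g z"
  shows "integrable lborel (gauss_conv t g)" "(\<integral>x. gauss_conv t g x \<partial>lborel) = (\<integral>x. g x \<partial>lborel)"
proof -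
  have [measurable]: "g \<in> borel_measurable borel" using borel_measurable_integrable[OF g] by simp
  have nn': "0 \<le> gauss t (x - z) * g z" for x z using gauss_nonneg[OF t, where 'n = 'n] nn by (intro mult_nonneg_nonneg)
  have nnc: "0 \<le> gauss_conv t g x" for x unfolding gauss_conv_def by (intro integral_nonneg_AE AE_I2 nn')
  have e: "ennreal (gauss_conv t g x) = (\<integral>\<^sup>+z. ennreal (gauss t (x - z)) * ennreal (g z) \<partial>lborel)" for x
    unfolding gauss_conv_def using gauss_nonneg[OF t, where 'n = 'n] nn
    by (subst nn_integral_eq_integral[symmetric, OF integrable_gauss_mult[OF t g] AE_I2[OF nn']]) (simp add: ennreal_mult)
  have "(\<integral>\<^sup>+x. ennreal (gauss_conv t g x) \<partial>lborel) = (\<integral>\<^sup>+z. \<integral>\<^sup>+x. ennreal (gauss t (x - z)) * ennreal (g z) \<partial>lborel \<partial>lborel)"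
    unfolding e by (rule lborel_pair.Fubini'[symmetric]) measurable
  also have "\<dots> = (\<integral>\<^sup>+z. ennreal (g z) \<partial>lborel)"
    by (subst nn_integral_multc) (auto simp: nn_integral_gauss[OF t])
  also have "\<dots> = ennreal (\<integral>z. g z \<partial>lborel)" by (rule nn_integral_eq_integral[OF g AE_I2[OF nn]])
  finally have eq: "(\<integral>\<^sup>+x. ennreal (gauss_conv t g x) \<partial>lborel) = ennreal (\<integral>z. g z \<partial>lborel)" .
  have [measurable]: "gauss_conv t g \<in> borel_measurable borel" by (rule measurable_gauss_conv) measurable
  show "integrable lborel (gauss_conv t g)" using eq nnc by (intro integrableI_bounded) auto
  show "(\<integral>x. gauss_conv t g x \<partial>lborel) = (\<integral>x. g x \<partial>lborel)"
    using eq nnc nn by (subst integral_eq_nn_integral) (auto simp: integral_nonneg_AE)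
qed

lemma gauss_conv_ge_box:
  fixes g :: "real ^ 'n::finite \<Rightarrow> real"
  assumes t: "0 < t" and g: "integrable lborel g" and nn: "\<And>z. 0 \<le> g z"
    and k: "\<And>z. z \<in> sup_box x R \<Longrightarrow> k \<le> gauss t (y - z)"
  shows "k * box_int R g x \<le> gauss_conv t g y"
proof -
  have "k * box_int R g x = (\<integral>z. k * (indicator (sup_box x R) z * g z) \<partial>lborel)"
    unfolding box_int_def by simp
  also have "\<dots> \<le> gauss_conv t g y"
    unfolding gauss_conv_def
  proof (intro integral_mono integrable_gauss_mult t g integrable_mult_right integrable_box)
    fix z show "k * (indicator (sup_box x R) z * g z) \<le> gauss t (y - z) * g z"
      using k[of z] nn[of z] gauss_nonneg[OF t, of "y - z"]
      by (cases "z \<in> sup_box x R") (auto intro: mult_right_mono)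
  qed
  finally show ?thesis .
qed

lemma norm_le_sup_box:
  assumes "z \<in> sup_box x R" shows "(norm (x - z :: real ^ 'n::finite))\<^sup>2 \<le> real CARD('n) * R\<^sup>2"
proof -
  have "(norm (x - z))\<^sup>2 = (\<Sum>i\<in>UNIV. \<bar>x $ i - z $ i\<bar>\<^sup>2)"
    unfolding norm_vec_def L2_set_def by (simp add: sum_nonneg)
  also have "\<dots> \<le> (\<Sum>i\<in>(UNIV :: 'n set). R\<^sup>2)"
    using assms by (intro sum_mono power_mono) (auto simp: sup_box_def abs_minus_commute)
  finally show ?thesis by simp
qed

lemma box_int_const: "0 \<le> R \<Longrightarrow> box_int R (\<lambda>_. c) (x :: real ^ 'n::finite) = c * (2 * R) ^ CARD('n)"
  unfolding box_int_def
  by (simp add: measure_def emeasure_sup_box)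

lemma box_int_ge_const:
  assumes "0 \<le> R" "integrable lborel f" "\<And>y. y \<in> sup_box x R \<Longrightarrow> c \<le> f y"
  shows "c * (2 * R) ^ CARD('n) \<le> box_int R f (x :: real ^ 'n::finite)"
proof -
  have "emeasure lborel (sup_box x R) < \<infinity>" by (simp add: emeasure_sup_box assms(1))
  then have i: "integrable lborel (\<lambda>y. indicator (sup_box x R) y * c)"
    by (intro integrable_mult_left integrable_real_indicator) auto
  have "box_int R (\<lambda>_. c) x \<le> box_int R f x"
    unfolding box_int_def using assms(3)
    by (intro integral_mono[OF i] integrable_box assms(2)) (auto simp: indicator_def)
  then show ?thesis using assms(1) by (simp add: box_int_const)
qed

context solenoidal
begin

text \<open>By the semigroup law \<open>G i R\<close> is \<open>G i (\<theta> * R)\<close> smoothed at width \<open>R * sqrt (1 - \<theta>\<^sup>2)\<close>. The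
  defect measures how much is lost by taking absolute values after this smoothing instead of before.\<close>

definition defect :: "real \<Rightarrow> 'n \<Rightarrow> real \<Rightarrow> real ^ 'n \<Rightarrow> real" where
  "defect \<theta> i R y = gauss_conv (R * sqrt (1 - \<theta>\<^sup>2)) (\<lambda>z. \<bar>G i (\<theta> * R) z\<bar>) y - \<bar>G i R y\<bar>"

context
  fixes \<theta> R :: real
  assumes \<theta>: "0 < \<theta>" "\<theta> < 1" and R: "0 < R"
begin

lemma width_pos: "0 < R * sqrt (1 - \<theta>\<^sup>2)"
  using \<theta> R by (simp add: power_less_one_iff)

lemma G_semigroup: "G i R y = gauss_conv (R * sqrt (1 - \<theta>\<^sup>2)) (G i (\<theta> * R)) y"
proof -
  have "\<theta>\<^sup>2 < 1" using \<theta> by (simp add: power_less_one_iff)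
  then have "sqrt ((R * sqrt (1 - \<theta>\<^sup>2))\<^sup>2 + (\<theta> * R)\<^sup>2) = R"
    using R by (simp add: power_mult_distrib algebra_simps)
  with G_convolution(1)[OF width_pos, of "\<theta> * R" i y] \<theta> R show ?thesis
    by (simp add: gauss_conv_def)
qed

lemma integrable_abs_G: "integrable lborel (\<lambda>z. \<bar>G i (\<theta> * R) z\<bar>)"
  using \<theta> R by (intro integrable_abs integrable_G) auto

text \<open>If \<open>p\<close> and \<open>q\<close> are the smoothed positive and negative parts, then the defect is
  \<open>(p + q) - \<bar>p - q\<bar>\<close>.\<close>

lemma defect_eq_min:
  "defect \<theta> i R y = 2 * min (gauss_conv (R * sqrt (1 - \<theta>\<^sup>2)) (\<lambda>z. max 0 (G i (\<theta> * R) z)) y)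
      (gauss_conv (R * sqrt (1 - \<theta>\<^sup>2)) (\<lambda>z. max 0 (- G i (\<theta> * R) z)) y)"
proof -
  define t where "t = R * sqrt (1 - \<theta>\<^sup>2)"
  define u where "u = G i (\<theta> * R)"
  have t: "0 < t" unfolding t_def by (rule width_pos)
  have u: "integrable lborel u" unfolding u_def using \<theta> R by (intro integrable_G) auto
  have p: "integrable lborel (\<lambda>z. max 0 (u z))" "integrable lborel (\<lambda>z. max 0 (- u z))"
    by (intro integrable_max integrable_zero Bochner_Integration.integrable_minus u)+
  have "gauss_conv t (\<lambda>z. \<bar>u z\<bar>) y = gauss_conv t (\<lambda>z. max 0 (u z)) y + gauss_conv t (\<lambda>z. max 0 (- u z)) y"
    unfolding gauss_conv_def Bochner_Integration.integral_add[OF integrable_gauss_mult[OF t p(1)] integrable_gauss_mult[OF t p(2)], symmetric]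
    by (intro Bochner_Integration.integral_cong) (auto simp: max_def)
  moreover have "gauss_conv t u y = gauss_conv t (\<lambda>z. max 0 (u z)) y - gauss_conv t (\<lambda>z. max 0 (- u z)) y"
    unfolding gauss_conv_def Bochner_Integration.integral_diff[OF integrable_gauss_mult[OF t p(1)] integrable_gauss_mult[OF t p(2)], symmetric]
    by (intro Bochner_Integration.integral_cong) (auto simp: max_def)
  moreover have "0 \<le> gauss_conv t (\<lambda>z. max 0 (u z)) y" "0 \<le> gauss_conv t (\<lambda>z. max 0 (- u z)) y"
    unfolding gauss_conv_def using gauss_nonneg[OF t, where 'n = 'n] by (auto intro!: integral_nonneg_AE)
  ultimately show ?thesis
    unfolding defect_def t_def[symmetric] u_def[symmetric] G_semigroup[of i y] by (auto simp: min_def abs_if)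
qed

lemma defect_nonneg: "0 \<le> defect \<theta> i R y"
  unfolding defect_eq_min gauss_conv_def using gauss_nonneg[OF width_pos, where 'n = 'n]
  by (auto intro!: integral_nonneg_AE simp: min_def)

lemma measurable_defect: "defect \<theta> i R \<in> borel_measurable borel"
proof -
  have [measurable]: "gauss_conv (R * sqrt (1 - \<theta>\<^sup>2)) (\<lambda>z. \<bar>G i (\<theta> * R) z\<bar>) \<in> borel_measurable borel"
    by (rule measurable_gauss_conv) measurable
  show ?thesis unfolding defect_def[abs_def] by measurable
qed

lemma integrable_defect: "integrable lborel (defect \<theta> i R)"
  unfolding defect_def[abs_def]
  by (intro Bochner_Integration.integrable_diff gauss_conv_integral width_pos integrable_abs_G integrable_abs integrable_G R) auto

text \<open>Smoothing preserves the integral of \<open>\<bar>G i (\<theta> * R)\<bar>\<close>. Along \<open>R = \<theta> powi k\<close> these differences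
  telescope.\<close>

lemma integral_defect:
  "(\<integral>y. defect \<theta> i R y \<partial>lborel) = (\<integral>y. \<bar>G i (\<theta> * R) y\<bar> \<partial>lborel) - (\<integral>y. \<bar>G i R y\<bar> \<partial>lborel)"
  unfolding defect_def[abs_def]
  by (subst Bochner_Integration.integral_diff)
     (auto intro!: gauss_conv_integral width_pos integrable_abs_G integrable_abs integrable_G R)

lemma gauss_lower:
  assumes th: "\<theta> \<le> 1 / 2" and y: "y \<in> sup_box x R" and z: "z \<in> sup_box x R"
  shows "exp (- 16 * real CARD('n)) / (gauss_mass TYPE('n) * R ^ CARD('n)) \<le> gauss (R * sqrt (1 - \<theta>\<^sup>2)) (y - z :: real ^ 'n)"
proof -
  define t where "t = R * sqrt (1 - \<theta>\<^sup>2)"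
  have t: "0 < t" unfolding t_def by (rule width_pos)
  have "\<theta>\<^sup>2 \<le> (1/2)\<^sup>2" using \<theta> th by (intro power_mono) auto
  then have a: "1 / 4 \<le> 1 - \<theta>\<^sup>2" by (simp add: power2_eq_square)
  have t2: "t\<^sup>2 = R\<^sup>2 * (1 - \<theta>\<^sup>2)" using a by (simp add: t_def power_mult_distrib)
  have tR: "t \<le> R" using R a by (simp add: t_def mult_le_cancel_left2)
  have "z \<in> sup_box y (R + R)" by (rule sup_box_trans[OF z y[THEN sup_box_sym[THEN iffD1]]])
  from norm_le_sup_box[OF this] have n: "(norm (y - z))\<^sup>2 \<le> real CARD('n) * (4 * R\<^sup>2)"
    by (simp add: power2_eq_square)
  have "R\<^sup>2 / 4 \<le> t\<^sup>2" unfolding t2 using a mult_left_mono[OF a, of "R\<^sup>2"] by simp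
  have "(norm (y - z))\<^sup>2 / t\<^sup>2 \<le> (real CARD('n) * (4 * R\<^sup>2)) / (R\<^sup>2 / 4)"
    using n \<open>R\<^sup>2 / 4 \<le> t\<^sup>2\<close> R by (intro frac_le) auto
  also have "\<dots> = 16 * real CARD('n)" using R by simp
  finally have "- 16 * real CARD('n) \<le> - (norm (y - z))\<^sup>2 / t\<^sup>2" by simp
  then have "exp (- 16 * real CARD('n)) / (gauss_mass TYPE('n) * R ^ CARD('n)) \<le> exp (- (norm (y - z))\<^sup>2 / t\<^sup>2) / (gauss_mass TYPE('n) * t ^ CARD('n))"
    using t tR gauss_mass_pos[where 'n = 'n] by (intro frac_le mult_left_mono power_mono mult_pos_pos) auto
  then show ?thesis by (simp add: gauss_def t_def)
qed

text \<open>Apply \<open>local_estimate\<close> at width \<open>\<theta> * R\<close> with \<open>1 / K = 2 * \<theta>\<close>, where \<open>s i\<close> is the sign that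
  prevails in the box of radius \<open>R\<close>. The mass of the other sign is then \<open>min (p i) (q i)\<close>, which is
  controlled by the defect: in the box, the smoothing kernel is bounded below by a constant over the
  volume (\<open>gauss_lower\<close>). For the same reason the full mass at width \<open>\<theta> * R\<close> is bounded by that of
  \<open>\<bar>G i R\<bar>\<close> plus the defect, which brings back the width \<open>R\<close>.\<close>

lemma scale_recursion:
  assumes th: "\<theta> \<le> 1 / (32 * exp 3)"
  defines "\<kappa> \<equiv> exp (- 16 * real CARD('n)) / gauss_mass TYPE('n) * 2 ^ CARD('n)"
    and "C0 \<equiv> 8 * exp 3 ^ CARD('n)"
  shows "(\<Sum>i\<in>UNIV. box_int (\<theta> * R) (\<lambda>y. \<bar>G i (\<theta> * R) y\<bar>) x)
    \<le> (6 * C0 + 1) / \<kappa> * (\<theta> * (\<Sum>i\<in>UNIV. box_int R (\<lambda>y. \<bar>G i R y\<bar>) x) + (\<Sum>i\<in>UNIV. box_int R (defect \<theta> i R) x))"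
proof -
  define t where "t = R * sqrt (1 - \<theta>\<^sup>2)"
  have t: "0 < t" unfolding t_def by (rule width_pos)
  have "1 \<le> exp (3::real)" by simp
  then have "2 \<le> 32 * exp (3::real)" by linarith
  then have "1 / (32 * exp 3) \<le> 1 / (2 :: real)" by (intro divide_left_mono) auto
  then have half: "\<theta> \<le> 1 / 2" by (rule order.trans[OF th])
  have \<kappa>: "0 < \<kappa>" unfolding \<kappa>_def using gauss_mass_pos[where 'n = 'n] by simp
  have C0: "0 < C0" by (simp add: C0_def)
  define k where "k = exp (- 16 * real CARD('n)) / (gauss_mass TYPE('n) * R ^ CARD('n))"
  have kk: "k * (2 * R) ^ CARD('n) = \<kappa>"
    using R by (simp add: k_def \<kappa>_def power_mult_distrib)
  define u where "u i = G i (\<theta> * R)" for i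
  have u: "integrable lborel (u i)" for i unfolding u_def using \<theta> R by (intro integrable_G) auto
  have pm: "integrable lborel (\<lambda>z. max 0 (u i z))" "integrable lborel (\<lambda>z. max 0 (- u i z))" for i
    by (intro integrable_max integrable_zero Bochner_Integration.integrable_minus u)+
  have low: "k * box_int R g x \<le> gauss_conv t g y" if "y \<in> sup_box x R" "integrable lborel g" "\<And>z. 0 \<le> g z" for g y
    using that t gauss_lower[OF half that(1)] unfolding k_def t_def by (intro gauss_conv_ge_box) auto
  define p where "p i = box_int R (\<lambda>y. max 0 (u i y)) x" for i
  define q where "q i = box_int R (\<lambda>y. max 0 (- u i y)) x" for i
  \<comment> \<open>the prevailing sign\<close>
  define s where "s i = (if q i \<le> p i then 1 else - 1 :: real)" for i
  have min: "box_int R (\<lambda>y. max 0 (- s i * u i y)) x = min (p i) (q i)" for i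
    by (auto simp: s_def p_def q_def min_def)
  have d1: "\<kappa> * (2 * min (p i) (q i)) \<le> box_int R (defect \<theta> i R) x" for i
  proof -
    have "k * (2 * min (p i) (q i)) \<le> defect \<theta> i R y" if y: "y \<in> sup_box x R" for y
    proof -
      have "k * min (p i) (q i) \<le> k * p i" "k * min (p i) (q i) \<le> k * q i"
        using R gauss_mass_pos[where 'n = 'n] by (intro mult_left_mono; simp add: k_def)+
      note this(1)[THEN order.trans, OF low[OF y pm(1) max.cobounded1, folded p_def]]
        this(2)[THEN order.trans, OF low[OF y pm(2) max.cobounded1, folded q_def]]
      then
      have "k * min (p i) (q i) \<le> gauss_conv t (\<lambda>z. max 0 (u i z)) y" "k * min (p i) (q i) \<le> gauss_conv t (\<lambda>z. max 0 (- u i z)) y"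
        by this
      then show ?thesis unfolding defect_eq_min t_def u_def by simp
    qed
    then have "k * (2 * min (p i) (q i)) * (2 * R) ^ CARD('n) \<le> box_int R (defect \<theta> i R) x"
      using R by (intro box_int_ge_const integrable_defect) auto
    then show ?thesis by (simp add: kk[symmetric] ac_simps)
  qed
  have d2: "\<kappa> * box_int R (\<lambda>y. \<bar>u i y\<bar>) x \<le> box_int R (\<lambda>y. \<bar>G i R y\<bar>) x + box_int R (defect \<theta> i R) x" for i
  proof -
    have "k * box_int R (\<lambda>y. \<bar>u i y\<bar>) x \<le> \<bar>G i R y\<bar> + defect \<theta> i R y" if "y \<in> sup_box x R" for y
      using low[OF that integrable_abs[OF u]] unfolding defect_def t_def u_def by simp
    then have "k * box_int R (\<lambda>y. \<bar>u i y\<bar>) x * (2 * R) ^ CARD('n) \<le> box_int R (\<lambda>y. \<bar>G i R y\<bar> + defect \<theta> i R y) x"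
      using R by (intro box_int_ge_const Bochner_Integration.integrable_add integrable_defect integrable_abs integrable_G) auto
    also have "\<dots> = box_int R (\<lambda>y. \<bar>G i R y\<bar>) x + box_int R (defect \<theta> i R) x"
      unfolding box_int_def distrib_left using R
      by (intro Bochner_Integration.integral_add integrable_box integrable_defect integrable_abs integrable_G)
    finally show ?thesis by (simp add: kk[symmetric] ac_simps)
  qed
  define A where "A = (\<Sum>i\<in>UNIV. box_int R (\<lambda>y. \<bar>G i R y\<bar>) x)"
  define D where "D = (\<Sum>i\<in>UNIV. box_int R (defect \<theta> i R) x)"
  define U where "U = (\<Sum>i\<in>UNIV. box_int R (\<lambda>y. \<bar>u i y\<bar>) x)"
  define m where "m = (\<Sum>i\<in>UNIV. min (p i) (q i))"
  have m: "\<kappa> * (2 * m) \<le> D" unfolding m_def D_def sum_distrib_left by (intro sum_mono d1)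
  have U: "\<kappa> * U \<le> A + D" unfolding U_def A_def D_def sum_distrib_left sum.distrib[symmetric] by (intro sum_mono d2)
  have nnA: "0 \<le> A" unfolding A_def box_int_def by (intro sum_nonneg integral_nonneg_AE) auto
  have nnD: "0 \<le> D" unfolding D_def box_int_def by (intro sum_nonneg integral_nonneg_AE) (auto simp: defect_nonneg)
  have "(\<Sum>i\<in>UNIV. box_int (R / (2 * (1 / (2 * \<theta>)))) (\<lambda>y. \<bar>G i (\<theta> * R) y\<bar>) x) \<le>
    2 * C0 / (1 / (2 * \<theta>)) * (\<Sum>i\<in>UNIV. box_int R (\<lambda>y. \<bar>G i (\<theta> * R) y\<bar>) x)
    + (2 * C0 + 1) * (\<Sum>i\<in>UNIV. box_int R (\<lambda>y. max 0 (- s i * G i (\<theta> * R) y)) x)"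
    unfolding C0_def
  proof (rule local_estimate)
    show "16 * exp 3 \<le> 1 / (2 * \<theta>)" using th \<theta> by (simp add: field_simps)
  qed (use R \<theta> in \<open>auto simp: s_def\<close>)
  then have "(\<Sum>i\<in>UNIV. box_int (\<theta> * R) (\<lambda>y. \<bar>G i (\<theta> * R) y\<bar>) x) \<le> 4 * C0 * \<theta> * U + (2 * C0 + 1) * m"
    unfolding u_def[symmetric] min U_def m_def using \<theta> by (simp add: ac_simps)
  also have "\<dots> \<le> (4 * C0 * \<theta> * (A + D) + (2 * C0 + 1) * D) / \<kappa>"
  proof -
    have "U \<le> (A + D) / \<kappa>" using U \<kappa> by (simp add: field_simps)
    moreover have "m \<le> D / \<kappa>"
    proof -
      have "\<kappa> * m \<le> D" using m nnD by linarith
      then show ?thesis using \<kappa> by (simp add: field_simps)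
    qed
    ultimately have "4 * C0 * \<theta> * U + (2 * C0 + 1) * m \<le> 4 * C0 * \<theta> * ((A + D) / \<kappa>) + (2 * C0 + 1) * (D / \<kappa>)"
      using C0 \<theta> by (intro add_mono mult_left_mono) auto
    moreover have "4 * C0 * \<theta> * ((A + D) / \<kappa>) + (2 * C0 + 1) * (D / \<kappa>) = (4 * C0 * \<theta> * (A + D) + (2 * C0 + 1) * D) / \<kappa>"
      by (subst add_divide_distrib[of "4 * C0 * \<theta> * (A + D)"]) (simp only: times_divide_eq_right)
    ultimately show ?thesis by (simp only:)
  qed
  also have "\<dots> \<le> ((6 * C0 + 1) * (\<theta> * A + D)) / \<kappa>"
  proof (intro divide_right_mono)
    have "C0 * \<theta> * D \<le> C0 * 1 * D" using C0 \<theta> nnD by (intro mult_right_mono mult_left_mono) auto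
    moreover have "0 \<le> C0 * \<theta> * A" "0 \<le> \<theta> * A" using C0 \<theta> nnA by auto
    ultimately show "4 * C0 * \<theta> * (A + D) + (2 * C0 + 1) * D \<le> (6 * C0 + 1) * (\<theta> * A + D)"
      by (simp add: algebra_simps)
  qed (use \<kappa> in simp)
  finally show ?thesis by (simp add: A_def D_def)
qed

end

end

section \<open>Summation over all scales\<close>

text \<open>The recursion is unrolled towards \<open>k = -\<infinity>\<close>; boundedness there makes the remainder vanish.\<close>

lemma halving_recursion:
  fixes g e :: "int \<Rightarrow> real"
  assumes step: "\<And>k. g (k + 1) \<le> g k / 2 + c * e k" and e: "\<And>k. 0 \<le> e k" and c: "0 \<le> c"
    and bounded: "\<And>k. k \<le> k0 \<Longrightarrow> g k \<le> B"
  shows "ennreal (g k0) \<le> (\<Sum>j. ennreal ((1/2)^j * c * e (k0 - 1 - int j)))"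
proof -
  have it: "g k0 \<le> (1/2)^n * g (k0 - int n) + (\<Sum>j<n. (1/2)^j * c * e (k0 - 1 - int j))" for n
  proof (induction n)
    case (Suc n)
    have "g (k0 - int n) \<le> g (k0 - 1 - int n) / 2 + c * e (k0 - 1 - int n)"
      using step[of "k0 - 1 - int n"] by (simp add: algebra_simps)
    then have "(1/2)^n * g (k0 - int n) \<le> (1/2)^n * (g (k0 - 1 - int n) / 2 + c * e (k0 - 1 - int n))"
      by (intro mult_left_mono) auto
    with Suc show ?case by (simp add: algebra_simps)
  qed simp
  show ?thesis
  proof (rule ennreal_le_epsilon)
    fix \<epsilon> :: real assume \<epsilon>: "0 < \<epsilon>"
    define B' where "B' = max B 1"
    obtain n where n: "(1/2 :: real)^n < \<epsilon> / B'"
      using real_arch_pow_inv[of "\<epsilon> / B'" "1/2"] \<epsilon> by (auto simp: B'_def max_def)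
    have B': "0 < B'" "g (k0 - int n) \<le> B'" using bounded[of "k0 - int n"] by (auto simp: B'_def)
    have "(1/2)^n * g (k0 - int n) \<le> (1/2)^n * B'" using B' by (intro mult_left_mono) auto
    also have "\<dots> \<le> \<epsilon>" using n B' by (simp add: field_simps)
    finally have "g k0 \<le> \<epsilon> + (\<Sum>j<n. (1/2)^j * c * e (k0 - 1 - int j))" using it[of n] by linarith
    then have "ennreal (g k0) \<le> ennreal (\<epsilon> + (\<Sum>j<n. (1/2)^j * c * e (k0 - 1 - int j)))" by (rule ennreal_leI)
    also have "\<dots> = ennreal \<epsilon> + (\<Sum>j<n. ennreal ((1/2)^j * c * e (k0 - 1 - int j)))"
      using \<epsilon> e c by (subst ennreal_plus) (auto intro!: sum_nonneg simp: sum_ennreal)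
    also have "\<dots> \<le> ennreal \<epsilon> + (\<Sum>j. ennreal ((1/2)^j * c * e (k0 - 1 - int j)))"
      by (intro add_left_mono sum_le_suminf) auto
    finally show "ennreal (g k0) \<le> (\<Sum>j. ennreal ((1/2)^j * c * e (k0 - 1 - int j))) + ennreal \<epsilon>"
      by (simp add: add.commute)
  qed
qed

lemma ennreal_suminf_swap:
  fixes f :: "nat \<Rightarrow> nat \<Rightarrow> ennreal"
  shows "(\<Sum>m. \<Sum>n. f m n) = (\<Sum>n. \<Sum>m. f m n)"
proof -
  have "(\<Sum>m. \<Sum>n. f m n) = (\<integral>\<^sup>+m. (\<Sum>n. f m n) \<partial>count_space UNIV)"
    by (simp add: nn_integral_count_space_nat)
  also have "\<dots> = (\<Sum>n. \<integral>\<^sup>+m. f m n \<partial>count_space UNIV)"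
    by (rule nn_integral_suminf) auto
  finally show ?thesis by (simp add: nn_integral_count_space_nat)
qed

text \<open>The exponential is bounded by a multiple of the power \<open>- 2 * (d + 3)\<close> of \<open>l\<close>, so that the
  terms are of order \<open>- (d + 5)\<close>.\<close>

lemma summable_gauss_poly:
  fixes c :: real
  assumes c: "0 < c"
  shows "summable (\<lambda>l. exp (- c * (real l)\<^sup>2) * (real l + 2) ^ d * (real l + 3))"
proof -
  define m where "m = d + 3"
  define K where "K = (real m / c) ^ m * (3 ^ d * 4)"
  show ?thesis
  proof (rule summable_comparison_test'[where N = 1])
    show "summable (\<lambda>l. K * inverse (real l ^ (d + 5)))"
      by (intro summable_mult inverse_power_summable) simp
    fix l :: nat assume l: "1 \<le> l"
    then have l1: "1 \<le> real l" by simp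
    have m0: "0 < m" by (simp add: m_def)
    have "(c * (real l)\<^sup>2 / real m) ^ m \<le> (1 + c * (real l)\<^sup>2 / real m) ^ m"
      using c by (intro power_mono) auto
    also have "\<dots> \<le> exp (c * (real l)\<^sup>2)"
      using m0 c by (intro exp_ge_one_plus_x_over_n_power_n) (auto intro: order.trans[of _ 0])
    finally have "exp (- c * (real l)\<^sup>2) \<le> inverse ((c * (real l)\<^sup>2 / real m) ^ m)"
      using c l m0 by (simp add: exp_minus le_imp_inverse_le)
    also have "\<dots> = (real m / c) ^ m * inverse (real l ^ (2 * m))"
    proof -
      have "((real l)\<^sup>2) ^ m = real l ^ (2 * m)" by (simp add: power_mult)
      then show ?thesis using c m0 by (simp add: power_divide power_mult_distrib field_simps)
    qed
    finally have 1: "exp (- c * (real l)\<^sup>2) \<le> (real m / c) ^ m * inverse (real l ^ (2 * m))" .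
    have 2: "(real l + 2) ^ d \<le> (3 * real l) ^ d" using l1 by (intro power_mono) auto
    have 3: "real l + 3 \<le> 4 * real l" using l1 by simp
    have "exp (- c * (real l)\<^sup>2) * (real l + 2) ^ d * (real l + 3)
        \<le> ((real m / c) ^ m * inverse (real l ^ (2 * m))) * (3 * real l) ^ d * (4 * real l)"
      using 1 2 3 c by (intro mult_mono) auto
    also have "\<dots> = K * (real l ^ (d + 1) * inverse (real l ^ (2 * m)))"
      by (simp add: K_def power_mult_distrib)
    also have "real l ^ (d + 1) * inverse (real l ^ (2 * m)) = inverse (real l ^ (d + 5))"
    proof -
      have "2 * m = (d + 1) + (d + 5)" by (simp add: m_def)
      then show ?thesis using l1 by (simp only: power_add) (simp add: field_simps)
    qed
    finally show "norm (exp (- c * (real l)\<^sup>2) * (real l + 2) ^ d * (real l + 3)) \<le> K * inverse (real l ^ (d + 5))"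
      by simp
  qed
qed

lemma ennreal_mult_assoc2: "0 \<le> a \<Longrightarrow> 0 \<le> b \<Longrightarrow> ennreal (a * b) * y = ennreal a * (ennreal b * y)"
  by (simp add: ennreal_mult mult.assoc)

lemma ennreal_mult_assoc3:
  "0 \<le> a \<Longrightarrow> 0 \<le> b \<Longrightarrow> 0 \<le> c \<Longrightarrow> ennreal a * (ennreal b * y * ennreal c) = ennreal (a * b * c) * y"
  by (simp add: ennreal_mult ac_simps)

lemma ennreal_box_int:
  assumes "integrable lborel f" "\<And>y. 0 \<le> f y"
  shows "ennreal (box_int R f x) = box_mass R (\<lambda>y. ennreal (f y)) x"
proof -
  have "ennreal (box_int R f x) = (\<integral>\<^sup>+y. ennreal (indicator (sup_box x R) y * f y) \<partial>lborel)"
    unfolding box_int_def using assms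
    by (intro nn_integral_eq_integral[symmetric] integrable_box) (auto intro!: AE_I2)
  also have "\<dots> = box_mass R (\<lambda>y. ennreal (f y)) x"
    unfolding box_mass_def by (intro nn_integral_cong) (auto simp: indicator_def)
  finally show ?thesis .
qed

lemma box_mass_sum:
  assumes "\<And>i. i \<in> I \<Longrightarrow> f i \<in> borel_measurable borel"
  shows "box_mass R (\<lambda>y. \<Sum>i\<in>I. f i y) x = (\<Sum>i\<in>I. box_mass R (f i) x)"
  unfolding box_mass_def sum_distrib_right using assms by (intro nn_integral_sum) auto

text \<open>Each point \<open>z\<close> of the large box belongs to the boxes of radius \<open>\<rho>\<close> around a set of centres \<open>w\<close>
  of volume \<open>(2 * \<rho>) ^ d\<close>, so a large box mass is an average of small ones up to normalization.\<close>

lemma box_mass_spread: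
  fixes g :: "real ^ 'n::finite \<Rightarrow> ennreal"
  assumes g [measurable]: "g \<in> borel_measurable borel" and \<rho>: "0 < \<rho>"
  shows "box_mass S g x \<le> ennreal (1 / (2 * \<rho>) ^ CARD('n)) * (\<integral>\<^sup>+w\<in>sup_box x (S + \<rho>). box_mass \<rho> g w \<partial>lborel)"
proof -
  have p: "0 < (2 * \<rho>) ^ CARD('n)" using \<rho> by simp
  have "ennreal ((2 * \<rho>) ^ CARD('n)) * box_mass S g x
      = (\<integral>\<^sup>+z. g z * indicator (sup_box x S) z * ennreal ((2 * \<rho>) ^ CARD('n)) \<partial>lborel)"
    unfolding box_mass_def by (subst nn_integral_cmult[symmetric]) (auto simp: mult.commute)
  also have "\<dots> = (\<integral>\<^sup>+z. (\<integral>\<^sup>+w. g z * indicator (sup_box x S) z * indicator (sup_box z \<rho>) w \<partial>lborel) \<partial>lborel)"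
    using \<rho> by (subst nn_integral_cmult_indicator) (auto simp: emeasure_sup_box)
  also have "\<dots> \<le> (\<integral>\<^sup>+z. (\<integral>\<^sup>+w. g z * indicator (sup_box w \<rho>) z * indicator (sup_box x (S + \<rho>)) w \<partial>lborel) \<partial>lborel)"
  proof (intro nn_integral_mono)
    fix z w
    have "z \<in> sup_box w \<rho>" "w \<in> sup_box x (S + \<rho>)" if "z \<in> sup_box x S" "w \<in> sup_box z \<rho>"
      using that sup_box_trans[of w z \<rho> x S] sup_box_sym by blast+
    then show "g z * indicator (sup_box x S) z * indicator (sup_box z \<rho>) w
        \<le> g z * indicator (sup_box w \<rho>) z * indicator (sup_box x (S + \<rho>)) w"
      by (auto simp: indicator_def)
  qed
  also have "\<dots> = (\<integral>\<^sup>+w. (\<integral>\<^sup>+z. g z * indicator (sup_box w \<rho>) z * indicator (sup_box x (S + \<rho>)) w \<partial>lborel) \<partial>lborel)"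
    by (rule lborel_pair.Fubini') measurable
  also have "\<dots> = (\<integral>\<^sup>+w\<in>sup_box x (S + \<rho>). box_mass \<rho> g w \<partial>lborel)"
    unfolding box_mass_def by (intro nn_integral_cong nn_integral_multc) auto
  finally have "ennreal (1 / (2 * \<rho>) ^ CARD('n)) * (ennreal ((2 * \<rho>) ^ CARD('n)) * box_mass S g x)
      \<le> ennreal (1 / (2 * \<rho>) ^ CARD('n)) * (\<integral>\<^sup>+w\<in>sup_box x (S + \<rho>). box_mass \<rho> g w \<partial>lborel)"
    by (intro mult_left_mono) auto
  then show ?thesis using p \<rho> by (simp add: mult.assoc[symmetric] ennreal_mult[symmetric])
qed

text \<open>The \<open>l\<close>-th term accounts for the points whose sup-norm distance from \<open>x\<close> is between \<open>l * r\<close>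
  and \<open>(l + 1) * r\<close>; their Euclidean distance is at least \<open>l * r\<close>.\<close>

lemma exp_norm_le_boxes:
  fixes z x :: "real ^ 'n::finite"
  assumes r: "0 < r" and c: "0 \<le> c"
  shows "ennreal (exp (- c * (norm (x - z))\<^sup>2 / r\<^sup>2))
    \<le> (\<Sum>l. ennreal (exp (- c * (real l)\<^sup>2)) * indicator (sup_box x ((real l + 1) * r)) z)"
proof -
  define m where "m = Max (range (\<lambda>i. \<bar>z $ i - x $ i\<bar>))"
  define l where "l = nat \<lfloor>m / r\<rfloor>"
  have m_ge: "\<bar>z $ i - x $ i\<bar> \<le> m" for i unfolding m_def by (rule Max_ge) auto
  have "m \<in> range (\<lambda>i. \<bar>z $ i - x $ i\<bar>)" unfolding m_def by (rule Max_in) auto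
  then obtain i where i: "m = \<bar>z $ i - x $ i\<bar>" by auto
  have m0: "0 \<le> m" using i by simp
  have ml: "m < (real l + 1) * r" "real l * r \<le> m"
  proof -
    have "real l \<le> m / r" "m / r < real l + 1" using m0 r unfolding l_def by simp_all
    then show "m < (real l + 1) * r" "real l * r \<le> m" using r by (simp_all add: field_simps)
  qed
  have in_box: "z \<in> sup_box x ((real l + 1) * r)"
    unfolding sup_box_def using m_ge ml(1) by (auto intro: order.trans less_imp_le)
  have "m \<le> norm (x - z)" using component_le_norm_cart[of "x - z" i] by (simp add: i abs_minus_commute)
  then have "(real l * r)\<^sup>2 \<le> (norm (x - z))\<^sup>2" using ml r by (intro power_mono) auto
  then have "(real l)\<^sup>2 \<le> (norm (x - z))\<^sup>2 / r\<^sup>2" using r by (simp add: power_mult_distrib field_simps)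
  then have "exp (- c * (norm (x - z))\<^sup>2 / r\<^sup>2) \<le> exp (- c * (real l)\<^sup>2)"
    using mult_left_mono[OF _ c] by fastforce
  then have "ennreal (exp (- c * (norm (x - z))\<^sup>2 / r\<^sup>2)) \<le> ennreal (exp (- c * (real l)\<^sup>2)) * indicator (sup_box x ((real l + 1) * r)) z"
    using in_box by (simp add: ennreal_leI)
  also have "\<dots> \<le> (\<Sum>l. ennreal (exp (- c * (real l)\<^sup>2)) * indicator (sup_box x ((real l + 1) * r)) z)"
    by (rule term_le_suminf)
  finally show ?thesis .
qed

text \<open>The constant of \<open>scale_recursion\<close>.\<close>

definition scale_recursion_const :: "'n::finite itself \<Rightarrow> real" where
  "scale_recursion_const _ = (6 * (8 * exp 3 ^ CARD('n)) + 1) / (exp (- 16 * real CARD('n)) / gauss_mass TYPE('n) * 2 ^ CARD('n))"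

lemma scale_recursion_const_pos: "0 < scale_recursion_const TYPE('n::finite)"
  unfolding scale_recursion_const_def using gauss_mass_pos[where 'n = 'n]
  by (intro divide_pos_pos mult_pos_pos add_pos_pos) auto

context solenoidal
begin

definition defect_sum :: "real \<Rightarrow> real \<Rightarrow> real ^ 'n \<Rightarrow> ennreal" where
  "defect_sum \<theta> R y = (\<Sum>i\<in>UNIV. ennreal (defect \<theta> i R y))"

context
  fixes \<theta> \<beta> :: real
  assumes th0: "0 < \<theta>" and th1: "\<theta> \<le> 1 / (32 * exp 3)" and \<beta>: "0 \<le> \<beta>" "\<beta> < 1"
    and contraction: "scale_recursion_const TYPE('n) * \<theta> powr (1 - \<beta>) \<le> 1 / 2"
begin

lemma theta_less_1: "\<theta> < 1"
proof -
  have "1 \<le> exp (3::real)" by simp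
  then have "1 < 32 * exp (3::real)" by linarith
  then have "1 / (32 * exp 3) < (1 :: real)" by simp
  then show ?thesis using th1 by linarith
qed

lemma scale_pos: "0 < \<theta> powi k"
  using th0 by simp

lemma scale_mono: "k \<le> l \<Longrightarrow> \<theta> powi l \<le> \<theta> powi k"
  using th0 theta_less_1 by (intro power_int_decreasing) auto

lemma scale_Suc: "\<theta> powi (k + 1) = \<theta> * \<theta> powi k"
  using th0 by (simp add: power_int_add_1)

lemma measurable_defect_sum [measurable]: "defect_sum \<theta> (\<theta> powi k) \<in> borel_measurable borel"
  unfolding defect_sum_def[abs_def]
  using measurable_defect[OF th0 theta_less_1 scale_pos] by measurable

lemma nn_integral_defect_sum:
  "(\<integral>\<^sup>+y. defect_sum \<theta> (\<theta> powi k) y \<partial>lborel) =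
    ennreal ((\<Sum>i\<in>UNIV. \<integral>y. \<bar>G i (\<theta> powi (k + 1)) y\<bar> \<partial>lborel) - (\<Sum>i\<in>UNIV. \<integral>y. \<bar>G i (\<theta> powi k) y\<bar> \<partial>lborel))"
proof -
  note d = th0 theta_less_1 scale_pos[of k]
  have "(\<integral>\<^sup>+y. defect_sum \<theta> (\<theta> powi k) y \<partial>lborel) = (\<Sum>i\<in>UNIV. \<integral>\<^sup>+y. ennreal (defect \<theta> i (\<theta> powi k) y) \<partial>lborel)"
    unfolding defect_sum_def using measurable_defect[OF d] by (intro nn_integral_sum) measurable
  also have "\<dots> = (\<Sum>i\<in>UNIV. ennreal (\<integral>y. defect \<theta> i (\<theta> powi k) y \<partial>lborel))"
    by (intro sum.cong refl nn_integral_eq_integral integrable_defect[OF d] AE_I2 defect_nonneg[OF d])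
  also have "\<dots> = ennreal (\<Sum>i\<in>UNIV. \<integral>y. defect \<theta> i (\<theta> powi k) y \<partial>lborel)"
    by (intro sum_ennreal integral_nonneg_AE AE_I2 defect_nonneg[OF d])
  finally show ?thesis by (simp add: integral_defect[OF d] sum_subtractf scale_Suc)
qed

text \<open>A finite set of scales is enclosed in an interval of integers, on which the integrals
  telescope to a difference of two \<open>L\<^sup>1\<close> norms. The shift \<open>c\<close> is needed because the defects enter
  the final sum at scales displaced by the number of recursion steps.\<close>

lemma sum_nn_integral_defect_sum:
  "(\<Sum>n. \<integral>\<^sup>+y. defect_sum \<theta> (\<theta> powi (int_decode n - c)) y \<partial>lborel) \<le> ennreal (2 * M * real CARD('n))"
proof (rule suminf_le_const)
  fix n :: nat
  define A where "A k = (\<Sum>i\<in>UNIV. \<integral>y. \<bar>G i (\<theta> powi k) y\<bar> \<partial>lborel)" for k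
  define I where "I k = (\<integral>\<^sup>+y. defect_sum \<theta> (\<theta> powi k) y \<partial>lborel)" for k
  have A0: "0 \<le> A k" for k unfolding A_def by (intro sum_nonneg integral_nonneg_AE) auto
  have A1: "A k \<le> 2 * M * real CARD('n)" for k
    using sum_mono[of "UNIV :: 'n set" "\<lambda>i. \<integral>y. \<bar>G i (\<theta> powi k) y\<bar> \<partial>lborel" "\<lambda>_. 2 * M"] G_L1[OF scale_pos]
    by (simp add: A_def mult.commute)
  have diff: "0 \<le> A (k + 1) - A k" for k
    unfolding A_def sum_subtractf[symmetric] scale_Suc integral_defect[OF th0 theta_less_1 scale_pos, symmetric]
    by (intro sum_nonneg integral_nonneg_AE AE_I2 defect_nonneg[OF th0 theta_less_1 scale_pos])
  have I: "I k = ennreal (A (k + 1) - A k)" for k unfolding I_def A_def by (rule nn_integral_defect_sum)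
  have tel: "(\<Sum>k\<in>{a..<a + int m}. I k) = ennreal (A (a + int m) - A a)" for a m
  proof (induction m)
    case (Suc m)
    have "{a..<a + int (Suc m)} = insert (a + int m) {a..<a + int m}" by auto
    then have "(\<Sum>k\<in>{a..<a + int (Suc m)}. I k) = I (a + int m) + ennreal (A (a + int m) - A a)"
      using Suc by simp
    moreover have "0 \<le> A (a + int m) - A a"
    proof (induction m)
      case (Suc m)
      have "A (a + int (Suc m)) = A (a + int m + 1)" by (simp add: algebra_simps)
      with Suc diff[of "a + int m"] show ?case by linarith
    qed simp
    ultimately show ?case
      using diff[of "a + int m"] by (simp add: I ennreal_plus[symmetric] algebra_simps del: ennreal_plus)
  qed simp
  define S where "S = (\<lambda>n. int_decode n - c) ` {..<n}"
  have inj: "inj_on (\<lambda>n. int_decode n - c) {..<n}" by (auto simp: inj_on_def int_decode_eq)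
  obtain a m where am: "S \<subseteq> {a..<a + int m}"
  proof (cases "S = {}")
    case False
    have "finite S" by (simp add: S_def)
    with False have "Min S \<le> Max S" by (meson Max_ge Min_in)
    then have "S \<subseteq> {Min S..<Min S + int (nat (Max S - Min S + 1))}" using \<open>finite S\<close> by auto
    then show thesis by (rule that)
  qed auto
  have "(\<Sum>k<n. I (int_decode k - c)) = (\<Sum>k\<in>S. I k)" unfolding S_def using inj by (simp add: sum.reindex)
  also have "\<dots> \<le> (\<Sum>k\<in>{a..<a + int m}. I k)" using am by (intro sum_mono2) auto
  also have "\<dots> \<le> ennreal (2 * M * real CARD('n))"
    unfolding tel using A0[of a] A1[of "a + int m"] by (intro ennreal_leI) linarith
  finally show "(\<Sum>k<n. \<integral>\<^sup>+y. defect_sum \<theta> (\<theta> powi (int_decode k - c)) y \<partial>lborel) \<le> ennreal (2 * M * real CARD('n))"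
    by (simp add: I_def)
qed auto

lemma box_mass_defect_sum:
  "ennreal (\<Sum>i\<in>UNIV. box_int (\<theta> powi k) (defect \<theta> i (\<theta> powi k)) x) = box_mass (\<theta> powi k) (defect_sum \<theta> (\<theta> powi k)) x"
proof -
  note d = th0 theta_less_1 scale_pos[of k]
  have [measurable]: "defect \<theta> i (\<theta> powi k) \<in> borel_measurable borel" for i by (rule measurable_defect[OF d])
  have nn: "0 \<le> box_int (\<theta> powi k) (defect \<theta> i (\<theta> powi k)) x" for i
    unfolding box_int_def using defect_nonneg[OF d] by (intro integral_nonneg_AE) auto
  have "ennreal (\<Sum>i\<in>UNIV. box_int (\<theta> powi k) (defect \<theta> i (\<theta> powi k)) x)
      = (\<Sum>i\<in>UNIV. box_mass (\<theta> powi k) (\<lambda>y. ennreal (defect \<theta> i (\<theta> powi k) y)) x)"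
    using nn by (subst sum_ennreal[symmetric]) (auto simp: ennreal_box_int integrable_defect[OF d] defect_nonneg[OF d])
  also have "\<dots> = box_mass (\<theta> powi k) (defect_sum \<theta> (\<theta> powi k)) x"
    unfolding defect_sum_def[abs_def] by (rule box_mass_sum[symmetric]) simp
  finally show ?thesis .
qed

text \<open>After normalization by the power \<open>-\<beta>\<close> of the scale the recursion contracts by the assumption
  on \<open>\<theta>\<close>. Boundedness at large scales holds as all masses are at most \<open>2 * M\<close> per component and
  \<open>\<beta> \<ge> 0\<close>.\<close>

lemma iterated_recursion:
  "ennreal ((\<theta> powi k) powr - \<beta> * (\<Sum>i\<in>UNIV. box_int (\<theta> powi k) (\<lambda>y. \<bar>G i (\<theta> powi k) y\<bar>) x))
    \<le> (\<Sum>j. ennreal ((1/2)^j * (scale_recursion_const TYPE('n) * \<theta> powr - \<beta>) * (\<theta> powi (k - 1 - int j)) powr - \<beta>)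
        * box_mass (\<theta> powi (k - 1 - int j)) (defect_sum \<theta> (\<theta> powi (k - 1 - int j))) x)"
proof -
  define a where "a k = (\<Sum>i\<in>UNIV. box_int (\<theta> powi k) (\<lambda>y. \<bar>G i (\<theta> powi k) y\<bar>) x)" for k
  define \<delta> where "\<delta> k = (\<Sum>i\<in>UNIV. box_int (\<theta> powi k) (defect \<theta> i (\<theta> powi k)) x)" for k
  define g where "g k = (\<theta> powi k) powr - \<beta> * a k" for k
  have a0: "0 \<le> a k" for k unfolding a_def box_int_def by (intro sum_nonneg integral_nonneg_AE) auto
  have \<delta>0: "0 \<le> \<delta> k" for k
    unfolding \<delta>_def box_int_def using defect_nonneg[OF th0 theta_less_1 scale_pos]
    by (intro sum_nonneg integral_nonneg_AE) auto
  have rc: "0 < scale_recursion_const TYPE('n)" by (rule scale_recursion_const_pos)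
  have step: "g (k + 1) \<le> g k / 2 + (scale_recursion_const TYPE('n) * \<theta> powr - \<beta>) * ((\<theta> powi k) powr - \<beta> * \<delta> k)" for k
  proof -
    have "a (k + 1) \<le> scale_recursion_const TYPE('n) * (\<theta> * a k + \<delta> k)"
      using scale_recursion[OF th0 theta_less_1 scale_pos th1, of k x]
      unfolding a_def \<delta>_def scale_recursion_const_def scale_Suc by simp
    then have "g (k + 1) \<le> (\<theta> powi (k + 1)) powr - \<beta> * (scale_recursion_const TYPE('n) * (\<theta> * a k + \<delta> k))"
      unfolding g_def by (intro mult_left_mono) auto
    also have "(\<theta> powi (k + 1)) powr - \<beta> = \<theta> powr - \<beta> * (\<theta> powi k) powr - \<beta>"
      unfolding scale_Suc by (rule powr_mult)
    also have "\<theta> powr - \<beta> * (\<theta> powi k) powr - \<beta> * (scale_recursion_const TYPE('n) * (\<theta> * a k + \<delta> k))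
        = (scale_recursion_const TYPE('n) * (\<theta> powr - \<beta> * \<theta>)) * g k + (scale_recursion_const TYPE('n) * \<theta> powr - \<beta>) * ((\<theta> powi k) powr - \<beta> * \<delta> k)"
      by (simp add: g_def algebra_simps)
    also have "\<theta> powr - \<beta> * \<theta> = \<theta> powr (1 - \<beta>)"
      using th0 by (simp add: powr_diff powr_minus field_simps)
    also have "scale_recursion_const TYPE('n) * \<theta> powr (1 - \<beta>) * g k \<le> 1 / 2 * g k"
      using a0 by (intro mult_right_mono contraction) (auto simp: g_def)
    finally show ?thesis by simp
  qed
  have bounded: "g l \<le> (\<theta> powi k) powr - \<beta> * (2 * M * real CARD('n))" if "l \<le> k" for l
  proof -
    have "a l \<le> (\<Sum>i\<in>(UNIV :: 'n set). 2 * M)"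
      unfolding a_def
    proof (intro sum_mono)
      fix i
      have "box_int (\<theta> powi l) (\<lambda>y. \<bar>G i (\<theta> powi l) y\<bar>) x \<le> (\<integral>y. \<bar>G i (\<theta> powi l) y\<bar> \<partial>lborel)"
        unfolding box_int_def using scale_pos
        by (intro integral_mono integrable_box integrable_abs integrable_G) (auto simp: indicator_def)
      with G_L1[OF scale_pos, of i l] show "box_int (\<theta> powi l) (\<lambda>y. \<bar>G i (\<theta> powi l) y\<bar>) x \<le> 2 * M" by linarith
    qed
    then have "a l \<le> 2 * M * real CARD('n)" by (simp add: mult.commute)
    moreover have "(\<theta> powi l) powr - \<beta> \<le> (\<theta> powi k) powr - \<beta>"
    proof -
      have "(\<theta> powi k) powr \<beta> \<le> (\<theta> powi l) powr \<beta>"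
        using scale_mono[OF that] scale_pos[of k] \<beta> by (intro powr_mono2) auto
      moreover have "0 < (\<theta> powi k) powr \<beta>" using scale_pos[of k] th0 by simp
      ultimately show ?thesis unfolding powr_minus by (rule le_imp_inverse_le)
    qed
    ultimately show ?thesis unfolding g_def using a0 by (intro mult_mono) auto
  qed
  have "ennreal (g k) \<le> (\<Sum>j. ennreal ((1/2)^j * (scale_recursion_const TYPE('n) * \<theta> powr - \<beta>) * ((\<theta> powi (k - 1 - int j)) powr - \<beta> * \<delta> (k - 1 - int j))))"
    by (rule halving_recursion[where g = g and e = "\<lambda>k. (\<theta> powi k) powr - \<beta> * \<delta> k", OF step _ _ bounded])
       (use \<delta>0 rc in auto)
  also have "\<dots> = (\<Sum>j. ennreal ((1/2)^j * (scale_recursion_const TYPE('n) * \<theta> powr - \<beta>) * (\<theta> powi (k - 1 - int j)) powr - \<beta>)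
        * box_mass (\<theta> powi (k - 1 - int j)) (defect_sum \<theta> (\<theta> powi (k - 1 - int j))) x)"
    unfolding \<delta>_def box_mass_defect_sum[symmetric] using \<delta>0[unfolded \<delta>_def] rc
    by (subst ennreal_mult[symmetric]) (auto simp: mult.assoc)
  finally show ?thesis by (simp add: g_def a_def)
qed

text \<open>A width \<open>r\<close> between \<open>\<theta> powi k\<close> and \<open>\<theta> powi k / \<theta>\<close> is reached from the next smaller scale
  \<open>\<theta> powi (k + 1)\<close> by a Gaussian whose width \<open>t\<close> is comparable to \<open>\<theta> powi k\<close>; that Gaussian is
  dominated by a sum of indicators of boxes.\<close>

lemma abs_G_le_boxes:
  assumes r: "\<theta> powi k \<le> r" "r \<le> \<theta> powi k / \<theta>"
  shows "ennreal \<bar>G i r x\<bar> \<le> ennreal (2 ^ CARD('n) / (gauss_mass TYPE('n) * (\<theta> powi k) ^ CARD('n))) *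
    (\<Sum>l. ennreal (exp (- \<theta>\<^sup>2 * (real l)\<^sup>2)) * box_mass ((real l + 1) * \<theta> powi k) (\<lambda>z. ennreal \<bar>G i (\<theta> powi (k + 1)) z\<bar>) x)"
proof -
  define \<rho> where "\<rho> = \<theta> powi k"
  define Z where "Z = gauss_mass TYPE('n)"
  define K where "K = 2 ^ CARD('n) / (Z * \<rho> ^ CARD('n))"
  \<comment> \<open>a Gaussian of width \<open>t\<close> takes the width \<open>\<theta> * \<rho>\<close> to \<open>r\<close>\<close>
  define t where "t = sqrt (r\<^sup>2 - (\<theta> * \<rho>)\<^sup>2)"
  have \<rho>: "0 < \<rho>" unfolding \<rho>_def by (rule scale_pos)
  have Z: "0 < Z" unfolding Z_def by (rule gauss_mass_pos)
  have K: "0 < K" unfolding K_def using \<rho> Z by simp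
  have r\<rho>: "\<rho> \<le> r" "r \<le> \<rho> / \<theta>" using r by (auto simp: \<rho>_def)
  have "1 \<le> exp (3::real)" by simp
  then have "2 \<le> 32 * exp (3::real)" by linarith
  then have "1 / (32 * exp 3) \<le> 1 / (2 :: real)" by (intro divide_left_mono) auto
  then have half: "\<theta> \<le> 1 / 2" by (rule order.trans[OF th1])
  have "\<theta> * \<rho> \<le> 1 / 2 * \<rho>" using half \<rho> by (intro mult_right_mono) auto
  then have "(\<theta> * \<rho>)\<^sup>2 \<le> (1 / 2 * \<rho>)\<^sup>2" using th0 \<rho> by (intro power_mono) auto
  moreover have "\<rho>\<^sup>2 \<le> r\<^sup>2" using r\<rho> \<rho> by (intro power_mono) auto
  moreover have "(1 / 2 * \<rho>)\<^sup>2 = \<rho>\<^sup>2 / 4" "(\<rho> / 2)\<^sup>2 = \<rho>\<^sup>2 / 4"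
    by (simp_all add: power_mult_distrib power_divide)
  ultimately have low: "(\<rho> / 2)\<^sup>2 \<le> r\<^sup>2 - (\<theta> * \<rho>)\<^sup>2" using zero_le_power2[of \<rho>] by linarith
  then have t2: "t\<^sup>2 = r\<^sup>2 - (\<theta> * \<rho>)\<^sup>2"
    unfolding t_def by (intro real_sqrt_pow2 order.trans[OF zero_le_power2 low])
  have t_low: "\<rho> / 2 \<le> t" unfolding t_def using low \<rho> by (intro real_le_rsqrt)
  then have t: "0 < t" using \<rho> by linarith
  have tup: "t\<^sup>2 \<le> (\<rho> / \<theta>)\<^sup>2"
  proof -
    have "t\<^sup>2 \<le> r\<^sup>2" using t2 by simp
    also have "\<dots> \<le> (\<rho> / \<theta>)\<^sup>2" using r\<rho> \<rho> by (intro power_mono) auto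
    finally show ?thesis .
  qed
  have gle: "gauss t w \<le> K * exp (- \<theta>\<^sup>2 * (norm w)\<^sup>2 / \<rho>\<^sup>2)" for w :: "real ^ 'n"
  proof -
    have "\<theta>\<^sup>2 * (norm w)\<^sup>2 / \<rho>\<^sup>2 = (norm w)\<^sup>2 / (\<rho> / \<theta>)\<^sup>2" by (simp add: power_divide)
    also have "\<dots> \<le> (norm w)\<^sup>2 / t\<^sup>2" using tup t \<rho> th0 by (intro divide_left_mono mult_pos_pos) auto
    finally have "exp (- (norm w)\<^sup>2 / t\<^sup>2) \<le> exp (- \<theta>\<^sup>2 * (norm w)\<^sup>2 / \<rho>\<^sup>2)" by simp
    moreover have "1 / (Z * t ^ CARD('n)) \<le> K"
    proof -
      have "(\<rho> / 2) ^ CARD('n) \<le> t ^ CARD('n)" using t_low \<rho> by (intro power_mono) auto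
      then have "1 / (Z * t ^ CARD('n)) \<le> 1 / (Z * (\<rho> / 2) ^ CARD('n))"
        using Z \<rho> t by (intro divide_left_mono mult_left_mono mult_pos_pos) auto
      also have "\<dots> = K" using \<rho> by (simp add: K_def power_divide)
      finally show ?thesis .
    qed
    ultimately have "1 / (Z * t ^ CARD('n)) * exp (- (norm w)\<^sup>2 / t\<^sup>2) \<le> K * exp (- \<theta>\<^sup>2 * (norm w)\<^sup>2 / \<rho>\<^sup>2)"
      using K by (intro mult_mono) auto
    then show ?thesis by (simp add: gauss_def Z_def)
  qed
  have "0 < \<theta> * \<rho>" using th0 \<rho> by simp
  note conv = G_convolution[OF t this, where i = i and x = x]
  have "sqrt (t\<^sup>2 + (\<theta> * \<rho>)\<^sup>2) = r" unfolding t2 using r\<rho> \<rho> by simp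
  with conv have "G i r x = (\<integral>z. gauss t (x - z) * G i (\<theta> * \<rho>) z \<partial>lborel)" by simp
  then have "ennreal \<bar>G i r x\<bar> \<le> (\<integral>\<^sup>+z. ennreal \<bar>gauss t (x - z) * G i (\<theta> * \<rho>) z\<bar> \<partial>lborel)"
    using integral_norm_bound_ennreal[OF conv(2)] by simp
  also have "\<dots> \<le> (\<integral>\<^sup>+z. ennreal K * (\<Sum>l. ennreal (exp (- \<theta>\<^sup>2 * (real l)\<^sup>2)) *
      (ennreal \<bar>G i (\<theta> * \<rho>) z\<bar> * indicator (sup_box x ((real l + 1) * \<rho>)) z)) \<partial>lborel)"
  proof (intro nn_integral_mono)
    fix z
    have "\<bar>gauss t (x - z) * G i (\<theta> * \<rho>) z\<bar> \<le> K * exp (- \<theta>\<^sup>2 * (norm (x - z))\<^sup>2 / \<rho>\<^sup>2) * \<bar>G i (\<theta> * \<rho>) z\<bar>"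
      unfolding abs_mult using gle[of "x - z"] gauss_nonneg[OF t, of "x - z"] by (intro mult_right_mono) auto
    then have "ennreal \<bar>gauss t (x - z) * G i (\<theta> * \<rho>) z\<bar>
        \<le> ennreal K * (ennreal (exp (- \<theta>\<^sup>2 * (norm (x - z))\<^sup>2 / \<rho>\<^sup>2)) * ennreal \<bar>G i (\<theta> * \<rho>) z\<bar>)"
      using K by (simp add: ennreal_mult[symmetric] mult.assoc ennreal_leI)
    also have "\<dots> \<le> ennreal K * ((\<Sum>l. ennreal (exp (- \<theta>\<^sup>2 * (real l)\<^sup>2)) * indicator (sup_box x ((real l + 1) * \<rho>)) z) * ennreal \<bar>G i (\<theta> * \<rho>) z\<bar>)"
      by (intro mult_left_mono mult_right_mono exp_norm_le_boxes \<rho>) auto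
    finally show "ennreal \<bar>gauss t (x - z) * G i (\<theta> * \<rho>) z\<bar> \<le> ennreal K * (\<Sum>l. ennreal (exp (- \<theta>\<^sup>2 * (real l)\<^sup>2)) *
      (ennreal \<bar>G i (\<theta> * \<rho>) z\<bar> * indicator (sup_box x ((real l + 1) * \<rho>)) z))"
      by (simp add: ennreal_suminf_multc[symmetric] mult.assoc mult.commute[of "ennreal \<bar>G i (\<theta> * \<rho>) z\<bar>"])
  qed
  also have "\<dots> = ennreal K * (\<Sum>l. ennreal (exp (- \<theta>\<^sup>2 * (real l)\<^sup>2)) * box_mass ((real l + 1) * \<rho>) (\<lambda>z. ennreal \<bar>G i (\<theta> * \<rho>) z\<bar>) x)"
    unfolding box_mass_def by (subst nn_integral_cmult, measurable) (simp add: nn_integral_suminf nn_integral_cmult)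
  finally show ?thesis unfolding K_def Z_def \<rho>_def scale_Suc .
qed

text \<open>The contribution of the widths near \<open>\<theta> powi k\<close>: the index \<open>l\<close> stands for the shells of the
  Gaussian, \<open>j\<close> for the number of steps of the recursion to larger scales.\<close>

definition scale_sum :: "int \<Rightarrow> real ^ 'n \<Rightarrow> ennreal" where
  "scale_sum k x = (\<Sum>l. \<Sum>j. ennreal (exp (- \<theta>\<^sup>2 * (real l)\<^sup>2) * (real l + 2) ^ CARD('n) * (1/2) ^ j) *
     (ennreal ((\<theta> powi (k - int j)) powr - \<beta>) *
       box_mass ((real l + 3) * \<theta> powi (k - int j)) (defect_sum \<theta> (\<theta> powi (k - int j))) x))"

text \<open>A large box mass is averaged over boxes of radius \<open>\<theta> powi (k + 1)\<close>, and \<open>iterated_recursion\<close>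
  is applied at each centre \<open>w\<close>. The boxes that occur there are contained in boxes around \<open>x\<close>, as
  all scales in the recursion are at least \<open>\<theta> powi k\<close>.\<close>

lemma box_mass_abs_G_le:
  fixes k :: int and l :: nat and x :: "real ^ 'n"
  defines "g \<equiv> \<lambda>z. \<Sum>i\<in>UNIV. ennreal \<bar>G i (\<theta> powi (k + 1)) z\<bar>"
  shows "box_mass ((real l + 1) * \<theta> powi k) g x \<le>
    ennreal (scale_recursion_const TYPE('n) / \<theta> ^ CARD('n) * (\<theta> powi k) powr \<beta>) *
    (\<Sum>j. ennreal ((real l + 2) ^ CARD('n) * (1/2) ^ j) * (ennreal ((\<theta> powi (k - int j)) powr - \<beta>) *
       box_mass ((real l + 3) * \<theta> powi (k - int j)) (defect_sum \<theta> (\<theta> powi (k - int j))) x))"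
proof -
  define \<rho> where "\<rho> = \<theta> powi k"
  define d where "d = CARD('n)"
  define Y where "Y = (\<Sum>j. ennreal ((1/2) ^ j) * (ennreal ((\<theta> powi (k - int j)) powr - \<beta>) *
       box_mass ((real l + 3) * \<theta> powi (k - int j)) (defect_sum \<theta> (\<theta> powi (k - int j))) x))"
  have \<rho>: "0 < \<rho>" unfolding \<rho>_def by (rule scale_pos)
  have rc: "0 < scale_recursion_const TYPE('n)" by (rule scale_recursion_const_pos)
  have \<rho>1: "\<theta> powi (k + 1) = \<theta> * \<rho>" by (simp add: scale_Suc \<rho>_def)
  have g [measurable]: "g \<in> borel_measurable borel" unfolding g_def by measurable
  have pt: "box_mass (\<theta> * \<rho>) g w \<le> ennreal (scale_recursion_const TYPE('n) * \<rho> powr \<beta>) * Y" if w: "w \<in> sup_box x ((real l + 2) * \<rho>)" for w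
  proof -
    define a where "a = (\<Sum>i\<in>UNIV. box_int (\<theta> powi (k + 1)) (\<lambda>y. \<bar>G i (\<theta> powi (k + 1)) y\<bar>) w)"
    have a0: "0 \<le> a" unfolding a_def box_int_def by (intro sum_nonneg integral_nonneg_AE) auto
    have "box_mass (\<theta> * \<rho>) g w = ennreal a"
    proof -
      have "0 \<le> box_int (\<theta> powi (k + 1)) (\<lambda>y. \<bar>G i (\<theta> powi (k + 1)) y\<bar>) w" for i
        unfolding box_int_def by (intro integral_nonneg_AE) auto
      then have "ennreal a = (\<Sum>i\<in>UNIV. box_mass (\<theta> powi (k + 1)) (\<lambda>y. ennreal \<bar>G i (\<theta> powi (k + 1)) y\<bar>) w)"
        unfolding a_def by (subst sum_ennreal[symmetric]) (auto simp: ennreal_box_int integrable_abs integrable_G[OF scale_pos])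
      also have "\<dots> = box_mass (\<theta> * \<rho>) g w"
        unfolding g_def \<rho>1 by (rule box_mass_sum[symmetric]) simp
      finally show ?thesis ..
    qed
    also have "ennreal a = ennreal ((\<theta> * \<rho>) powr \<beta>) * ennreal ((\<theta> * \<rho>) powr - \<beta> * a)"
      using th0 \<rho> a0 by (simp add: ennreal_mult[symmetric] powr_minus field_simps)
    also have "ennreal ((\<theta> * \<rho>) powr - \<beta> * a) \<le> (\<Sum>j. ennreal ((1/2)^j * (scale_recursion_const TYPE('n) * \<theta> powr - \<beta>) * (\<theta> powi (k + 1 - 1 - int j)) powr - \<beta>)
        * box_mass (\<theta> powi (k + 1 - 1 - int j)) (defect_sum \<theta> (\<theta> powi (k + 1 - 1 - int j))) w)"
      using iterated_recursion[of "k + 1" w] unfolding a_def \<rho>1 .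
    also have "\<dots> \<le> (\<Sum>j. ennreal (scale_recursion_const TYPE('n) * \<theta> powr - \<beta>) * (ennreal ((1/2) ^ j) * (ennreal ((\<theta> powi (k - int j)) powr - \<beta>) *
       box_mass ((real l + 3) * \<theta> powi (k - int j)) (defect_sum \<theta> (\<theta> powi (k - int j))) x)))"
    proof (intro suminf_le)
      fix j
      have "\<rho> \<le> \<theta> powi (k - int j)" unfolding \<rho>_def by (intro scale_mono) simp
      then have "(real l + 2) * \<rho> + \<theta> powi (k - int j) \<le> (real l + 2) * \<theta> powi (k - int j) + \<theta> powi (k - int j)"
        by (intro add_right_mono mult_left_mono) auto
      also have "\<dots> = (real l + 3) * \<theta> powi (k - int j)" by (simp add: algebra_simps)
      finally have "sup_box w (\<theta> powi (k - int j)) \<subseteq> sup_box x ((real l + 3) * \<theta> powi (k - int j))"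
        using sup_box_trans[OF _ w] sup_box_mono by blast
      then have "box_mass (\<theta> powi (k - int j)) (defect_sum \<theta> (\<theta> powi (k - int j))) w
          \<le> box_mass ((real l + 3) * \<theta> powi (k - int j)) (defect_sum \<theta> (\<theta> powi (k - int j))) x"
        by (rule box_mass_mono)
      moreover have "ennreal ((1/2)^j * (scale_recursion_const TYPE('n) * \<theta> powr - \<beta>) * (\<theta> powi (k - int j)) powr - \<beta>)
        = ennreal (scale_recursion_const TYPE('n) * \<theta> powr - \<beta>) * ennreal ((1/2) ^ j) * ennreal ((\<theta> powi (k - int j)) powr - \<beta>)"
        using rc by (simp add: ennreal_mult[symmetric] ac_simps)
      ultimately show "ennreal ((1/2)^j * (scale_recursion_const TYPE('n) * \<theta> powr - \<beta>) * (\<theta> powi (k + 1 - 1 - int j)) powr - \<beta>)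
          * box_mass (\<theta> powi (k + 1 - 1 - int j)) (defect_sum \<theta> (\<theta> powi (k + 1 - 1 - int j))) w
        \<le> ennreal (scale_recursion_const TYPE('n) * \<theta> powr - \<beta>) * (ennreal ((1/2) ^ j) * (ennreal ((\<theta> powi (k - int j)) powr - \<beta>) *
       box_mass ((real l + 3) * \<theta> powi (k - int j)) (defect_sum \<theta> (\<theta> powi (k - int j))) x))"
        by (simp add: mult.assoc mult_left_mono)
    qed auto
    also have "\<dots> = ennreal (scale_recursion_const TYPE('n) * \<theta> powr - \<beta>) * Y" unfolding Y_def by (simp add: ennreal_suminf_cmult)
    finally have "box_mass (\<theta> * \<rho>) g w \<le> ennreal ((\<theta> * \<rho>) powr \<beta>) * (ennreal (scale_recursion_const TYPE('n) * \<theta> powr - \<beta>) * Y)"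
      by (simp add: mult_left_mono)
    also have "\<dots> = ennreal ((\<theta> * \<rho>) powr \<beta> * (scale_recursion_const TYPE('n) * \<theta> powr - \<beta>)) * Y"
      using rc by (simp add: ennreal_mult[symmetric] mult.assoc[symmetric])
    also have "(\<theta> * \<rho>) powr \<beta> * (scale_recursion_const TYPE('n) * \<theta> powr - \<beta>) = scale_recursion_const TYPE('n) * \<rho> powr \<beta>"
      using th0 \<rho> by (simp add: powr_mult powr_minus field_simps)
    finally show ?thesis .
  qed
  have "0 < \<theta> * \<rho>" using th0 \<rho> by simp
  from box_mass_spread[OF g this, of "(real l + 1) * \<rho>" x]
  have "box_mass ((real l + 1) * \<rho>) g x
      \<le> ennreal (1 / (2 * (\<theta> * \<rho>)) ^ d) * (\<integral>\<^sup>+w\<in>sup_box x ((real l + 1) * \<rho> + \<theta> * \<rho>). box_mass (\<theta> * \<rho>) g w \<partial>lborel)"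
    unfolding d_def .
  also have "\<dots> \<le> ennreal (1 / (2 * (\<theta> * \<rho>)) ^ d) * (\<integral>\<^sup>+w. (ennreal (scale_recursion_const TYPE('n) * \<rho> powr \<beta>) * Y) * indicator (sup_box x ((real l + 2) * \<rho>)) w \<partial>lborel)"
  proof (intro mult_left_mono nn_integral_mono)
    fix w
    have "\<theta> * \<rho> \<le> 1 * \<rho>" using theta_less_1 \<rho> by (intro mult_right_mono) auto
    then have "sup_box x ((real l + 1) * \<rho> + \<theta> * \<rho>) \<subseteq> sup_box x ((real l + 2) * \<rho>)"
      by (intro sup_box_mono) (simp add: algebra_simps)
    then show "box_mass (\<theta> * \<rho>) g w * indicator (sup_box x ((real l + 1) * \<rho> + \<theta> * \<rho>)) w
        \<le> (ennreal (scale_recursion_const TYPE('n) * \<rho> powr \<beta>) * Y) * indicator (sup_box x ((real l + 2) * \<rho>)) w"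
      using pt[of w] by (auto simp: indicator_def)
  qed auto
  also have "\<dots> = ennreal (1 / (2 * (\<theta> * \<rho>)) ^ d) * (ennreal (scale_recursion_const TYPE('n) * \<rho> powr \<beta>) * Y * ennreal ((2 * ((real l + 2) * \<rho>)) ^ d))"
    using \<rho> by (subst nn_integral_cmult_indicator) (auto simp: emeasure_sup_box d_def)
  also have "\<dots> = ennreal (1 / (2 * (\<theta> * \<rho>)) ^ d * (scale_recursion_const TYPE('n) * \<rho> powr \<beta>) * (2 * ((real l + 2) * \<rho>)) ^ d) * Y"
    using th0 \<rho> rc by (intro ennreal_mult_assoc3) auto
  also have "1 / (2 * (\<theta> * \<rho>)) ^ d * (scale_recursion_const TYPE('n) * \<rho> powr \<beta>) * (2 * ((real l + 2) * \<rho>)) ^ d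
      = (scale_recursion_const TYPE('n) / \<theta> ^ d * \<rho> powr \<beta>) * (real l + 2) ^ d"
    unfolding power_mult_distrib using th0 \<rho> by (simp add: field_simps)
  also have "ennreal ((scale_recursion_const TYPE('n) / \<theta> ^ d * \<rho> powr \<beta>) * (real l + 2) ^ d) * Y
    = ennreal (scale_recursion_const TYPE('n) / \<theta> ^ d * \<rho> powr \<beta>) * (ennreal ((real l + 2) ^ d) * Y)"
    using th0 rc by (intro ennreal_mult_assoc2) auto
  also have "ennreal ((real l + 2) ^ d) * Y = (\<Sum>j. ennreal ((real l + 2) ^ d * (1/2) ^ j) * (ennreal ((\<theta> powi (k - int j)) powr - \<beta>) *
       box_mass ((real l + 3) * \<theta> powi (k - int j)) (defect_sum \<theta> (\<theta> powi (k - int j))) x))"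
    unfolding Y_def by (subst ennreal_suminf_cmult[symmetric]) (simp add: ennreal_mult mult.assoc)
  finally show ?thesis unfolding \<rho>_def d_def .
qed

lemma sum_abs_G_le:
  assumes r: "\<theta> powi k \<le> r" "r \<le> \<theta> powi k / \<theta>"
  shows "(\<Sum>i\<in>UNIV. ennreal \<bar>G i r x\<bar>) \<le>
    ennreal (2 ^ CARD('n) * scale_recursion_const TYPE('n) / (gauss_mass TYPE('n) * \<theta> ^ CARD('n)) * (\<theta> powi k) powr (\<beta> - real CARD('n))) * scale_sum k x"
proof -
  define \<rho> where "\<rho> = \<theta> powi k"
  define d where "d = CARD('n)"
  define Z where "Z = gauss_mass TYPE('n)"
  define K where "K = 2 ^ d / (Z * \<rho> ^ d)"
  define K' where "K' = scale_recursion_const TYPE('n) / \<theta> ^ d * \<rho> powr \<beta>"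
  have \<rho>: "0 < \<rho>" unfolding \<rho>_def by (rule scale_pos)
  have Z: "0 < Z" unfolding Z_def by (rule gauss_mass_pos)
  have K: "0 \<le> K" "0 \<le> K'" unfolding K_def K'_def using \<rho> Z scale_recursion_const_pos[where 'n = 'n] th0 by auto
  define g where "g z = (\<Sum>i\<in>UNIV. ennreal \<bar>G i (\<theta> powi (k + 1)) z\<bar>)" for z
  define e where "e l = exp (- \<theta>\<^sup>2 * (real l)\<^sup>2)" for l :: nat
  have "(\<Sum>i\<in>UNIV. ennreal \<bar>G i r x\<bar>) \<le> (\<Sum>i\<in>UNIV. ennreal K * (\<Sum>l. ennreal (e l) * box_mass ((real l + 1) * \<rho>) (\<lambda>z. ennreal \<bar>G i (\<theta> powi (k + 1)) z\<bar>) x))"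
    unfolding K_def Z_def d_def \<rho>_def e_def by (intro sum_mono abs_G_le_boxes r)
  also have "\<dots> = ennreal K * (\<Sum>l. ennreal (e l) * box_mass ((real l + 1) * \<rho>) g x)"
  proof -
    have "box_mass ((real l + 1) * \<rho>) g x = (\<Sum>i\<in>UNIV. box_mass ((real l + 1) * \<rho>) (\<lambda>z. ennreal \<bar>G i (\<theta> powi (k + 1)) z\<bar>) x)" for l
      unfolding g_def[abs_def] by (rule box_mass_sum) simp
    then have "(\<Sum>l. ennreal (e l) * box_mass ((real l + 1) * \<rho>) g x)
        = (\<Sum>l. \<Sum>i\<in>UNIV. ennreal (e l) * box_mass ((real l + 1) * \<rho>) (\<lambda>z. ennreal \<bar>G i (\<theta> powi (k + 1)) z\<bar>) x)"
      by (simp add: sum_distrib_left)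
    also have "\<dots> = (\<Sum>i\<in>UNIV. \<Sum>l. ennreal (e l) * box_mass ((real l + 1) * \<rho>) (\<lambda>z. ennreal \<bar>G i (\<theta> powi (k + 1)) z\<bar>) x)"
      by (rule suminf_sum) simp
    finally show ?thesis by (simp only: sum_distrib_left)
  qed
  also have "\<dots> \<le> ennreal K * (\<Sum>l. ennreal (e l) * (ennreal K' * (\<Sum>j. ennreal ((real l + 2) ^ d * (1/2) ^ j) * (ennreal ((\<theta> powi (k - int j)) powr - \<beta>) *
       box_mass ((real l + 3) * \<theta> powi (k - int j)) (defect_sum \<theta> (\<theta> powi (k - int j))) x))))"
    unfolding K'_def g_def[abs_def] \<rho>_def d_def by (intro mult_left_mono suminf_le box_mass_abs_G_le) auto
  also have "\<dots> = ennreal K * (ennreal K' * scale_sum k x)"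
  proof -
    have "ennreal (e l) * (ennreal K' * (\<Sum>j. ennreal ((real l + 2) ^ d * (1/2) ^ j) * X j))
        = ennreal K' * (\<Sum>j. ennreal (e l * (real l + 2) ^ d * (1/2) ^ j) * X j)" for l :: nat and X
    proof -
      have "ennreal (e l) * (ennreal K' * (\<Sum>j. ennreal ((real l + 2) ^ d * (1/2) ^ j) * X j))
        = ennreal K' * (\<Sum>j. ennreal (e l) * (ennreal ((real l + 2) ^ d * (1/2) ^ j) * X j))"
        by (simp add: ennreal_suminf_cmult mult.left_commute)
      also have "\<dots> = ennreal K' * (\<Sum>j. ennreal (e l * (real l + 2) ^ d * (1/2) ^ j) * X j)"
        by (simp add: ennreal_mult e_def mult.assoc)
      finally show ?thesis .
    qed
    then show ?thesis by (simp add: scale_sum_def e_def d_def ennreal_suminf_cmult)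
  qed
  also have "\<dots> = ennreal (K * K') * scale_sum k x" using K by (simp add: ennreal_mult mult.assoc)
  also have "K * K' = 2 ^ d * scale_recursion_const TYPE('n) / (Z * \<theta> ^ d) * \<rho> powr (\<beta> - real d)"
    using \<rho> Z th0 by (simp add: K_def K'_def powr_diff powr_realpow field_simps)
  finally show ?thesis by (simp add: \<rho>_def d_def Z_def)
qed

text \<open>The intervals \<open>[\<theta> powi k, \<theta> powi k / \<theta>]\<close> cover the half-line. On each of them the weight
  integrates to the power \<open>d - \<beta>\<close> of the scale, which cancels the power \<open>\<beta> - d\<close> from \<open>sum_abs_G_le\<close>.\<close>

lemma integral_scales:
  defines "C4 \<equiv> 2 ^ CARD('n) * scale_recursion_const TYPE('n) / (gauss_mass TYPE('n) * \<theta> ^ CARD('n)) * \<theta> powr (\<beta> - real CARD('n) - 1)"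
  shows "(\<integral>\<^sup>+r\<in>{0<..}. ennreal (r powr (real CARD('n) - \<beta> - 1)) * (\<Sum>i\<in>UNIV. ennreal \<bar>G i r x\<bar>) \<partial>lborel)
    \<le> ennreal C4 * (\<Sum>n. scale_sum (int_decode n) x)"
proof -
  define d where "d = real CARD('n)"
  define C3 where "C3 = 2 ^ CARD('n) * scale_recursion_const TYPE('n) / (gauss_mass TYPE('n) * \<theta> ^ CARD('n))"
  define \<rho> where "\<rho> n = \<theta> powi (int_decode n)" for n
  define K where "K n = (\<rho> n / \<theta>) powr (d - \<beta>) / \<rho> n * (C3 * \<rho> n powr (\<beta> - d))" for n
  have \<rho>: "0 < \<rho> n" for n unfolding \<rho>_def by (rule scale_pos)
  have d1: "1 \<le> d" by (simp add: d_def Suc_leI)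
  have C3: "0 \<le> C3"
    unfolding C3_def using scale_recursion_const_pos[where 'n = 'n] gauss_mass_pos[where 'n = 'n] th0 by (intro divide_nonneg_nonneg) auto
  have K0: "0 \<le> K n" for n unfolding K_def using \<rho>[of n] C3 by simp
  have pt: "ennreal (r powr (d - \<beta> - 1)) * (\<Sum>i\<in>UNIV. ennreal \<bar>G i r x\<bar>) \<le> ennreal (K n) * scale_sum (int_decode n) x"
    if r: "r \<in> {\<rho> n..\<rho> n / \<theta>}" for r n
  proof -
    have r0: "0 < r" using r \<rho>[of n] by (auto simp: less_le_trans)
    have "r powr (d - \<beta> - 1) = r powr (d - \<beta>) / r" using r0 by (simp add: powr_diff)
    also have "\<dots> \<le> (\<rho> n / \<theta>) powr (d - \<beta>) / \<rho> n"
      using r r0 \<rho>[of n] d1 \<beta> by (intro frac_le powr_mono2) auto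
    finally have "ennreal (r powr (d - \<beta> - 1)) * (\<Sum>i\<in>UNIV. ennreal \<bar>G i r x\<bar>)
      \<le> ennreal ((\<rho> n / \<theta>) powr (d - \<beta>) / \<rho> n) * (ennreal (C3 * \<rho> n powr (\<beta> - d)) * scale_sum (int_decode n) x)"
      using r sum_abs_G_le[of "int_decode n" r x] unfolding \<rho>_def d_def C3_def
      by (intro mult_mono ennreal_leI) auto
    also have "\<dots> = ennreal (K n) * scale_sum (int_decode n) x"
      unfolding K_def using \<rho>[of n] C3 by (intro ennreal_mult_assoc2[symmetric]) auto
    finally show ?thesis .
  qed
  have cover: "\<exists>n. r \<in> {\<rho> n..\<rho> n / \<theta>}" if r: "0 < r" for r
  proof -
    define k where "k = \<lceil>ln r / ln \<theta>\<rceil>"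
    have lt: "ln \<theta> < 0" using th0 theta_less_1 by simp
    have pw: "\<theta> powi k = exp (real_of_int k * ln \<theta>)"
      using th0 by (simp add: powr_real_of_int'[symmetric] powr_def)
    have "ln r / ln \<theta> \<le> real_of_int k" "real_of_int k \<le> ln r / ln \<theta> + 1" unfolding k_def by linarith+
    then have "real_of_int k * ln \<theta> \<le> ln r" "ln r + ln \<theta> \<le> real_of_int k * ln \<theta>"
      using lt by (auto simp: field_simps)
    then have "exp (real_of_int k * ln \<theta>) \<le> exp (ln r)" "exp (ln r + ln \<theta>) \<le> exp (real_of_int k * ln \<theta>)" by simp_all
    then have "\<theta> powi k \<le> r" "r * \<theta> \<le> \<theta> powi k" using r th0 by (simp_all add: pw exp_add)
    then have "r \<in> {\<rho> (int_encode k)..\<rho> (int_encode k) / \<theta>}" using th0 by (simp add: \<rho>_def field_simps)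
    then show ?thesis ..
  qed
  have "(\<integral>\<^sup>+r\<in>{0<..}. ennreal (r powr (d - \<beta> - 1)) * (\<Sum>i\<in>UNIV. ennreal \<bar>G i r x\<bar>) \<partial>lborel)
    \<le> (\<integral>\<^sup>+r. (\<Sum>n. ennreal (K n) * scale_sum (int_decode n) x * indicator {\<rho> n..\<rho> n / \<theta>} r) \<partial>lborel)"
  proof (intro nn_integral_mono)
    fix r :: real
    show "ennreal (r powr (d - \<beta> - 1)) * (\<Sum>i\<in>UNIV. ennreal \<bar>G i r x\<bar>) * indicator {0<..} r
      \<le> (\<Sum>n. ennreal (K n) * scale_sum (int_decode n) x * indicator {\<rho> n..\<rho> n / \<theta>} r)"
    proof (cases "0 < r")
      case True
      then obtain n where n: "r \<in> {\<rho> n..\<rho> n / \<theta>}" using cover by auto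
      have "ennreal (r powr (d - \<beta> - 1)) * (\<Sum>i\<in>UNIV. ennreal \<bar>G i r x\<bar>) * indicator {0<..} r
          \<le> ennreal (K n) * scale_sum (int_decode n) x * indicator {\<rho> n..\<rho> n / \<theta>} r"
        using pt[OF n] n True by simp
      also have "\<dots> \<le> (\<Sum>n. ennreal (K n) * scale_sum (int_decode n) x * indicator {\<rho> n..\<rho> n / \<theta>} r)"
        by (rule term_le_suminf)
      finally show ?thesis .
    qed simp
  qed
  also have "\<dots> = (\<Sum>n. ennreal (K n) * scale_sum (int_decode n) x * ennreal (\<rho> n / \<theta> - \<rho> n))"
  proof (subst nn_integral_suminf)
    have "(\<integral>\<^sup>+r. ennreal (K n) * scale_sum (int_decode n) x * indicator {\<rho> n..\<rho> n / \<theta>} r \<partial>lborel)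
        = ennreal (K n) * scale_sum (int_decode n) x * ennreal (\<rho> n / \<theta> - \<rho> n)" for n
    proof -
      have "\<rho> n \<le> \<rho> n / \<theta>" using \<rho>[of n] th0 theta_less_1 by (simp add: field_simps)
      then show ?thesis by (subst nn_integral_cmult_indicator) auto
    qed
    then show "(\<Sum>n. \<integral>\<^sup>+r. ennreal (K n) * scale_sum (int_decode n) x * indicator {\<rho> n..\<rho> n / \<theta>} r \<partial>lborel)
        = (\<Sum>n. ennreal (K n) * scale_sum (int_decode n) x * ennreal (\<rho> n / \<theta> - \<rho> n))" by simp
  qed simp
  also have "\<dots> \<le> (\<Sum>n. ennreal C4 * scale_sum (int_decode n) x)"
  proof (intro suminf_le)
    fix n
    have "K n * (\<rho> n / \<theta> - \<rho> n) \<le> K n * (\<rho> n / \<theta>)"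
      using K0[of n] \<rho>[of n] by (intro mult_left_mono) auto
    also have "\<dots> = C4"
    proof -
      have "(\<rho> n / \<theta>) powr (d - \<beta>) = \<rho> n powr (d - \<beta>) * \<theta> powr (\<beta> - d)"
        using \<rho>[of n] th0 by (simp add: powr_divide powr_diff)
      moreover have "\<theta> powr (\<beta> - d - 1) = \<theta> powr (\<beta> - d) / \<theta>" using th0 by (simp add: powr_diff)
      moreover have "\<rho> n powr (d - \<beta>) * \<rho> n powr (\<beta> - d) = 1" using \<rho>[of n] by (simp add: powr_add[symmetric])
      moreover have "C4 = C3 * \<theta> powr (\<beta> - d - 1)" by (simp add: C4_def C3_def d_def)
      ultimately show ?thesis
        using \<rho>[of n] th0 by (simp add: K_def)
    qed
    finally have "ennreal (K n * (\<rho> n / \<theta> - \<rho> n)) \<le> ennreal C4" by (rule ennreal_leI)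
    moreover have "0 \<le> \<rho> n / \<theta> - \<rho> n" using \<rho>[of n] th0 theta_less_1 by (simp add: field_simps)
    ultimately have "ennreal (K n) * ennreal (\<rho> n / \<theta> - \<rho> n) \<le> ennreal C4"
      using K0[of n] by (simp add: ennreal_mult)
    from mult_right_mono[OF this, of "scale_sum (int_decode n) x"]
    show "ennreal (K n) * scale_sum (int_decode n) x * ennreal (\<rho> n / \<theta> - \<rho> n) \<le> ennreal C4 * scale_sum (int_decode n) x"
      by (simp add: ac_simps)
  qed auto
  finally show ?thesis by (simp add: d_def ennreal_suminf_cmult)
qed

lemma measurable_scale_sum [measurable]: "scale_sum k \<in> borel_measurable borel"
  unfolding scale_sum_def[abs_def] by measurable

lemma average_scale_sum:
  assumes r: "0 < r"
  defines "C \<equiv> averaging_const TYPE('n)"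
  shows "(\<integral>\<^sup>+y\<in>ball x r. scale_sum k y \<partial>lborel) / emeasure lborel (ball x r) \<le>
    (\<Sum>l. \<Sum>j. ennreal (exp (- \<theta>\<^sup>2 * (real l)\<^sup>2) * (real l + 2) ^ CARD('n) * (1/2) ^ j) *
     (ennreal ((\<theta> powi (k - int j)) powr - \<beta>) *
       (\<Sum>p. ennreal (C * (1/2) ^ (p * CARD('n))) *
          box_mass (2 ^ (p + 2) * ((real l + 3) * \<theta> powi (k - int j))) (defect_sum \<theta> (\<theta> powi (k - int j))) x)))"
proof -
  define v where "v = inverse (emeasure lborel (ball x r))"
  have [measurable]: "ball x r \<in> sets borel" by simp
  define a where "a l j = ennreal (exp (- \<theta>\<^sup>2 * (real l)\<^sup>2) * (real l + 2) ^ CARD('n) * (1/2) ^ j)" for l j :: nat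
  define b where "b j = ennreal ((\<theta> powi (k - int j)) powr - \<beta>)" for j
  define T where "T l j = box_mass ((real l + 3) * \<theta> powi (k - int j)) (defect_sum \<theta> (\<theta> powi (k - int j)))" for l j
  have [measurable]: "T l j \<in> borel_measurable borel" for l j unfolding T_def by measurable
  have "(\<integral>\<^sup>+y\<in>ball x r. scale_sum k y \<partial>lborel) = (\<integral>\<^sup>+y. (\<Sum>l. \<Sum>j. a l j * (b j * (T l j y * indicator (ball x r) y))) \<partial>lborel)"
    unfolding scale_sum_def a_def[symmetric] b_def[symmetric] T_def[symmetric]
    by (intro nn_integral_cong) (simp add: ennreal_suminf_multc[symmetric] mult.assoc)
  also have "\<dots> = (\<Sum>l. \<Sum>j. a l j * (b j * (\<integral>\<^sup>+y\<in>ball x r. T l j y \<partial>lborel)))"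
    by (simp add: nn_integral_suminf nn_integral_cmult)
  finally have "(\<integral>\<^sup>+y\<in>ball x r. scale_sum k y \<partial>lborel) / emeasure lborel (ball x r)
      = (\<Sum>l. \<Sum>j. a l j * (b j * ((\<integral>\<^sup>+y\<in>ball x r. T l j y \<partial>lborel) / emeasure lborel (ball x r))))"
    by (simp add: divide_ennreal_def ennreal_suminf_multc[symmetric] mult.assoc)
  also have "\<dots> \<le> (\<Sum>l. \<Sum>j. a l j * (b j * (\<Sum>p. ennreal (C * (1/2) ^ (p * CARD('n))) *
          box_mass (2 ^ (p + 2) * ((real l + 3) * \<theta> powi (k - int j))) (defect_sum \<theta> (\<theta> powi (k - int j))) x)))"
    unfolding T_def C_def using r scale_pos by (intro suminf_le mult_left_mono average_box_mass_le) (auto intro!: mult_pos_pos add_nonneg_pos)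
  finally show ?thesis unfolding a_def b_def .
qed

text \<open>The cost of a box mass of radius \<open>2 ^ (p + 2) * (l + 3) * \<rho>\<close> carries the power \<open>\<beta>\<close> of this
  radius, where \<open>\<rho>\<close> is the scale of the defect. The factor \<open>\<rho> powr \<beta>\<close> cancels the normalization
  \<open>\<rho> powr - \<beta>\<close>. The factor \<open>2 powr (p * \<beta>)\<close> is beaten by the weight \<open>(1/2) ^ (p * d)\<close> of the
  average, since \<open>\<beta> < 1 \<le> d\<close>. The sum over \<open>l\<close> converges by the Gaussian weights, the one over \<open>j\<close>
  geometrically, and the one over the scales telescopes.\<close>

lemma atomic_bound_maximal:
  fixes A :: real and f :: "real ^ 'n \<Rightarrow> 'b::real_normed_vector"
  assumes A: "0 \<le> A"
    and f: "\<And>y. ennreal (norm (f y)) \<le> ennreal A * (\<Sum>n. scale_sum (int_decode n) y)"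
  defines "E \<equiv> (\<Sum>l. exp (- \<theta>\<^sup>2 * (real l)\<^sup>2) * (real l + 2) ^ CARD('n) * (real l + 3))"
    and "K1 \<equiv> averaging_const TYPE('n) * (3 ^ CARD('n) * (2 * real CARD('n)) powr \<beta> * 4) / (1 - 2 powr (\<beta> - 1))"
  shows "atomic_bound \<beta> (maximal_function f) (ennreal (A * (K1 * E * 2 * (2 * M * real CARD('n)))))"
proof -
  define C where "C = averaging_const TYPE('n)"
  have C: "0 < C" unfolding C_def by (rule averaging_const_pos)
  define e where "e l = exp (- \<theta>\<^sup>2 * (real l)\<^sup>2) * (real l + 2) ^ CARD('n)" for l :: nat
  define q where "q = 2 powr (\<beta> - 1)"
  define K where "K = C * (3 ^ CARD('n) * (2 * real CARD('n)) powr \<beta> * 4)"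
  define I where "I n j = (\<integral>\<^sup>+y. defect_sum \<theta> (\<theta> powi (int_decode n - int j)) y \<partial>lborel)" for n j :: nat
  define W where "W n l j p x = box_mass (2 ^ (p + 2) * ((real l + 3) * \<theta> powi (int_decode n - int j)))
      (defect_sum \<theta> (\<theta> powi (int_decode n - int j))) x" for n l j p :: nat and x
  define S where "S x = (\<Sum>n. \<Sum>l. \<Sum>j. ennreal (e l * (1/2) ^ j) * (ennreal ((\<theta> powi (int_decode n - int j)) powr - \<beta>) *
       (\<Sum>p. ennreal (C * (1/2) ^ (p * CARD('n))) * W n l j p x)))" for x
  have q: "0 < q" "q < 1" using \<beta> by (auto simp: q_def powr_less_one)
  have K1_eq: "K1 = K / (1 - q)" unfolding K1_def K_def q_def C_def ..
  have K0: "0 \<le> K" using C by (simp add: K_def)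
  have e0: "0 \<le> e l" for l by (simp add: e_def)
  have dom: "maximal_function f x \<le> ennreal A * S x" for x
    unfolding maximal_function_def
  proof (rule SUP_least)
    fix r :: real assume "r \<in> {0<..}"
    then have r: "0 < r" by simp
    have [measurable]: "ball x r \<in> sets borel" by simp
    have "(\<integral>\<^sup>+y\<in>ball x r. ennreal (norm (f y)) \<partial>lborel)
        \<le> (\<integral>\<^sup>+y. ennreal A * (\<Sum>n. scale_sum (int_decode n) y * indicator (ball x r) y) \<partial>lborel)"
      using f by (intro nn_integral_mono) (auto simp: indicator_def)
    also have "\<dots> = ennreal A * (\<Sum>n. \<integral>\<^sup>+y\<in>ball x r. scale_sum (int_decode n) y \<partial>lborel)"
    proof -
      have m: "(\<lambda>y. scale_sum (int_decode n) y * indicator (ball x r) y) \<in> borel_measurable lborel" for n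
        by measurable
      show ?thesis unfolding nn_integral_suminf[OF m, symmetric] by (rule nn_integral_cmult) measurable
    qed
    finally have "(\<integral>\<^sup>+y\<in>ball x r. ennreal (norm (f y)) \<partial>lborel) / emeasure lborel (ball x r)
      \<le> ennreal A * (\<Sum>n. \<integral>\<^sup>+y\<in>ball x r. scale_sum (int_decode n) y \<partial>lborel) / emeasure lborel (ball x r)"
      by (rule divide_right_mono_ennreal)
    also have "\<dots> = ennreal A * (\<Sum>n. (\<integral>\<^sup>+y\<in>ball x r. scale_sum (int_decode n) y \<partial>lborel) / emeasure lborel (ball x r))"
      by (simp only: divide_ennreal_def mult.assoc ennreal_suminf_multc)
    also have "\<dots> \<le> ennreal A * S x"
      unfolding S_def W_def e_def C_def using average_scale_sum[OF r] by (intro mult_left_mono suminf_le) auto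
    finally show "(\<integral>\<^sup>+y\<in>ball x r. ennreal (norm (f y)) \<partial>lborel) / emeasure lborel (ball x r) \<le> ennreal A * S x" .
  qed
  define B where "B n l j p = ennreal (3 ^ CARD('n) * (2 * real CARD('n)) powr \<beta> *
      (2 ^ (p + 2) * ((real l + 3) * \<theta> powi (int_decode n - int j))) powr \<beta>) * I n j" for n l j p :: nat
  have at: "atomic_bound \<beta> (W n l j p) (B n l j p)" for n l j p
    unfolding W_def B_def I_def using scale_pos \<beta>
    by (intro atomic_bound_box_mass) (auto intro!: mult_pos_pos add_nonneg_pos)
  have atS: "atomic_bound \<beta> S (\<Sum>n. \<Sum>l. \<Sum>j. ennreal (e l * (1/2) ^ j) * (ennreal ((\<theta> powi (int_decode n - int j)) powr - \<beta>) *
       (\<Sum>p. ennreal (C * (1/2) ^ (p * CARD('n))) * B n l j p)))"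
    unfolding S_def[abs_def] by (intro atomic_bound_suminf atomic_bound_cmult at)
  have inner: "ennreal (e l * (1/2) ^ j) * (ennreal ((\<theta> powi (int_decode n - int j)) powr - \<beta>) *
       (\<Sum>p. ennreal (C * (1/2) ^ (p * CARD('n))) * B n l j p))
      \<le> ennreal (K1 * (e l * (real l + 3)) * (1/2) ^ j) * I n j" for n l j
  proof -
    define \<rho> where "\<rho> = \<theta> powi (int_decode n - int j)"
    have \<rho>: "0 < \<rho>" unfolding \<rho>_def by (rule scale_pos)
    have "ennreal (\<rho> powr - \<beta>) * (ennreal (C * (1/2) ^ (p * CARD('n))) * B n l j p)
        \<le> ennreal (K * (real l + 3) * q ^ p) * I n j" for p
    proof -
      have eq: "ennreal (\<rho> powr - \<beta>) * (ennreal (C * (1/2) ^ (p * CARD('n))) * B n l j p)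
        = ennreal (\<rho> powr - \<beta> * (C * (1/2) ^ (p * CARD('n)) * (3 ^ CARD('n) * (2 * real CARD('n)) powr \<beta> *
           (2 ^ (p + 2) * ((real l + 3) * \<rho>)) powr \<beta>))) * I n j"
        unfolding B_def \<rho>_def[symmetric] using C by (simp add: ennreal_mult_assoc2)
      have "\<rho> powr - \<beta> * (C * (1/2) ^ (p * CARD('n)) * (3 ^ CARD('n) * (2 * real CARD('n)) powr \<beta> *
           (2 ^ (p + 2) * ((real l + 3) * \<rho>)) powr \<beta>))
          = C * (3 ^ CARD('n) * (2 * real CARD('n)) powr \<beta>) * ((1/2) ^ (p * CARD('n)) * (2 ^ (p + 2)) powr \<beta>) * (real l + 3) powr \<beta>"
      proof -
        have "(2 ^ (p + 2) * ((real l + 3) * \<rho>)) powr \<beta> = (2 ^ (p + 2)) powr \<beta> * ((real l + 3) powr \<beta> * \<rho> powr \<beta>)"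
          by (simp only: powr_mult)
        moreover have "\<rho> powr - \<beta> * \<rho> powr \<beta> = 1" using \<rho> by (simp add: powr_minus)
        moreover have "a' * (c * h * (t * (u * (v * a)))) = (a' * a) * (c * t * (h * u) * v)"
          for a a' c h t u v :: real by (simp only: ac_simps)
        ultimately show ?thesis by (simp only: mult_1_left)
      qed
      also have "\<dots> \<le> C * (3 ^ CARD('n) * (2 * real CARD('n)) powr \<beta>) * (q ^ p * 4) * (real l + 3)"
      proof -
        have "(real l + 3) powr \<beta> \<le> (real l + 3) powr 1" using \<beta> by (intro powr_mono) auto
        then have a1: "(real l + 3) powr \<beta> \<le> real l + 3" by simp
        have "(1/2 :: real) ^ (p * CARD('n)) \<le> (1/2) ^ p"
          by (intro power_decreasing) (auto simp: Suc_leI)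
        moreover have "(2 ^ (p + 2) :: real) powr \<beta> = (2 powr \<beta>) ^ p * 4 powr \<beta>"
          by (simp add: powr_mult powr_power powr_realpow[symmetric] powr_powr mult.commute)
        moreover have "(4::real) powr \<beta> \<le> 4 powr 1" using \<beta> by (intro powr_mono) auto
        ultimately have "(1/2 :: real) ^ (p * CARD('n)) * (2 ^ (p + 2)) powr \<beta> \<le> (1/2) ^ p * ((2 powr \<beta>) ^ p * 4)"
          by (auto intro!: mult_mono)
        also have "\<dots> = q ^ p * 4" by (simp add: q_def powr_diff power_divide power_one_over)
        finally have a2: "(1/2 :: real) ^ (p * CARD('n)) * (2 ^ (p + 2)) powr \<beta> \<le> q ^ p * 4" .
        show ?thesis by (rule mult_mono[OF mult_left_mono[OF a2] a1]) (use C q in auto)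
      qed
      also have "\<dots> = K * (real l + 3) * q ^ p" by (simp add: K_def)
      finally show ?thesis unfolding eq by (intro mult_right_mono ennreal_leI) auto
    qed
    then have "ennreal (\<rho> powr - \<beta>) * (\<Sum>p. ennreal (C * (1/2) ^ (p * CARD('n))) * B n l j p)
        \<le> (\<Sum>p. ennreal (K * (real l + 3) * q ^ p)) * I n j"
      unfolding ennreal_suminf_cmult[symmetric] ennreal_suminf_multc[symmetric] by (intro suminf_le) auto
    also have "(\<Sum>p. ennreal (K * (real l + 3) * q ^ p)) = ennreal (K * (real l + 3) * (1 / (1 - q)))"
      using q K0 by (intro suminf_ennreal_eq sums_mult geometric_sums) auto
    finally have "ennreal (e l * (1/2) ^ j) * (ennreal (\<rho> powr - \<beta>) * (\<Sum>p. ennreal (C * (1/2) ^ (p * CARD('n))) * B n l j p))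
        \<le> ennreal (e l * (1/2) ^ j) * (ennreal (K * (real l + 3) * (1 / (1 - q))) * I n j)"
      by (intro mult_left_mono) auto
    also have "\<dots> = ennreal (e l * (1/2) ^ j * (K * (real l + 3) * (1 / (1 - q)))) * I n j"
      using e0[of l] K0 q by (intro ennreal_mult_assoc2[symmetric]) auto
    also have "e l * (1/2) ^ j * (K * (real l + 3) * (1 / (1 - q))) = K1 * (e l * (real l + 3)) * (1/2) ^ j"
      by (simp add: K1_eq field_simps)
    finally show ?thesis unfolding \<rho>_def .
  qed
  have K1: "0 \<le> K1" using K0 q by (simp add: K1_eq)
  have "(\<Sum>n. \<Sum>l. \<Sum>j. ennreal (e l * (1/2) ^ j) * (ennreal ((\<theta> powi (int_decode n - int j)) powr - \<beta>) *
       (\<Sum>p. ennreal (C * (1/2) ^ (p * CARD('n))) * B n l j p)))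
      \<le> (\<Sum>n. \<Sum>l. \<Sum>j. ennreal (K1 * (e l * (real l + 3)) * (1/2) ^ j) * I n j)"
    by (intro suminf_le inner) auto
  also have "\<dots> = (\<Sum>l. \<Sum>j. \<Sum>n. ennreal (K1 * (e l * (real l + 3)) * (1/2) ^ j) * I n j)"
    by (subst ennreal_suminf_swap) (simp add: ennreal_suminf_swap[of "\<lambda>n j. _ n j * I n j"] ennreal_suminf_swap[of "\<lambda>n j. _ j * I n j"])
  also have "\<dots> \<le> (\<Sum>l. \<Sum>j. ennreal (K1 * (e l * (real l + 3)) * (1/2) ^ j) * ennreal (2 * M * real CARD('n)))"
    unfolding ennreal_suminf_cmult I_def by (intro suminf_le mult_left_mono sum_nn_integral_defect_sum) auto
  also have "\<dots> = (\<Sum>l. ennreal (K1 * (e l * (real l + 3)) * 2)) * ennreal (2 * M * real CARD('n))"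
  proof -
    have "(\<Sum>j. ennreal (K1 * (e l * (real l + 3)) * (1/2) ^ j)) = ennreal (K1 * (e l * (real l + 3)) * 2)" for l
      using K1 e0[of l] geometric_sums[of "1/2 :: real"]
      by (intro suminf_ennreal_eq sums_mult) auto
    then show ?thesis by (simp add: ennreal_suminf_multc)
  qed
  also have "(\<Sum>l. ennreal (K1 * (e l * (real l + 3)) * 2)) = ennreal (K1 * E * 2)"
  proof (rule suminf_ennreal_eq)
    have "summable (\<lambda>l. e l * (real l + 3))" unfolding e_def using th0 by (intro summable_gauss_poly) auto
    then show "(\<lambda>l. K1 * (e l * (real l + 3)) * 2) sums (K1 * E * 2)"
      unfolding E_def e_def by (intro sums_mult sums_mult2 summable_sums)
  qed (use K1 e0 in auto)
  finally have "ennreal A * (\<Sum>n. \<Sum>l. \<Sum>j. ennreal (e l * (1/2) ^ j) * (ennreal ((\<theta> powi (int_decode n - int j)) powr - \<beta>) *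
       (\<Sum>p. ennreal (C * (1/2) ^ (p * CARD('n))) * B n l j p)))
       \<le> ennreal A * (ennreal (K1 * E * 2) * ennreal (2 * M * real CARD('n)))"
    by (intro mult_left_mono) auto
  also have "\<dots> = ennreal (A * (K1 * E * 2 * (2 * M * real CARD('n))))"
  proof -
    have "0 \<le> E" unfolding E_def using th0 by (intro suminf_nonneg summable_gauss_poly) auto
    then have X: "0 \<le> K1 * E * 2" using K1 by simp
    have Y: "0 \<le> 2 * M * real CARD('n)" using M_nonneg by simp
    show ?thesis by (simp only: ennreal_mult[OF A mult_nonneg_nonneg[OF X Y]] ennreal_mult[OF X Y])
  qed
  finally show ?thesis by (rule atomic_bound_mono[OF atomic_bound_cmult[OF atS] dom])
qed

end

end

section \<open>Riesz kernels as superpositions of Gaussians\<close>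

lemma smooth_cutoff_exists:
  obtains b :: "real \<Rightarrow> real" where "smooth b" "b 0 = 1" "\<And>t. 1 < \<bar>t\<bar> \<Longrightarrow> b t = 0"
proof
  define b where "b t = exp 2 * (flat_exp (1 - t) * flat_exp (1 + t))" for t
  have "smooth (\<lambda>t. flat_exp (1 - t) * flat_exp (1 + t))"
    using smooth_mult[OF smooth_affine[OF smooth_flat_exp, of "-1" 1] smooth_affine[OF smooth_flat_exp, of 1 1]]
    by (simp add: add.commute)
  moreover have "smooth (\<lambda>t. exp 2)"
    unfolding smooth_def by (rule exI[of _ "\<lambda>k x. if k = 0 then exp 2 else 0"]) auto
  ultimately show "smooth b" unfolding b_def[abs_def] by (rule smooth_mult[rotated])
  show "b 0 = 1" by (simp add: b_def flat_exp_def exp_add[symmetric])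
  show "b t = 0" if "1 < \<bar>t\<bar>" for t using that by (auto simp: b_def flat_exp_def abs_if split: if_splits)
qed

context solenoidal
begin

text \<open>The gradient of the test function \<open>x\<^sub>i * b (x\<^sub>1 / R) * \<dots> * b (x\<^sub>d / R)\<close>, with a cutoff \<open>b\<close>
  equal to \<open>1\<close> at \<open>0\<close>, is bounded uniformly in \<open>R\<close> and tends pointwise to the \<open>i\<close>-th unit vector.
  The functions \<open>v k j\<close> of the proof are the factors of its \<open>k\<close>-th partial derivative, rescaled to
  be independent of \<open>R\<close>.\<close>

lemma total_flux_zero: "measure (P i) UNIV = measure (N i) UNIV"
proof -
  obtain b :: "real \<Rightarrow> real" where b: "smooth b" "b 0 = 1" "\<And>t. 1 < \<bar>t\<bar> \<Longrightarrow> b t = 0"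
    using smooth_cutoff_exists by blast
  define s where "s t = t * b t" for t
  have s: "smooth s" "s 0 = 0" "\<And>t. 1 < \<bar>t\<bar> \<Longrightarrow> s t = 0"
    using b smooth_mult[OF smooth_id b(1)] by (auto simp: s_def[abs_def])
  have "\<exists>f'. \<forall>t. (f has_real_derivative f' t) (at t)" if "smooth f" for f
    using that unfolding smooth_def by metis
  then obtain b' s' where b': "\<And>t. (b has_real_derivative b' t) (at t)" and s': "\<And>t. (s has_real_derivative s' t) (at t)"
    using b(1) s(1) by metis
  have "(s has_real_derivative 1 * b 0 + b' 0 * 0) (at 0)"
    unfolding s_def[abs_def] by (rule DERIV_mult'[THEN DERIV_cong, OF DERIV_ident b']) simp
  then have s'0: "s' 0 = 1" using DERIV_unique[OF s'[of 0]] b(2) by fastforce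
  obtain B1 where B1: "\<And>t. \<bar>b t\<bar> \<le> B1" "\<And>t. \<bar>b' t\<bar> \<le> B1" and bc: "continuous_on UNIV b" "continuous_on UNIV b'"
    using smooth_compact_bounds[OF b(1) b(3) b'] by metis
  obtain B2 where B2: "\<And>t. \<bar>s t\<bar> \<le> B2" "\<And>t. \<bar>s' t\<bar> \<le> B2" and sc: "continuous_on UNIV s" "continuous_on UNIV s'"
    using smooth_compact_bounds[OF s(1) s(3) s'] by metis
  define B where "B = max B1 B2"
  define v where "v k j = (if k = i then (if j = i then s' else b) else (if j = k then b' else if j = i then s else b))" for k j
  have vB: "\<bar>v k j t\<bar> \<le> B" for k j t using B1[of t] B2[of t] by (auto simp: v_def B_def)
  have vc: "continuous_on UNIV (v k j)" for k j using bc sc by (auto simp: v_def)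
  have v0: "(\<Prod>j\<in>UNIV. v k j 0) = (if k = i then 1 else 0)" for k
  proof (cases "k = i")
    case True
    then have "v k j 0 = 1" for j using s'0 b(2) by (auto simp: v_def)
    then show ?thesis using True by simp
  next
    case False
    then have "v k i 0 = 0" using s(2) by (simp add: v_def)
    then show ?thesis using False by (auto intro!: prod_zero)
  qed
  define W where "W k R y = (\<Prod>j\<in>UNIV. v k j (y $ j / R))" for k R and y :: "real ^ 'n"
  have W_deriv: "(\<Sum>k\<in>UNIV. (\<integral>y. W k R y \<partial>P k) - (\<integral>y. W k R y \<partial>N k)) = 0" if R: "0 < R" for R
  proof -
    define h where "h j t = (if j = i then R * s (t / R) else b (t / R))" for j t
    define h' where "h' j t = (if j = i then s' (t / R) else b' (t / R) / R)" for j t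
    have hs: "smooth (h j)" for j
    proof -
      have "smooth (\<lambda>t. s (1 / R * t + 0))" "smooth (\<lambda>t. b (1 / R * t + 0))" by (rule smooth_affine s b)+
      moreover have "smooth (\<lambda>t. R)" unfolding smooth_def by (rule exI[of _ "\<lambda>k x. if k = 0 then R else 0"]) auto
      ultimately show ?thesis
        using smooth_mult[of "\<lambda>t. R" "\<lambda>t. s (t / R)"] by (cases "j = i") (simp_all add: h_def[abs_def])
    qed
    have hsupp: "h j t = 0" if "R < \<bar>t\<bar>" for j t
    proof -
      have "1 < \<bar>t / R\<bar>" using that R by (simp add: field_simps)
      then show ?thesis using b(3) s(3) by (simp add: h_def)
    qed
    have hd: "(h j has_real_derivative h' j t) (at t)" for j t
    proof -
      have d: "((\<lambda>t. t / R) has_real_derivative 1 / R) (at t)"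
        by (rule DERIV_cdivide[OF DERIV_ident])
      have "((\<lambda>t. R * s (t / R)) has_real_derivative R * (s' (t / R) * (1 / R))) (at t)"
        by (intro DERIV_cmult DERIV_chain2[OF s'] d)
      moreover have "R * (s' (t / R) * (1 / R)) = s' (t / R)" using R by simp
      ultimately have "((\<lambda>t. R * s (t / R)) has_real_derivative s' (t / R)) (at t)" by (simp only:)
      moreover have "((\<lambda>t. b (t / R)) has_real_derivative b' (t / R) * (1 / R)) (at t)"
        by (intro DERIV_chain2[OF b'] d)
      ultimately show ?thesis by (cases "j = i") (simp_all add: h_def[abs_def] h'_def)
    qed
    have pd: "partial_deriv k (\<lambda>x. \<Prod>j\<in>UNIV. h j (x $ j)) y = W k R y" for k y
    proof -
      have "partial_deriv k (\<lambda>x. \<Prod>j\<in>UNIV. h j (x $ j)) y = h' k (y $ k) * (\<Prod>j\<in>UNIV - {k}. h j (y $ j))"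
        by (rule partial_deriv_prod_eq[OF hd])
      also have "\<dots> = W k R y"
      proof (cases "k = i")
        case True
        have "W k R y = v k k (y $ k / R) * (\<Prod>j\<in>UNIV - {k}. v k j (y $ j / R))"
          unfolding W_def by (rule prod.remove) auto
        moreover have "(\<Prod>j\<in>UNIV - {k}. v k j (y $ j / R)) = (\<Prod>j\<in>UNIV - {k}. h j (y $ j))"
          using True by (intro prod.cong) (auto simp: v_def h_def)
        ultimately show ?thesis using True by (simp add: v_def h'_def)
      next
        case False
        have "W k R y = v k k (y $ k / R) * (v k i (y $ i / R) * (\<Prod>j\<in>UNIV - {k} - {i}. v k j (y $ j / R)))"
          unfolding W_def using False by (subst prod.remove[of _ k], simp, simp, subst prod.remove[of _ i]) auto
        moreover have "(\<Prod>j\<in>UNIV - {k}. h j (y $ j)) = h i (y $ i) * (\<Prod>j\<in>UNIV - {k} - {i}. h j (y $ j))"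
          using False by (subst prod.remove[of _ i]) auto
        moreover have "(\<Prod>j\<in>UNIV - {k} - {i}. v k j (y $ j / R)) = (\<Prod>j\<in>UNIV - {k} - {i}. h j (y $ j))"
          using False by (intro prod.cong) (auto simp: v_def h_def)
        ultimately show ?thesis using False R by (simp add: v_def h'_def h_def)
      qed
      finally show ?thesis .
    qed
    have "(\<lambda>x. \<Prod>j\<in>UNIV. h j (x $ j)) \<in> test_functions"
      by (rule product_test_function[OF hs hsupp])
    from div[OF this] show ?thesis by (simp only: pd)
  qed
  have lim: "(\<lambda>n. \<integral>y. W k (real (Suc n)) y \<partial>m) \<longlonglongrightarrow> (if k = i then measure m UNIV else 0)"
    if m: "finite_borel_measure m" for m and k
  proof -
    interpret m: finite_borel_measure m by fact
    have Wm: "W k R \<in> borel_measurable m" for R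
    proof -
      have [measurable]: "v k j \<in> borel_measurable borel" for j
        using vc by (rule borel_measurable_continuous_onI)
      note [measurable] = borel_measurable_nth_vec
      show ?thesis unfolding W_def[abs_def] by measurable
    qed
    have "(\<lambda>n. \<integral>y. W k (real (Suc n)) y \<partial>m) \<longlonglongrightarrow> (\<integral>y. (if k = i then 1 else 0) \<partial>m)"
    proof (rule integral_dominated_convergence[where w = "\<lambda>_. B ^ CARD('n)"])
      have B0: "0 \<le> B" using vB[of i i 0] by linarith
      show "AE y in m. norm (W k (real (Suc n)) y) \<le> B ^ CARD('n)" for n
      proof (rule AE_I2)
        fix y
        have "\<bar>W k (real (Suc n)) y\<bar> \<le> (\<Prod>j\<in>(UNIV :: 'n set). B)"
          unfolding W_def abs_prod by (intro prod_mono conjI vB abs_ge_zero)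
        then show "norm (W k (real (Suc n)) y) \<le> B ^ CARD('n)" by simp
      qed
      show "AE y in m. (\<lambda>n. W k (real (Suc n)) y) \<longlonglongrightarrow> (if k = i then 1 else 0)"
      proof (rule AE_I2)
        fix y :: "real ^ 'n"
        have "(\<lambda>n. v k j (y $ j / real (Suc n))) \<longlonglongrightarrow> v k j 0" for j
        proof -
          have "isCont (v k j) 0" using vc[of k j] by (simp add: continuous_on_eq_continuous_at)
          moreover have "(\<lambda>n. y $ j / real (Suc n)) \<longlonglongrightarrow> 0"
            using LIMSEQ_Suc[OF lim_const_over_n[of "y $ j"]] by simp
          ultimately show ?thesis by (rule isCont_tendsto_compose)
        qed
        then have "(\<lambda>n. W k (real (Suc n)) y) \<longlonglongrightarrow> (\<Prod>j\<in>UNIV. v k j 0)"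
          unfolding W_def by (intro tendsto_prod)
        then show "(\<lambda>n. W k (real (Suc n)) y) \<longlonglongrightarrow> (if k = i then 1 else 0)" by (simp only: v0)
      qed
    qed (use Wm in auto)
    then show ?thesis by (cases "k = i") (simp_all add: m.space_m)
  qed
  have "(\<lambda>n. \<Sum>k\<in>UNIV. (\<integral>y. W k (real (Suc n)) y \<partial>P k) - (\<integral>y. W k (real (Suc n)) y \<partial>N k)) \<longlonglongrightarrow>
      (\<Sum>k\<in>UNIV. (if k = i then measure (P k) UNIV else 0) - (if k = i then measure (N k) UNIV else 0))"
    by (intro tendsto_sum tendsto_diff lim P N)
  then have "(\<lambda>n::nat. 0) \<longlonglongrightarrow> (\<Sum>k\<in>UNIV. (if k = i then measure (P k) UNIV else 0) - (if k = i then measure (N k) UNIV else 0))"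
    by (simp only: W_deriv[OF of_nat_0_less_iff[THEN iffD2, OF zero_less_Suc]])
  then have "0 = (\<Sum>k\<in>UNIV. (if k = i then measure (P k) UNIV else 0) - (if k = i then measure (N k) UNIV else 0))"
    by (simp add: LIMSEQ_const_iff)
  also have "\<dots> = measure (P i) UNIV - measure (N i) UNIV" by (simp add: sum_subtractf)
  finally show ?thesis by simp
qed

end

text \<open>Its value is \<open>Gamma (1 + \<beta> / 2) / 2\<close>.\<close>

definition scale_const :: "real \<Rightarrow> ennreal" where
  "scale_const \<beta> = (\<integral>\<^sup>+u\<in>{0<..}. ennreal (u powr (- \<beta> - 3) * exp (- 1 / u\<^sup>2)) \<partial>lborel)"

text \<open>The kernel of order \<open>\<beta>\<close>, normalized to vanish at \<open>1\<close>. With this normalization the logarithm is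
  the limit as \<open>\<beta>\<close> tends to \<open>0\<close>, and the derivative has the same form for all \<open>\<beta>\<close>.\<close>

definition power_potential :: "real \<Rightarrow> real \<Rightarrow> real" where
  "power_potential \<beta> t = (if \<beta> = 0 then - ln t else (t powr - \<beta> - 1) / \<beta>)"

lemma power_potential_1: "power_potential \<beta> 1 = 0"
  by (simp add: power_potential_def)

lemma power_potential_deriv: "0 < t \<Longrightarrow> (power_potential \<beta> has_real_derivative - (t powr (- \<beta> - 1))) (at t)"
  unfolding power_potential_def[abs_def]
  by (cases "\<beta> = 0") (auto intro!: derivative_eq_intros simp: powr_minus powr_diff field_simps)

lemma measurable_power_potential [measurable]: "power_potential \<beta> \<in> borel_measurable borel"
  unfolding power_potential_def[abs_def] by measurable

text \<open>Near \<open>0\<close> the exponential beats the power, at infinity the integrand is at most \<open>u powr - 3\<close>.\<close>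

lemma scale_const_finite:
  assumes \<beta>: "0 \<le> \<beta>" "\<beta> < 1" shows "scale_const \<beta> < \<infinity>"
proof -
  have "scale_const \<beta> \<le> (\<integral>\<^sup>+u. ennreal 2 * indicator {0..1} u + ennreal (u powr - 3) * indicator {1..} u \<partial>lborel)"
    unfolding scale_const_def
  proof (intro nn_integral_mono)
    fix u :: real
    show "ennreal (u powr (- \<beta> - 3) * exp (- 1 / u\<^sup>2)) * indicator {0<..} u
      \<le> ennreal 2 * indicator {0..1} u + ennreal (u powr - 3) * indicator {1..} u"
    proof (cases "0 < u \<and> u < 1")
      case True
      have "exp_ineq": "x\<^sup>2 / 2 \<le> exp x" if "0 \<le> x" for x :: real
        using exp_lower_Taylor_quadratic[OF that] that by linarith
      have "u powr (- \<beta> - 3) \<le> u powr - 4" using True \<beta> by (intro powr_mono') auto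
      also have "\<dots> = 1 / u ^ 4" using True by (simp add: powr_minus_divide)
      finally have 1: "u powr (- \<beta> - 3) \<le> 1 / u ^ 4" .
      have "(1 / u\<^sup>2)\<^sup>2 / 2 \<le> exp (1 / u\<^sup>2)" by (rule exp_ineq) simp
      then have "exp (- 1 / u\<^sup>2) \<le> 2 * u ^ 4"
        using True by (simp add: exp_minus field_simps power2_eq_square power4_eq_xxxx)
      with 1 have "u powr (- \<beta> - 3) * exp (- 1 / u\<^sup>2) \<le> (1 / u ^ 4) * (2 * u ^ 4)"
        using True by (intro mult_mono) auto
      also have "\<dots> = 2" using True by simp
      finally have "ennreal (u powr (- \<beta> - 3) * exp (- 1 / u\<^sup>2)) \<le> ennreal 2" by (rule ennreal_leI)
      then show ?thesis using True by simp
    next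
      case False
      show ?thesis
      proof (cases "1 \<le> u")
        case True
        have "u powr (- \<beta> - 3) * exp (- 1 / u\<^sup>2) \<le> u powr - 3 * 1"
          using True \<beta> by (intro mult_mono powr_mono) auto
        then have "ennreal (u powr (- \<beta> - 3) * exp (- 1 / u\<^sup>2)) \<le> ennreal (u powr - 3)"
          by (intro ennreal_leI) simp
        also have "\<dots> \<le> ennreal 2 * indicator {0..1} u + ennreal (u powr - 3) * indicator {1..} u"
          using True by (simp add: add_increasing)
        finally show ?thesis using True by simp
      qed (use False in \<open>auto simp: indicator_def\<close>)
    qed
  qed
  also have "\<dots> = 2 + (\<integral>\<^sup>+u. ennreal (u powr - 3) * indicator {1..} u \<partial>lborel)"
    by (subst nn_integral_add) (auto simp: nn_integral_cmult_indicator)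
  also have "(\<integral>\<^sup>+u. ennreal (u powr - 3) * indicator {1..} u \<partial>lborel) = ennreal (0 - (- (1 powr - 2) / 2))"
  proof (rule nn_integral_FTC_atLeast)
    fix u :: real assume "1 \<le> u"
    then show "((\<lambda>u. - (u powr - 2) / 2) has_real_derivative u powr - 3) (at u)"
      by (auto intro!: derivative_eq_intros)
    show "0 \<le> u powr - 3" by simp
  next
    have "((\<lambda>u::real. u powr - 2) \<longlongrightarrow> 0) at_top" by (rule tendsto_neg_powr) (auto intro: filterlim_ident)
    from tendsto_divide[OF tendsto_minus[OF this] tendsto_const[of 2]]
    show "((\<lambda>u::real. - (u powr - 2) / 2) \<longlongrightarrow> 0) at_top" by simp
  qed simp
  also have "2 + ennreal (0 - (- (1 powr - 2) / 2)) < (\<infinity> :: ennreal)" by (simp only: less_top[symmetric] infinity_ennreal_def ennreal_add_eq_top) simp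
  finally show ?thesis .
qed

lemma scale_const_pos:
  assumes \<beta>: "0 \<le> \<beta>" "\<beta> < 1" shows "0 < scale_const \<beta>"
proof -
  have "ennreal (2 powr - 4 * exp (- 1)) * emeasure lborel {1..2::real} \<le> scale_const \<beta>"
    unfolding scale_const_def
  proof (subst nn_integral_cmult_indicator[symmetric], simp, intro nn_integral_mono)
    fix u :: real
    have "2 powr - 4 * exp (- 1) \<le> u powr (- \<beta> - 3) * exp (- 1 / u\<^sup>2)" if u: "u \<in> {1..2}"
    proof (intro mult_mono)
      have "(2::real) powr - 4 \<le> 2 powr (- \<beta> - 3)" using \<beta> by (intro powr_mono) auto
      also have "\<dots> \<le> u powr (- \<beta> - 3)" using u \<beta> by (intro powr_mono2') auto
      finally show "2 powr - 4 \<le> u powr (- \<beta> - 3)" .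
      show "exp (- 1) \<le> exp (- 1 / u\<^sup>2)" using u by (simp add: field_simps)
    qed auto
    then show "ennreal (2 powr - 4 * exp (- 1)) * indicator {1..2} u
        \<le> ennreal (u powr (- \<beta> - 3) * exp (- 1 / u\<^sup>2)) * indicator {0<..} u"
      by (auto simp: indicator_def intro: ennreal_leI)
  qed
  moreover have "0 < ennreal (2 powr - 4 * exp (- 1)) * emeasure lborel {1..2::real}"
    by (simp add: ennreal_zero_less_mult_iff)
  ultimately show ?thesis by (rule order_less_le_trans[rotated])
qed

lemma scale_integral:
  assumes s: "0 < s"
  shows "(\<integral>\<^sup>+r\<in>{0<..}. ennreal (r powr (- \<beta> - 3) * exp (- s\<^sup>2 / r\<^sup>2)) \<partial>lborel) = ennreal (s powr (- \<beta> - 2)) * scale_const \<beta>"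
proof -
  have "(\<integral>\<^sup>+r\<in>{0<..}. ennreal (r powr (- \<beta> - 3) * exp (- s\<^sup>2 / r\<^sup>2)) \<partial>lborel)
      = ennreal s * (\<integral>\<^sup>+u. ennreal ((s * u) powr (- \<beta> - 3) * exp (- s\<^sup>2 / (s * u)\<^sup>2)) * indicator {0<..} (s * u) \<partial>lborel)"
    using s by (subst nn_integral_real_affine[where c = s and t = 0]) auto
  also have "(\<integral>\<^sup>+u. ennreal ((s * u) powr (- \<beta> - 3) * exp (- s\<^sup>2 / (s * u)\<^sup>2)) * indicator {0<..} (s * u) \<partial>lborel)
      = (\<integral>\<^sup>+u. ennreal (s powr (- \<beta> - 3)) * (ennreal (u powr (- \<beta> - 3) * exp (- 1 / u\<^sup>2)) * indicator {0<..} u) \<partial>lborel)"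
  proof (intro nn_integral_cong)
    fix u :: real
    have "(s * u) powr (- \<beta> - 3) * exp (- s\<^sup>2 / (s * u)\<^sup>2) = s powr (- \<beta> - 3) * (u powr (- \<beta> - 3) * exp (- 1 / u\<^sup>2))"
      using s by (simp add: powr_mult power_mult_distrib)
    then show "ennreal ((s * u) powr (- \<beta> - 3) * exp (- s\<^sup>2 / (s * u)\<^sup>2)) * indicator {0<..} (s * u)
      = ennreal (s powr (- \<beta> - 3)) * (ennreal (u powr (- \<beta> - 3) * exp (- 1 / u\<^sup>2)) * indicator {0<..} u)"
      using s by (auto simp: indicator_def zero_less_mult_iff ennreal_mult)
  qed
  also have "\<dots> = ennreal (s powr (- \<beta> - 3)) * scale_const \<beta>"
    unfolding scale_const_def by (rule nn_integral_cmult) measurable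
  also have "ennreal s * (ennreal (s powr (- \<beta> - 3)) * scale_const \<beta>) = ennreal (s * s powr (- \<beta> - 3)) * scale_const \<beta>"
    using s by (simp add: ennreal_mult mult.assoc)
  also have "s * s powr (- \<beta> - 3) = s powr (- \<beta> - 2)"
    using s powr_add[of s 1 "- \<beta> - 3"] by (simp add: algebra_simps)
  finally show ?thesis .
qed

text \<open>Write the difference of the exponentials as an integral over \<open>s\<close> between \<open>a\<close> and \<open>b\<close>, exchange
  the integrals, and use homogeneity in \<open>r\<close>. What remains is the integral of the derivative of
  \<^const>\<open>power_potential\<close>. All integrands are nonnegative.\<close>

lemma gauss_difference_integral:
  assumes ab: "0 < a" "a \<le> b"
  shows "(\<integral>\<^sup>+r\<in>{0<..}. ennreal ((exp (- a\<^sup>2 / r\<^sup>2) - exp (- b\<^sup>2 / r\<^sup>2)) * r powr (- \<beta> - 1)) \<partial>lborel)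
    = scale_const \<beta> * ennreal (2 * (power_potential \<beta> a - power_potential \<beta> b))"
proof -
  have ftc: "ennreal ((exp (- a\<^sup>2 / r\<^sup>2) - exp (- b\<^sup>2 / r\<^sup>2)) * r powr (- \<beta> - 1))
      = (\<integral>\<^sup>+s. ennreal (2 * s * (r powr (- \<beta> - 3) * exp (- s\<^sup>2 / r\<^sup>2))) * indicator {a..b} s \<partial>lborel)" if r: "0 < r" for r
  proof -
    have "(\<integral>\<^sup>+s. ennreal (2 * s * (r powr (- \<beta> - 3) * exp (- s\<^sup>2 / r\<^sup>2))) * indicator {a..b} s \<partial>lborel)
      = ennreal (- exp (- b\<^sup>2 / r\<^sup>2) * r powr (- \<beta> - 1) - (- exp (- a\<^sup>2 / r\<^sup>2) * r powr (- \<beta> - 1)))"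
    proof (rule nn_integral_FTC_Icc)
      fix s assume "s \<in> {a..b}"
      then have "0 \<le> s" using ab by auto
      then show "0 \<le> 2 * s * (r powr (- \<beta> - 3) * exp (- s\<^sup>2 / r\<^sup>2))" by simp
      have p: "r powr (- \<beta> - 1) = r powr (- \<beta> - 3) * r\<^sup>2"
      proof -
        have "- \<beta> - 1 = (- \<beta> - 3) + 2" by simp
        then have "r powr (- \<beta> - 1) = r powr ((- \<beta> - 3) + 2)" by (rule arg_cong)
        also have "\<dots> = r powr (- \<beta> - 3) * r powr 2" by (rule powr_add)
        finally show ?thesis using r by simp
      qed
      have "((\<lambda>s. - exp (- s\<^sup>2 / r\<^sup>2) * r powr (- \<beta> - 1)) has_real_derivative 2 * s * (r powr (- \<beta> - 3) * exp (- s\<^sup>2 / r\<^sup>2))) (at s)"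
        unfolding p using r by (auto intro!: derivative_eq_intros simp: field_simps)
      then show "((\<lambda>s. - exp (- s\<^sup>2 / r\<^sup>2) * r powr (- \<beta> - 1)) has_real_derivative 2 * s * (r powr (- \<beta> - 3) * exp (- s\<^sup>2 / r\<^sup>2))) (at s)" .
    qed (use ab in auto)
    then show ?thesis by (simp add: algebra_simps)
  qed
  have "(\<integral>\<^sup>+r\<in>{0<..}. ennreal ((exp (- a\<^sup>2 / r\<^sup>2) - exp (- b\<^sup>2 / r\<^sup>2)) * r powr (- \<beta> - 1)) \<partial>lborel)
      = (\<integral>\<^sup>+r. (\<integral>\<^sup>+s. ennreal (2 * s) * indicator {a..b} s * (ennreal (r powr (- \<beta> - 3) * exp (- s\<^sup>2 / r\<^sup>2)) * indicator {0<..} r) \<partial>lborel) \<partial>lborel)"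
  proof (intro nn_integral_cong)
    fix r :: real
    show "ennreal ((exp (- a\<^sup>2 / r\<^sup>2) - exp (- b\<^sup>2 / r\<^sup>2)) * r powr (- \<beta> - 1)) * indicator {0<..} r
      = (\<integral>\<^sup>+s. ennreal (2 * s) * indicator {a..b} s * (ennreal (r powr (- \<beta> - 3) * exp (- s\<^sup>2 / r\<^sup>2)) * indicator {0<..} r) \<partial>lborel)"
    proof (cases "0 < r")
      case True
      have "ennreal (2 * s * (r powr (- \<beta> - 3) * exp (- s\<^sup>2 / r\<^sup>2))) * indicator {a..b} s
        = ennreal (2 * s) * indicator {a..b} s * (ennreal (r powr (- \<beta> - 3) * exp (- s\<^sup>2 / r\<^sup>2)) * indicator {0<..} r)" for s
        using True ab by (cases "s \<in> {a..b}") (auto simp: ennreal_mult)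
      then show ?thesis using True ftc[OF True] by (simp only:) simp
    qed simp
  qed
  also have "\<dots> = (\<integral>\<^sup>+s. (\<integral>\<^sup>+r. ennreal (2 * s) * indicator {a..b} s * (ennreal (r powr (- \<beta> - 3) * exp (- s\<^sup>2 / r\<^sup>2)) * indicator {0<..} r) \<partial>lborel) \<partial>lborel)"
    by (rule lborel_pair.Fubini') measurable
  also have "\<dots> = (\<integral>\<^sup>+s. scale_const \<beta> * (ennreal (2 * s powr (- \<beta> - 1)) * indicator {a..b} s) \<partial>lborel)"
  proof (intro nn_integral_cong)
    fix s :: real
    show "(\<integral>\<^sup>+r. ennreal (2 * s) * indicator {a..b} s * (ennreal (r powr (- \<beta> - 3) * exp (- s\<^sup>2 / r\<^sup>2)) * indicator {0<..} r) \<partial>lborel)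
      = scale_const \<beta> * (ennreal (2 * s powr (- \<beta> - 1)) * indicator {a..b} s)"
    proof (cases "s \<in> {a..b}")
      case True
      then have s: "0 < s" using ab by auto
      have p: "s powr (- \<beta> - 1) = s * s powr (- \<beta> - 2)"
      proof -
        have "- \<beta> - 1 = 1 + (- \<beta> - 2)" by simp
        then have "s powr (- \<beta> - 1) = s powr (1 + (- \<beta> - 2))" by (rule arg_cong)
        also have "\<dots> = s powr 1 * s powr (- \<beta> - 2)" by (rule powr_add)
        finally show ?thesis using s by simp
      qed
      have "(\<integral>\<^sup>+r. ennreal (2 * s) * indicator {a..b} s * (ennreal (r powr (- \<beta> - 3) * exp (- s\<^sup>2 / r\<^sup>2)) * indicator {0<..} r) \<partial>lborel)
        = ennreal (2 * s) * (ennreal (s powr (- \<beta> - 2)) * scale_const \<beta>)"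
        using True by (subst nn_integral_cmult, measurable) (simp only: scale_integral[OF s], simp)
      also have "\<dots> = scale_const \<beta> * ennreal (2 * s powr (- \<beta> - 1))"
        unfolding p using s by (simp add: ennreal_mult ac_simps)
      finally show ?thesis using True by simp
    qed simp
  qed
  also have "\<dots> = scale_const \<beta> * (\<integral>\<^sup>+s. ennreal (2 * s powr (- \<beta> - 1)) * indicator {a..b} s \<partial>lborel)"
    by (rule nn_integral_cmult) measurable
  also have "(\<integral>\<^sup>+s. ennreal (2 * s powr (- \<beta> - 1)) * indicator {a..b} s \<partial>lborel)
      = ennreal (- 2 * power_potential \<beta> b - (- 2 * power_potential \<beta> a))"
  proof (rule nn_integral_FTC_Icc)
    fix s assume "s \<in> {a..b}"
    then have s: "0 < s" using ab by auto
    then show "0 \<le> 2 * s powr (- \<beta> - 1)" by simp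
    show "((\<lambda>s. - 2 * power_potential \<beta> s) has_real_derivative 2 * s powr (- \<beta> - 1)) (at s)"
      using DERIV_cmult[OF power_potential_deriv[OF s], of "- 2" \<beta>] by simp
  qed (use ab in auto)
  finally show ?thesis by (simp add: algebra_simps)
qed

text \<open>Subtraction of the Gaussian at distance \<open>1\<close> makes the integral converge also for \<open>\<beta> = 0\<close>,
  where the superposition of the Gaussians alone diverges at \<open>r = \<infinity>\<close>. The integrand has a constant
  sign, which depends on whether \<open>t \<le> 1\<close>; the sign \<open>\<sigma>\<close> treats both cases at once.\<close>

lemma gauss_representation:
  assumes \<beta>: "0 \<le> \<beta>" "\<beta> < 1" and t: "0 < t"
  defines "g \<equiv> \<lambda>r. indicator {0<..} r * ((exp (- t\<^sup>2 / r\<^sup>2) - exp (- 1 / r\<^sup>2)) * r powr (- \<beta> - 1))"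
    and "c \<equiv> enn2real (scale_const \<beta>)"
  shows "(\<integral>\<^sup>+r. ennreal \<bar>g r\<bar> \<partial>lborel) = ennreal (2 * c * \<bar>power_potential \<beta> t\<bar>)"
    "(\<integral>r. g r \<partial>lborel) = 2 * c * power_potential \<beta> t"
proof -
  have c: "scale_const \<beta> = ennreal c" "0 \<le> c"
    using scale_const_finite[OF \<beta>] by (auto simp: c_def)
  have [measurable]: "g \<in> borel_measurable borel" unfolding g_def by measurable
  have main: "\<exists>\<sigma>\<in>{1, - 1}. (\<forall>r. 0 \<le> \<sigma> * g r) \<and> 0 \<le> \<sigma> * power_potential \<beta> t \<and>
      (\<integral>\<^sup>+r. ennreal (\<sigma> * g r) \<partial>lborel) = ennreal (2 * c * (\<sigma> * power_potential \<beta> t))"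
  proof (cases "t \<le> 1")
    case True
    have "exp (- 1 / r\<^sup>2) \<le> exp (- t\<^sup>2 / r\<^sup>2)" for r
      using True t by (auto intro!: divide_right_mono simp: power_le_one)
    then have nn: "0 \<le> g r" for r unfolding g_def by (intro mult_nonneg_nonneg) auto
    have pp: "0 \<le> power_potential \<beta> t"
    proof (cases "\<beta> = 0")
      case False
      have "1 powr - \<beta> \<le> t powr - \<beta>" using True t \<beta> by (intro powr_mono2') auto
      with False \<beta> show ?thesis by (simp add: power_potential_def)
    qed (use True t in \<open>simp add: power_potential_def\<close>)
    have eq: "ennreal (g r) = ennreal ((exp (- t\<^sup>2 / r\<^sup>2) - exp (- 1\<^sup>2 / r\<^sup>2)) * r powr (- \<beta> - 1)) * indicator {0<..} r" for r
      by (simp add: g_def indicator_def)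
    have "(\<integral>\<^sup>+r. ennreal (g r) \<partial>lborel) = scale_const \<beta> * ennreal (2 * (power_potential \<beta> t - power_potential \<beta> 1))"
      unfolding eq by (rule gauss_difference_integral[OF t True])
    then have "(\<integral>\<^sup>+r. ennreal (1 * g r) \<partial>lborel) = ennreal (2 * c * (1 * power_potential \<beta> t))"
      using c pp by (simp add: power_potential_1 ennreal_mult[symmetric] ac_simps)
    then show ?thesis using nn pp by (intro bexI[of _ 1]) auto
  next
    case False
    then have t1: "1 \<le> t" by simp
    have "exp (- t\<^sup>2 / r\<^sup>2) \<le> exp (- 1 / r\<^sup>2)" for r
      using t1 by (auto intro!: divide_right_mono simp: one_le_power)
    then have nn: "0 \<le> - 1 * g r" for r
      unfolding g_def by (auto simp: indicator_def mult_le_0_iff)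
    have pp: "0 \<le> - 1 * power_potential \<beta> t"
    proof (cases "\<beta> = 0")
      case False
      have "t powr - \<beta> \<le> 1 powr - \<beta>" using t1 \<beta> by (intro powr_mono2') auto
      with False \<beta> show ?thesis by (simp add: power_potential_def divide_nonpos_pos)
    qed (use t1 in \<open>simp add: power_potential_def\<close>)
    have eq: "ennreal (- 1 * g r) = ennreal ((exp (- 1\<^sup>2 / r\<^sup>2) - exp (- t\<^sup>2 / r\<^sup>2)) * r powr (- \<beta> - 1)) * indicator {0<..} r" for r
      by (simp add: g_def indicator_def algebra_simps)
    have "(\<integral>\<^sup>+r. ennreal (- 1 * g r) \<partial>lborel) = scale_const \<beta> * ennreal (2 * (power_potential \<beta> 1 - power_potential \<beta> t))"
      unfolding eq by (rule gauss_difference_integral[OF zero_less_one t1])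
    then have "(\<integral>\<^sup>+r. ennreal (- 1 * g r) \<partial>lborel) = ennreal (2 * c * (- 1 * power_potential \<beta> t))"
      using c pp by (simp add: power_potential_1 ennreal_mult[symmetric] ac_simps)
    then show ?thesis using nn pp by (intro bexI[of _ "- 1"]) auto
  qed
  then obtain \<sigma> where s1: "\<sigma> \<in> {1, - 1}" and s2: "(\<forall>r. 0 \<le> \<sigma> * g r) \<and> 0 \<le> \<sigma> * power_potential \<beta> t \<and>
      (\<integral>\<^sup>+r. ennreal (\<sigma> * g r) \<partial>lborel) = ennreal (2 * c * (\<sigma> * power_potential \<beta> t))" by (elim bexE)
  have \<sigma>: "\<sigma> = 1 \<or> \<sigma> = - 1" "\<And>r. 0 \<le> \<sigma> * g r" "0 \<le> \<sigma> * power_potential \<beta> t"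
    "(\<integral>\<^sup>+r. ennreal (\<sigma> * g r) \<partial>lborel) = ennreal (2 * c * (\<sigma> * power_potential \<beta> t))"
    using s1 s2 by simp_all
  have abs: "\<bar>g r\<bar> = \<sigma> * g r" for r using \<sigma>(1) \<sigma>(2)[of r] by (auto simp: abs_if)
  have abs': "\<bar>power_potential \<beta> t\<bar> = \<sigma> * power_potential \<beta> t" using \<sigma>(1,3) by (auto simp: abs_if)
  show "(\<integral>\<^sup>+r. ennreal \<bar>g r\<bar> \<partial>lborel) = ennreal (2 * c * \<bar>power_potential \<beta> t\<bar>)"
    unfolding abs abs' by (rule \<sigma>(4))
  have "0 \<le> 2 * c * (\<sigma> * power_potential \<beta> t)" using c(2) \<sigma>(3)
    by (intro mult_nonneg_nonneg[of "2 * c"]) auto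
  then have "(\<integral>r. \<sigma> * g r \<partial>lborel) = 2 * c * (\<sigma> * power_potential \<beta> t)"
    using \<sigma>(2,4) by (subst integral_eq_nn_integral) auto
  then show "(\<integral>r. g r \<partial>lborel) = 2 * c * power_potential \<beta> t" using \<sigma>(1) by auto
qed

lemma potential_as_heat:
  fixes m :: "(real ^ 'n::finite) measure"
  assumes m: "finite_borel_measure m" and \<beta>: "0 \<le> \<beta>" "\<beta> < 1"
    and ne: "AE y in m. y \<noteq> x" and int: "integrable m (\<lambda>y. power_potential \<beta> (norm (x - y)))"
  defines "c \<equiv> enn2real (scale_const \<beta>)"
    and "H \<equiv> \<lambda>r. indicator {0<..} r * ((gauss_mass TYPE('n) * r ^ CARD('n) * heat m r x - exp (- 1 / r\<^sup>2) * measure m UNIV) * r powr (- \<beta> - 1))"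
  shows "integrable lborel H" "(\<integral>r. H r \<partial>lborel) = 2 * c * (\<integral>y. power_potential \<beta> (norm (x - y)) \<partial>m)"
proof -
  interpret m: finite_borel_measure m by fact
  define f where "f y r = indicator {0<..} r * ((exp (- (norm (x - y))\<^sup>2 / r\<^sup>2) - exp (- 1 / r\<^sup>2)) * r powr (- \<beta> - 1))" for y r
  have c: "0 \<le> c" by (simp add: c_def)
  have AEpos: "AE y in m. 0 < norm (x - y)" using ne by eventually_elim auto
  have nnf: "(\<integral>\<^sup>+y. \<integral>\<^sup>+r. ennreal \<bar>f y r\<bar> \<partial>lborel \<partial>m) = (\<integral>\<^sup>+y. ennreal (2 * c * \<bar>power_potential \<beta> (norm (x - y))\<bar>) \<partial>m)"
    using AEpos
    by (intro nn_integral_cong_AE, eventually_elim)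
       (simp only: f_def c_def gauss_representation(1)[OF \<beta>])
  have "(\<integral>\<^sup>+y. ennreal (2 * c * \<bar>power_potential \<beta> (norm (x - y))\<bar>) \<partial>m) = ennreal (\<integral>y. 2 * c * \<bar>power_potential \<beta> (norm (x - y))\<bar> \<partial>m)"
    using int c by (intro nn_integral_eq_integral integrable_mult_right integrable_abs) auto
  with nnf have fin: "(\<integral>\<^sup>+y. \<integral>\<^sup>+r. ennreal \<bar>f y r\<bar> \<partial>lborel \<partial>m) < \<infinity>" by simp
  have meas: "(\<lambda>(y, r). f y r) \<in> borel_measurable (m \<Otimes>\<^sub>M lborel)"
    unfolding f_def by measurable
  note F = Fubini_swap[OF m.sigma_m lborel.sigma_finite_measure_axioms meas fin]
  have inner: "(\<integral>y. f y r \<partial>m) = H r" for r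
  proof (cases "0 < r")
    case True
    have e: "exp (- (norm (x - y))\<^sup>2 / r\<^sup>2) = gauss_mass TYPE('n) * r ^ CARD('n) * gauss r (x - y)" for y
      using True gauss_mass_pos[where 'n = 'n] by (simp add: gauss_def)
    have "(\<integral>y. f y r \<partial>m) = (\<integral>y. (gauss_mass TYPE('n) * r ^ CARD('n) * gauss r (x - y) - exp (- 1 / r\<^sup>2)) * r powr (- \<beta> - 1) \<partial>m)"
    proof -
      have "f y r = (gauss_mass TYPE('n) * r ^ CARD('n) * gauss r (x - y) - exp (- 1 / r\<^sup>2)) * r powr (- \<beta> - 1)" for y
        unfolding f_def e using True by simp
      then show ?thesis by (simp only:)
    qed
    also have "\<dots> = (gauss_mass TYPE('n) * r ^ CARD('n) * heat m r x - exp (- 1 / r\<^sup>2) * measure m UNIV) * r powr (- \<beta> - 1)"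
      using m.integrable_gauss_m[OF True, of x] by (simp add: heat_def m.space_m mult.commute)
    finally show ?thesis using True by (simp add: H_def)
  qed (simp add: f_def H_def)
  show "integrable lborel H" using F(3) by (simp add: inner)
  have "(\<integral>r. H r \<partial>lborel) = (\<integral>y. \<integral>r. f y r \<partial>lborel \<partial>m)" using F(1) by (simp add: inner)
  also have "\<dots> = (\<integral>y. 2 * c * power_potential \<beta> (norm (x - y)) \<partial>m)"
  proof (rule integral_cong_AE)
    show "AE y in m. (\<integral>r. f y r \<partial>lborel) = 2 * c * power_potential \<beta> (norm (x - y))"
      using AEpos by eventually_elim (simp only: f_def c_def gauss_representation(2)[OF \<beta>])
  qed (use borel_measurable_integrable[OF F(2)] in auto)
  also have "\<dots> = 2 * c * (\<integral>y. power_potential \<beta> (norm (x - y)) \<partial>m)" by simp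
  finally show "(\<integral>r. H r \<partial>lborel) = 2 * c * (\<integral>y. power_potential \<beta> (norm (x - y)) \<partial>m)" .
qed

context solenoidal
begin

lemma measurable_G_scale: "(\<lambda>r. G i r x) \<in> borel_measurable borel"
proof -
  have "(\<lambda>r. heat m r x) \<in> borel_measurable borel" if "finite_borel_measure m" for m
  proof -
    interpret m: finite_borel_measure m by fact
    show ?thesis unfolding heat_def gauss_def
      by (rule m.borel_measurable_lebesgue_integral) measurable
  qed
  from this[OF P] this[OF N] show ?thesis unfolding G_def by measurable
qed

text \<open>The representation is applied to both parts. The subtracted Gaussians contribute multiples of
  the total masses of \<open>P i\<close> and \<open>N i\<close>, which cancel by \<open>total_flux_zero\<close>.\<close>

lemma potential_le_heat:
  assumes \<beta>: "0 \<le> \<beta>" "\<beta> < 1"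
    and neP: "AE y in P i. y \<noteq> x" and neN: "AE y in N i. y \<noteq> x"
    and intP: "integrable (P i) (\<lambda>y. power_potential \<beta> (norm (x - y)))"
    and intN: "integrable (N i) (\<lambda>y. power_potential \<beta> (norm (x - y)))"
  shows "ennreal \<bar>(\<integral>y. power_potential \<beta> (norm (x - y)) \<partial>P i) - (\<integral>y. power_potential \<beta> (norm (x - y)) \<partial>N i)\<bar>
    \<le> ennreal (gauss_mass TYPE('n) / (2 * enn2real (scale_const \<beta>))) *
      (\<integral>\<^sup>+r\<in>{0<..}. ennreal (r powr (real CARD('n) - \<beta> - 1)) * ennreal \<bar>G i r x\<bar> \<partial>lborel)"
proof -
  define c where "c = enn2real (scale_const \<beta>)"
  define Z where "Z = gauss_mass TYPE('n)"
  define H where "H m r = indicator {0<..} r * ((gauss_mass TYPE('n) * r ^ CARD('n) * heat m r x - exp (- 1 / r\<^sup>2) * measure m UNIV) * r powr (- \<beta> - 1))"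
    for m :: "(real ^ 'n) measure" and r
  define X where "X = (\<integral>y. power_potential \<beta> (norm (x - y)) \<partial>P i) - (\<integral>y. power_potential \<beta> (norm (x - y)) \<partial>N i)"
  have c: "0 < c"
    using scale_const_pos[OF \<beta>] scale_const_finite[OF \<beta>] by (simp add: c_def enn2real_positive_iff)
  have Z: "0 < Z" unfolding Z_def by (rule gauss_mass_pos)
  note hP = potential_as_heat[OF P[of i] \<beta> neP intP, folded c_def, folded H_def]
  note hN = potential_as_heat[OF N[of i] \<beta> neN intN, folded c_def, folded H_def]
  have "2 * c * X = (\<integral>r. H (P i) r - H (N i) r \<partial>lborel)"
    unfolding X_def using hP hN by (simp add: right_diff_distrib)
  then have "ennreal \<bar>2 * c * X\<bar> \<le> (\<integral>\<^sup>+r. ennreal \<bar>H (P i) r - H (N i) r\<bar> \<partial>lborel)"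
    using integral_norm_bound_ennreal[OF Bochner_Integration.integrable_diff[OF hP(1) hN(1)]] by simp
  also have "\<dots> = (\<integral>\<^sup>+r. ennreal Z * (ennreal (r powr (real CARD('n) - \<beta> - 1)) * ennreal \<bar>G i r x\<bar> * indicator {0<..} r) \<partial>lborel)"
  proof (intro nn_integral_cong)
    fix r :: real
    show "ennreal \<bar>H (P i) r - H (N i) r\<bar> = ennreal Z * (ennreal (r powr (real CARD('n) - \<beta> - 1)) * ennreal \<bar>G i r x\<bar> * indicator {0<..} r)"
    proof (cases "0 < r")
      case True
      have p: "r powr (real CARD('n) - \<beta> - 1) = r ^ CARD('n) * r powr (- \<beta> - 1)"
        using True powr_add[of r "real CARD('n)" "- \<beta> - 1"] by (simp add: powr_realpow algebra_simps)
      have "H (P i) r - H (N i) r = Z * (r powr (real CARD('n) - \<beta> - 1) * G i r x)"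
        unfolding p using True by (simp add: H_def total_flux_zero G_def Z_def algebra_simps)
      then show ?thesis using True Z by (simp add: abs_mult ennreal_mult)
    qed (simp add: H_def)
  qed
  also have "\<dots> = ennreal Z * (\<integral>\<^sup>+r\<in>{0<..}. ennreal (r powr (real CARD('n) - \<beta> - 1)) * ennreal \<bar>G i r x\<bar> \<partial>lborel)"
  proof (rule nn_integral_cmult)
    note [measurable] = measurable_G_scale
    show "(\<lambda>r. ennreal (r powr (real CARD('n) - \<beta> - 1)) * ennreal \<bar>G i r x\<bar> * indicator {0<..} r) \<in> borel_measurable lborel"
      by measurable
  qed
  finally have "ennreal (1 / (2 * c)) * ennreal \<bar>2 * c * X\<bar> \<le> ennreal (1 / (2 * c)) * (ennreal Z *
      (\<integral>\<^sup>+r\<in>{0<..}. ennreal (r powr (real CARD('n) - \<beta> - 1)) * ennreal \<bar>G i r x\<bar> \<partial>lborel))"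
    by (intro mult_left_mono) auto
  moreover have "ennreal (1 / (2 * c)) * ennreal \<bar>2 * c * X\<bar> = ennreal \<bar>X\<bar>"
    using c by (simp add: ennreal_mult[symmetric] abs_mult)
  moreover have "ennreal (1 / (2 * c)) * (ennreal Z * y) = ennreal (Z / (2 * c)) * y" for y
    using c Z by (simp add: ennreal_mult[symmetric] mult.assoc[symmetric])
  ultimately show ?thesis by (simp add: X_def c_def Z_def)
qed

end

section \<open>The maximal estimate\<close>

text \<open>For \<open>\<alpha> < d\<close> the kernel is split into its value \<open>b\<close> at distance \<open>1\<close> and a multiple of
  \<^const>\<open>power_potential\<close>. The two forms of the kernel are treated alike from here on.\<close>

lemma riesz_kernel_form:
  fixes \<alpha> :: real
  assumes "real CARD('n::finite) - 1 < \<alpha>" "\<alpha> \<le> real CARD('n)"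
  obtains a b where "0 < a"
    "\<And>z :: real ^ 'n. z \<noteq> 0 \<Longrightarrow> riesz_kernel \<alpha> z = a * power_potential (real CARD('n) - \<alpha>) (norm z) + b"
proof (cases "\<alpha> = real CARD('n)")
  case True
  define c where "c = 1 / (2 powr (real CARD('n) - 1) * pi powr (real CARD('n) / 2) * Gamma (real CARD('n) / 2))"
  have "0 < Gamma (real CARD('n) / 2)" by (intro Gamma_real_pos) simp
  then have "0 < c" by (simp add: c_def)
  then show thesis
    by (rule that[of c 0]) (simp_all add: True riesz_kernel_def power_potential_def c_def Let_def)
next
  case False
  define \<beta> where "\<beta> = real CARD('n) - \<alpha>"
  have \<beta>: "0 < \<beta>" using False assms by (simp add: \<beta>_def)
  have "1 \<le> real CARD('n)" by (simp add: Suc_leI)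
  then have \<alpha>: "0 < \<alpha>" using assms by linarith
  define c where "c = Gamma (\<beta> / 2) / (pi powr (real CARD('n) / 2) * 2 powr \<alpha> * Gamma (\<alpha> / 2))"
  have "0 < Gamma (\<beta> / 2)" "0 < Gamma (\<alpha> / 2)" using \<alpha> \<beta> by (auto intro!: Gamma_real_pos)
  then have c: "0 < c" by (simp add: c_def)
  show thesis
  proof (rule that[of "c * \<beta>" c])
    show "0 < c * \<beta>" using c \<beta> by simp
    fix z :: "real ^ 'n" assume "z \<noteq> 0"
    have "riesz_kernel \<alpha> z = c * norm z powr - \<beta>"
      using False by (simp add: riesz_kernel_def c_def \<beta>_def Let_def)
    also have "\<dots> = c * \<beta> * power_potential \<beta> (norm z) + c"
      using \<beta> by (simp add: power_potential_def field_simps)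
    finally show "riesz_kernel \<alpha> z = c * \<beta> * power_potential (real CARD('n) - \<alpha>) (norm z) + c"
      by (simp add: \<beta>_def)
  qed
qed

lemma integral_kernel_form:
  fixes m :: "(real ^ 'n::finite) measure"
  assumes m: "finite_borel_measure m" and ne: "AE y in m. y \<noteq> x" and int: "integrable m (\<lambda>y. K (x - y))"
    and K: "\<And>z. z \<noteq> 0 \<Longrightarrow> K z = a * power_potential \<beta> (norm z) + b" and a: "0 < a"
  shows "integrable m (\<lambda>y. power_potential \<beta> (norm (x - y)))"
    "(\<integral>y. K (x - y) \<partial>m) = a * (\<integral>y. power_potential \<beta> (norm (x - y)) \<partial>m) + b * measure m UNIV"
proof -
  interpret m: finite_borel_measure m by fact
  have i: "integrable m (\<lambda>y. (K (x - y) - b) / a)"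
    using int by (intro integrable_divide Bochner_Integration.integrable_diff) auto
  have "AE y in m. (K (x - y) - b) / a = power_potential \<beta> (norm (x - y))"
    using ne by eventually_elim (use a K in \<open>simp add: field_simps\<close>)
  then show I: "integrable m (\<lambda>y. power_potential \<beta> (norm (x - y)))"
    using i by (subst integrable_cong_AE[symmetric, of "\<lambda>y. (K (x - y) - b) / a"]) auto
  have "(\<integral>y. K (x - y) \<partial>m) = (\<integral>y. a * power_potential \<beta> (norm (x - y)) + b \<partial>m)"
    using ne int by (intro integral_cong_AE) (auto simp: K)
  also have "\<dots> = a * (\<integral>y. power_potential \<beta> (norm (x - y)) \<partial>m) + b * measure m UNIV"
    using I by (simp add: m.space_m mult.commute)
  finally show "(\<integral>y. K (x - y) \<partial>m) = a * (\<integral>y. power_potential \<beta> (norm (x - y)) \<partial>m) + b * measure m UNIV" .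
qed

lemma variation_dominates_jordan_pos:
  fixes F :: "(real ^ 'n::finite) set \<Rightarrow> real ^ 'n"
  assumes F: "F \<in> bounded_vector_measures" and A: "A \<in> sets borel"
  shows "emeasure (jordan_pos (\<lambda>A. F A $ i)) A \<le> emeasure (variation_measure F) A"
    "emeasure (jordan_pos (\<lambda>A. - F A $ i)) A \<le> emeasure (variation_measure F) A"
proof -
  note c = component_vector_measure[OF F]
  show "emeasure (jordan_pos (\<lambda>A. F A $ i)) A \<le> emeasure (variation_measure F) A"
    unfolding emeasure_variation_measure[OF F A]
    by (rule order.trans[OF emeasure_jordan_pos_le[OF c(1) A] c(3)])
  show "emeasure (jordan_pos (\<lambda>A. - F A $ i)) A \<le> emeasure (variation_measure F) A"
    unfolding emeasure_variation_measure[OF F A]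
    by (rule order.trans[OF emeasure_jordan_pos_le[OF c(2) A] c(4)])
qed

lemma finite_borel_jordan_pos:
  fixes F :: "(real ^ 'n::finite) set \<Rightarrow> real ^ 'n"
  assumes F: "F \<in> bounded_vector_measures"
  shows "finite_borel_measure (jordan_pos (\<lambda>A. F A $ i))" "finite_borel_measure (jordan_pos (\<lambda>A. - F A $ i))"
proof -
  have fin: "emeasure (variation_measure F) UNIV < \<infinity>"
    using F by (simp add: emeasure_variation_measure total_variation_finite[unfolded infinity_ennreal_def])
  have "finite_borel_measure m" if "sets m = sets borel" "emeasure m UNIV \<le> emeasure (variation_measure F) UNIV" for m :: "(real ^ 'n) measure"
  proof -
    have "space m = UNIV" using sets_eq_imp_space_eq[OF that(1)] by simp
    then have "emeasure m (space m) \<noteq> \<infinity>" using order_le_less_trans[OF that(2) fin] by simp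
    then show ?thesis
      using that(1) by (intro finite_borel_measure.intro finite_measureI finite_borel_measure_axioms.intro)
  qed
  then show "finite_borel_measure (jordan_pos (\<lambda>A. F A $ i))" "finite_borel_measure (jordan_pos (\<lambda>A. - F A $ i))"
    using variation_dominates_jordan_pos[OF F, of UNIV i] by (simp_all add: sets_jordan_pos)
qed

lemma solenoidal_jordan:
  fixes F :: "(real ^ 'n::finite) set \<Rightarrow> real ^ 'n"
  assumes F: "F \<in> bounded_vector_measures" and div: "divergence_free F"
  shows "solenoidal (\<lambda>i. jordan_pos (\<lambda>A. F A $ i)) (\<lambda>i. jordan_pos (\<lambda>A. - F A $ i)) (enn2real (total_variation F UNIV))"
proof (rule solenoidal.intro)
  have tv: "total_variation F UNIV = ennreal (enn2real (total_variation F UNIV))"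
    using total_variation_finite[OF F, of UNIV] by (simp add: less_top)
  show "finite_borel_measure (jordan_pos (\<lambda>A. F A $ i))" "finite_borel_measure (jordan_pos (\<lambda>A. - F A $ i))" for i
    by (rule finite_borel_jordan_pos[OF F])+
  show "emeasure (jordan_pos (\<lambda>A. F A $ i)) UNIV \<le> ennreal (enn2real (total_variation F UNIV))"
    "emeasure (jordan_pos (\<lambda>A. - F A $ i)) UNIV \<le> ennreal (enn2real (total_variation F UNIV))" for i
    using variation_dominates_jordan_pos[OF F, of UNIV i]
    unfolding tv[symmetric] emeasure_variation_measure[OF F sets.top[of borel, unfolded space_borel]] by simp_all
  show "0 \<le> enn2real (total_variation F UNIV)" by simp
  show "(\<Sum>i\<in>UNIV. (\<integral>y. partial_deriv i \<phi> y \<partial>jordan_pos (\<lambda>A. F A $ i)) - (\<integral>y. partial_deriv i \<phi> y \<partial>jordan_pos (\<lambda>A. - F A $ i))) = 0"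
    if "\<phi> \<in> test_functions" for \<phi>
    using div that unfolding divergence_free_def signed_integral_def by blast
qed

text \<open>Absolute convergence with respect to the variation measure passes to the Jordan parts of the
  components, which it dominates. The additive constant of the kernel disappears because the flux
  vanishes.\<close>

lemma riesz_potential_le_heat:
  fixes F :: "(real ^ 'n::finite) set \<Rightarrow> real ^ 'n"
  assumes F: "F \<in> bounded_vector_measures" and div: "divergence_free F"
    and \<alpha>: "real CARD('n) - 1 < \<alpha>" "\<alpha> \<le> real CARD('n)"
    and a: "0 < a" and K: "\<And>z :: real ^ 'n. z \<noteq> 0 \<Longrightarrow> riesz_kernel \<alpha> z = a * power_potential (real CARD('n) - \<alpha>) (norm z) + b"
  defines "\<beta> \<equiv> real CARD('n) - \<alpha>"
    and "g \<equiv> solenoidal.G (\<lambda>i. jordan_pos (\<lambda>A. F A $ i)) (\<lambda>i. jordan_pos (\<lambda>A. - F A $ i))"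
  shows "ennreal (norm (riesz_potential \<alpha> F x)) \<le> ennreal (a * (gauss_mass TYPE('n) / (2 * enn2real (scale_const \<beta>)))) *
      (\<integral>\<^sup>+r\<in>{0<..}. ennreal (r powr (real CARD('n) - \<beta> - 1)) * (\<Sum>i\<in>UNIV. ennreal \<bar>g i r x\<bar>) \<partial>lborel)"
proof (cases "riesz_converges \<alpha> F x")
  case False
  then show ?thesis by (simp add: riesz_potential_def)
next
  case True
  interpret solenoidal "\<lambda>i. jordan_pos (\<lambda>A. F A $ i)" "\<lambda>i. jordan_pos (\<lambda>A. - F A $ i)" "enn2real (total_variation F UNIV)"
    by (rule solenoidal_jordan[OF F div])
  have \<beta>: "0 \<le> \<beta>" "\<beta> < 1" using \<alpha> by (auto simp: \<beta>_def)
  define c where "c = gauss_mass TYPE('n) / (2 * enn2real (scale_const \<beta>))"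
  have c: "0 \<le> c" using gauss_mass_pos[where 'n = 'n] by (simp add: c_def)
  note [measurable] = measurable_G_scale
  have transfer: "AE y in m. y \<noteq> x" "integrable m (\<lambda>y. riesz_kernel \<alpha> (x - y))"
    if m: "sets m = sets borel" and le: "\<And>A. A \<in> sets borel \<Longrightarrow> emeasure m A \<le> emeasure (variation_measure F) A"
    for m :: "(real ^ 'n) measure"
  proof -
    have "emeasure m {x} = 0" using le[of "{x}"] True by (simp add: riesz_converges_def)
    then show "AE y in m. y \<noteq> x"
      using m by (intro AE_I[of _ _ "{x}"]) auto
    have i: "integrable (variation_measure F) (\<lambda>y. riesz_kernel \<alpha> (x - y))"
      using True by (simp add: riesz_converges_def)
    have sv: "sets m = sets (variation_measure F)" using m by (simp add: sets_variation_measure)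
    have "m \<le> variation_measure F" using le m by (subst le_measure[OF sv]) (auto simp: le_fun_def)
    then have "(\<integral>\<^sup>+y. ennreal (norm (riesz_kernel \<alpha> (x - y))) \<partial>m) \<le> (\<integral>\<^sup>+y. ennreal (norm (riesz_kernel \<alpha> (x - y))) \<partial>variation_measure F)"
      using sv by (intro nn_integral_mono_measure) auto
    also have "\<dots> < \<infinity>" using i by (simp add: integrable_iff_bounded)
    finally show "integrable m (\<lambda>y. riesz_kernel \<alpha> (x - y))"
      using borel_measurable_integrable[OF i] measurable_cong_sets[OF sv refl] by (intro integrableI_bounded) auto
  qed
  have comp: "ennreal \<bar>riesz_potential \<alpha> F x $ i\<bar> \<le> ennreal (a * c) *
      (\<integral>\<^sup>+r\<in>{0<..}. ennreal (r powr (real CARD('n) - \<beta> - 1)) * ennreal \<bar>g i r x\<bar> \<partial>lborel)" for i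
  proof -
    define P where "P = jordan_pos (\<lambda>A. F A $ i)"
    define N where "N = jordan_pos (\<lambda>A. - F A $ i)"
    have fb: "finite_borel_measure P" "finite_borel_measure N" unfolding P_def N_def by (rule finite_borel_jordan_pos[OF F])+
    have tP: "AE y in P. y \<noteq> x" "integrable P (\<lambda>y. riesz_kernel \<alpha> (x - y))"
      and tN: "AE y in N. y \<noteq> x" "integrable N (\<lambda>y. riesz_kernel \<alpha> (x - y))"
      unfolding P_def N_def by (rule transfer sets_jordan_pos variation_dominates_jordan_pos[OF F] | assumption)+
    note kP = integral_kernel_form[OF fb(1) tP K a] and kN = integral_kernel_form[OF fb(2) tN K a]
    define X where "X = (\<integral>y. power_potential \<beta> (norm (x - y)) \<partial>P) - (\<integral>y. power_potential \<beta> (norm (x - y)) \<partial>N)"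
    have "riesz_potential \<alpha> F x $ i = (\<integral>y. riesz_kernel \<alpha> (x - y) \<partial>P) - (\<integral>y. riesz_kernel \<alpha> (x - y) \<partial>N)"
      using True by (simp add: riesz_potential_def signed_integral_def P_def N_def)
    also have "\<dots> = a * X"
      using kP(2) kN(2) total_flux_zero[of i] by (simp add: X_def \<beta>_def P_def N_def right_diff_distrib)
    finally have "ennreal \<bar>riesz_potential \<alpha> F x $ i\<bar> = ennreal a * ennreal \<bar>X\<bar>"
      using a by (simp add: abs_mult ennreal_mult)
    also have "ennreal \<bar>X\<bar> \<le> ennreal c * (\<integral>\<^sup>+r\<in>{0<..}. ennreal (r powr (real CARD('n) - \<beta> - 1)) * ennreal \<bar>g i r x\<bar> \<partial>lborel)"
      unfolding X_def c_def g_def P_def N_def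
      by (rule potential_le_heat[OF \<beta> tP(1)[unfolded P_def] tN(1)[unfolded N_def]
            kP(1)[unfolded P_def, folded \<beta>_def] kN(1)[unfolded N_def, folded \<beta>_def]])
    finally show ?thesis using a c by (simp add: ennreal_mult mult.assoc mult_left_mono)
  qed
  have "ennreal (norm (riesz_potential \<alpha> F x)) \<le> ennreal (\<Sum>i\<in>UNIV. \<bar>riesz_potential \<alpha> F x $ i\<bar>)"
    by (intro ennreal_leI norm_le_l1_cart)
  also have "\<dots> = (\<Sum>i\<in>UNIV. ennreal \<bar>riesz_potential \<alpha> F x $ i\<bar>)" by (rule sum_ennreal[symmetric]) simp
  also have "\<dots> \<le> (\<Sum>i\<in>UNIV. ennreal (a * c) *
      (\<integral>\<^sup>+r\<in>{0<..}. ennreal (r powr (real CARD('n) - \<beta> - 1)) * ennreal \<bar>g i r x\<bar> \<partial>lborel))"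
    by (intro sum_mono comp)
  also have "\<dots> = ennreal (a * c) * (\<Sum>i\<in>UNIV. \<integral>\<^sup>+r\<in>{0<..}. ennreal (r powr (real CARD('n) - \<beta> - 1)) * ennreal \<bar>g i r x\<bar> \<partial>lborel)"
    by (rule sum_distrib_left[symmetric])
  also have "(\<Sum>i\<in>UNIV. \<integral>\<^sup>+r\<in>{0<..}. ennreal (r powr (real CARD('n) - \<beta> - 1)) * ennreal \<bar>g i r x\<bar> \<partial>lborel)
      = (\<integral>\<^sup>+r. (\<Sum>i\<in>UNIV. ennreal (r powr (real CARD('n) - \<beta> - 1)) * ennreal \<bar>g i r x\<bar> * indicator {0<..} r) \<partial>lborel)"
    unfolding g_def by (rule nn_integral_sum[symmetric]) measurable
  also have "\<dots> = (\<integral>\<^sup>+r\<in>{0<..}. ennreal (r powr (real CARD('n) - \<beta> - 1)) * (\<Sum>i\<in>UNIV. ennreal \<bar>g i r x\<bar>) \<partial>lborel)"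
    by (intro nn_integral_cong) (simp only: sum_distrib_left sum_distrib_right)
  finally show ?thesis by (simp only: c_def)
qed

theorem theorem1p3:
  fixes \<alpha> :: real
  assumes "real CARD('n::finite) - 1 < \<alpha>" and "\<alpha> \<le> real CARD('n)"
  shows "\<exists>C>0. \<forall>F \<in> (bounded_vector_measures :: ((real ^ 'n) set \<Rightarrow> real ^ 'n) set).
    divergence_free F \<longrightarrow>
      (\<integral>\<^sup>+t\<in>{0<..}.
          hausdorff_content (real CARD('n) - \<alpha>)
            {x. maximal_function (riesz_potential \<alpha> F) x > ennreal t} \<partial>lborel)
        \<le> ennreal C * total_variation F UNIV"
proof -
  define \<beta> where "\<beta> = real CARD('n) - \<alpha>"
  have \<beta>: "0 \<le> \<beta>" "\<beta> < 1" using assms by (auto simp: \<beta>_def)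
  define rc where "rc = scale_recursion_const TYPE('n)"
  have rc: "0 < rc" unfolding rc_def by (rule scale_recursion_const_pos)
  \<comment> \<open>the first entry gives the condition of \<open>local_estimate\<close>, the second one makes the recursion contract\<close>
  define \<theta> where "\<theta> = min (1 / (32 * exp 3)) ((1 / (2 * rc)) powr (1 / (1 - \<beta>)))"
  have th0: "0 < \<theta>" using rc by (simp add: \<theta>_def)
  have th1: "\<theta> \<le> 1 / (32 * exp 3)" by (simp add: \<theta>_def)
  have "\<theta> powr (1 - \<beta>) \<le> ((1 / (2 * rc)) powr (1 / (1 - \<beta>))) powr (1 - \<beta>)"
    using th0 \<beta> by (intro powr_mono2) (auto simp: \<theta>_def)
  also have "\<dots> = 1 / (2 * rc)" using rc \<beta> by (simp add: powr_powr)
  finally have contraction: "scale_recursion_const TYPE('n) * \<theta> powr (1 - \<beta>) \<le> 1 / 2"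
    using rc unfolding rc_def[symmetric] by (simp add: field_simps)
  obtain a b where a: "0 < a" and K: "\<And>z :: real ^ 'n. z \<noteq> 0 \<Longrightarrow> riesz_kernel \<alpha> z = a * power_potential (real CARD('n) - \<alpha>) (norm z) + b"
    using riesz_kernel_form[OF assms] by metis
  define C where "C = averaging_const TYPE('n)"
  have C: "0 < C" unfolding C_def by (rule averaging_const_pos)
  define A1 where "A1 = a * (gauss_mass TYPE('n) / (2 * enn2real (scale_const \<beta>)))"
  define C4 where "C4 = 2 ^ CARD('n) * scale_recursion_const TYPE('n) / (gauss_mass TYPE('n) * \<theta> ^ CARD('n)) * \<theta> powr (\<beta> - real CARD('n) - 1)"
  define E where "E = (\<Sum>l. exp (- \<theta>\<^sup>2 * (real l)\<^sup>2) * (real l + 2) ^ CARD('n) * (real l + 3))"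
  define K1 where "K1 = C * (3 ^ CARD('n) * (2 * real CARD('n)) powr \<beta> * 4) / (1 - 2 powr (\<beta> - 1))"
  define B where "B = 4 * 2 powr \<beta> * (A1 * C4 * (K1 * E * 2 * (2 * real CARD('n))))"
  have A1: "0 \<le> A1" using a gauss_mass_pos[where 'n = 'n] by (simp add: A1_def)
  have C4: "0 \<le> C4" using rc[unfolded rc_def] gauss_mass_pos[where 'n = 'n] th0 by (simp add: C4_def)
  have E: "0 \<le> E" unfolding E_def using th0 by (intro suminf_nonneg summable_gauss_poly) auto
  have "2 powr (\<beta> - 1) < 1" using \<beta> by (simp add: powr_less_one)
  then have K1: "0 \<le> K1" using C by (simp add: K1_def)
  have B: "0 \<le> B" unfolding B_def using A1 C4 K1 E by (intro mult_nonneg_nonneg) auto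
  show ?thesis
  \<comment> \<open>\<open>1\<close> is added because \<open>B\<close> is only known to be nonnegative\<close>
  proof (intro exI[of _ "B + 1"] conjI ballI impI)
    fix F :: "(real ^ 'n) set \<Rightarrow> real ^ 'n"
    assume F: "F \<in> bounded_vector_measures" and div_free: "divergence_free F"
    define M where "M = enn2real (total_variation F UNIV)"
    have tv: "total_variation F UNIV = ennreal M"
      using total_variation_finite[OF F, of UNIV] by (simp add: M_def less_top)
    have M: "0 \<le> M" by (simp add: M_def)
    interpret solenoidal "\<lambda>i. jordan_pos (\<lambda>A. F A $ i)" "\<lambda>i. jordan_pos (\<lambda>A. - F A $ i)" M
      unfolding M_def by (rule solenoidal_jordan[OF F div_free])
    have "ennreal (norm (riesz_potential \<alpha> F y)) \<le> ennreal (A1 * C4) * (\<Sum>n. scale_sum \<theta> \<beta> (int_decode n) y)" for y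
    proof -
      have "ennreal (norm (riesz_potential \<alpha> F y)) \<le> ennreal A1 *
        (\<integral>\<^sup>+r\<in>{0<..}. ennreal (r powr (real CARD('n) - \<beta> - 1)) * (\<Sum>i\<in>UNIV. ennreal \<bar>G i r y\<bar>) \<partial>lborel)"
        unfolding A1_def \<beta>_def by (rule riesz_potential_le_heat[OF F div_free assms a K])
      also have "\<dots> \<le> ennreal A1 * (ennreal C4 * (\<Sum>n. scale_sum \<theta> \<beta> (int_decode n) y))"
        unfolding C4_def by (intro mult_left_mono integral_scales[OF th0 th1 \<beta> contraction]) auto
      finally show ?thesis using A1 C4 by (simp add: ennreal_mult mult.assoc)
    qed
    from atomic_bound_maximal[OF th0 th1 \<beta> contraction mult_nonneg_nonneg[OF A1 C4] this]
    have "atomic_bound \<beta> (maximal_function (riesz_potential \<alpha> F)) (ennreal (A1 * C4 * (K1 * E * 2 * (2 * M * real CARD('n)))))"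
      unfolding E_def K1_def C_def .
    from atomic_bound_choquet[OF \<beta>(1) this]
    have "choquet (hausdorff_content \<beta>) (maximal_function (riesz_potential \<alpha> F))
        \<le> ennreal (4 * 2 powr \<beta> * (A1 * C4 * (K1 * E * 2 * (2 * M * real CARD('n)))))"
      using A1 C4 K1 E M by (auto intro!: mult_nonneg_nonneg)
    also have "4 * 2 powr \<beta> * (A1 * C4 * (K1 * E * 2 * (2 * M * real CARD('n)))) = B * M"
      by (simp add: B_def)
    also have "ennreal (B * M) \<le> ennreal ((B + 1) * M)" using M by (intro ennreal_leI mult_right_mono) auto
    also have "\<dots> = ennreal (B + 1) * total_variation F UNIV" using B M by (simp add: tv ennreal_mult)
    finally show "(\<integral>\<^sup>+t\<in>{0<..}. hausdorff_content (real CARD('n) - \<alpha>)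
            {x. maximal_function (riesz_potential \<alpha> F) x > ennreal t} \<partial>lborel)
        \<le> ennreal (B + 1) * total_variation F UNIV"
      by (simp only: choquet_def \<beta>_def)
  qed (use B in simp)
qed

end
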